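(* In the problem described in the context, with initial point $q_0=(0,0,0)$, optimal trajectories from $q_0$ to $q_1$ are as follows (existence of exactly one or exactly two optimal trajectories is understood up to reparametrization of time). (1) Let $q_1\in(\operatorname{int}\mathcal A_1)\setminus\Pi$. Then there exists a unique optimal trajectory $\operatorname{Exp}(\lambda,t)$, $t\in[0,t_1]$, where $(\lambda,t_1)$ is the unique preimage of $q_1$ under $\operatorname{Exp}$ in $N_+\cup N_-$. (2) Let $q_1\in(\operatorname{int}\mathcal A_1)\cap\Pi$. Then there exist exactly two optimal trajectories $\operatorname{Exp}(\lambda_i,t)$, $t\in[0,t_1]$, $i=1,2$, where $\{(\lambda_1,t_1),(\lambda_2,t_1)\}$ is the set of preimages of $q_1$ under $\operatorname{Exp}$ in $N_0$. (3) Let $q_1=(x_1,y_1,z_1)\in S_1\cup S_2$ with $\operatorname{sgn}x_1=\pm1$. Then there exists a unique optimal trajectory $$q(t)=\begin{cases}e^{t(\pm X_1+X_2)}(q_0),& t\in[0,\tau_1],\\ e^{(t-\tau_1)(\mp X_1+X_2)}\circ e^{\tau_1(\pm X_1+X_2)}(q_0),& t\in[\tau_1,t_1],\end{cases}$$ with $\tau_1=(y_1\pm x_1)/2$, $t_1=y_1$. (4) Let $q_1=(x_1,y_1,z_1)\in S_3\cup S_4$ with $\operatorname{sgn}x_1=\pm1$. Then there exists a unique optimal trajectory $$q(t)=\begin{cases}e^{tX_2}(q_0),& t\in[0,\tau_1],\\ e^{(t-\tau_1)(\pm X_1+X_2)}\circ e^{\tau_1X_2}(q_0),& t\in[\tau_1,t_1],\end{cases}$$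 with $\tau_1=y_1\mp x_1$, $t_1=y_1$. (5) Let $q_1=(0,y_1,0)$, $y_1>0$. Then there exists a unique optimal trajectory $q(t)=e^{tX_2}(q_0)$, $t\in[0,t_1]$, $t_1=y_1$. (6) Let $q_1=(0,y_1,z_1)$, $z_1=y_1^3/24>0$. Then there exist exactly two optimal trajectories $$q^1(t)=\begin{cases}e^{t(X_1+X_2)}(q_0),& t\in[0,\tau_1],\\ e^{(t-\tau_1)(-X_1+X_2)}\circ e^{\tau_1(X_1+X_2)}(q_0),& t\in[\tau_1,t_1],\end{cases}$$ $$q^2(t)=\begin{cases}e^{t(-X_1+X_2)}(q_0),& t\in[0,\tau_1],\\ e^{(t-\tau_1)(X_1+X_2)}\circ e^{\tau_1(-X_1+X_2)}(q_0),& t\in[\tau_1,t_1],\end{cases}$$ with $\tau_1=t_1/2$, $t_1=y_1$. (7) Let $q_1=(x_1,y_1,z_1)$, $\operatorname{sgn}x_1=\pm1$, $y_1=\pm x_1$, $z_1=y_1^3/6$. Then there exists a unique optimal trajectory $q(t)=e^{t(\pm X_1+X_2)}(q_0)$, $t\in[0,t_1]$, $t_1=y_1$. In each item the upper signs correspond to $\operatorname{sgn}x_1=1$ and the lower signs to $\operatorname{sgn}x_1=-1$.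
   Context: Let $M=\mathbb R^3$ with coordinates $(x,y,z)$, $X_1=\frac{\partial}{\partial x}$, $X_2=\frac{\partial}{\partial y}+\frac{x^2}{2}\frac{\partial}{\partial z}$, $U_1=\{(u_1,u_2)\in\mathbb R^2: u_2\ge|u_1|\}$, $\Pi=\{x=0\}$; $e^{tX}$ denotes the flow of a vector field $X$. An admissible trajectory is a Lipschitz curve $q:[0,t_1]\to M$ ($t_1\ge0$ free) with $\dot q=u_1X_1(q)+u_2X_2(q)$ a.e. for some bounded measurable control $u:[0,t_1]\to U_1$; its length is $l=\int_0^{t_1}\sqrt{u_2^2-u_1^2}\,dt$. It is optimal if its length is maximal among all admissible trajectories with the same endpoints. $\mathcal A_1$ is the set of endpoints of admissible trajectories starting at $q_0$. Exponential mapping. For $\lambda=(\psi_0,c)\in\mathbb R^2$ let $(\psi,x,y,z)(t)$ be the solution of $\dot\psi=-cx$, $\dot x=\sinh\psi$, $\dot y=\cosh\psi$, $\dot z=\frac{x^2}{2}\cosh\psi$ ($c$ constant) with $\psi(0)=\psi_0$, $x(0)=y(0)=z(0)=0$; set $\operatorname{Exp}(\lambda,t)=(x(t),y(t),z(t))$. The function $\mathbf t:\mathbb R^2\to(0,+\infty]$. Let $K(k)=\int_0^{\pi/2}\frac{d\theta}{\sqrt{1-k^2\sin^2\theta}}$. Put $\mathbf t(\psi_0,c)=+\infty$ if $c=0$ or $\psi_0=0$; for $c>0$, $\psi_0\ne0$, $\mathbf t(\psi_0,c)=\frac{2\sqrt{1-k^2}\,K(k)}{\sqrt c}$ with $k=\sqrt{\frac{\cosh\psi_0-1}{\cosh\psi_0+1}}$;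 for $c<0$, $\psi_0\ne0$, $\mathbf t(\psi_0,c)=\frac{k\,K(k)}{\sqrt{-c}}$ with $k=\sqrt{\frac{2}{1+\cosh\psi_0}}$ (in this last case the solution exists exactly for $0\le t<\mathbf t$ in forward time). Set $N_\pm=\{(\psi_0,c,t): \pm\psi_0>0,\ 0<t<\mathbf t(\psi_0,c)\}$ and $N_0=\{(\psi_0,c,t): c>0,\ \psi_0\ne0,\ t=\mathbf t(\psi_0,c)\}$. Surfaces (all with $y>0$): $S_1=\{0\le x\le y,\ z=\frac{1}{24}(-3x^3+3x^2y+3xy^2+y^3)\}$, $S_2=\{-y\le x\le0,\ z=\frac1{24}(3x^3+3x^2y-3xy^2+y^3)\}$, $S_3=\{0\le x\le y,\ z=x^3/6\}$, $S_4=\{-y\le x\le 0,\ z=-x^3/6\}$. *)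

theory Defs
  imports "HOL-Analysis.Analysis"
begin

type_synonym R3 = "real \<times> real \<times> real"

definition q0 :: R3 where
  "q0 = (0, 0, 0)"

definition X1 :: "R3 \<Rightarrow> R3" where
  "X1 = (\<lambda>(x, y, z). (1, 0, 0))"

definition X2 :: "R3 \<Rightarrow> R3" where
  "X2 = (\<lambda>(x, y, z). (0, 1, x\<^sup>2 / 2))"

definition X_comb :: "real \<Rightarrow> real \<Rightarrow> R3 \<Rightarrow> R3" where
  "X_comb u1 u2 p = u1 *\<^sub>R X1 p + u2 *\<^sub>R X2 p"

definition U1 :: "(real \<times> real) set" where
  "U1 = {(u1, u2). u2 \<ge> \<bar>u1\<bar>}"

definition plane_x0 :: "R3 set" where
  "plane_x0 = {(x, y, z). x = 0}"

text \<open>The value at time \<open>t\<close> of the integral curve of \<open>X\<close> issuing from \<open>p\<close>. It is meaningful only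
  if that curve exists on the whole time interval between \<open>0\<close> and \<open>t\<close> and is unique there.\<close>

definition flow :: "('a::real_normed_vector \<Rightarrow> 'a) \<Rightarrow> real \<Rightarrow> 'a \<Rightarrow> 'a" where
  "flow X t p = (THE r. \<exists>\<gamma>. \<gamma> 0 = p \<and> \<gamma> t = r \<and>
     (\<forall>s \<in> closed_segment 0 t.
        (\<gamma> has_vector_derivative X (\<gamma> s)) (at s within closed_segment 0 t)))"

definition admissible :: "(real \<Rightarrow> R3) \<Rightarrow> (real \<Rightarrow> real \<times> real) \<Rightarrow> real \<Rightarrow> bool" where
  "admissible q u T \<longleftrightarrow>
     0 \<le> T \<and>
     (\<exists>L. L-lipschitz_on {0..T} q) \<and>
     u \<in> borel_measurable (lebesgue_on {0..T}) \<and>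
     bounded (u ` {0..T}) \<and>
     (\<forall>t \<in> {0..T}. u t \<in> U1) \<and>
     (AE t in lebesgue_on {0..T}.
        (q has_vector_derivative X_comb (fst (u t)) (snd (u t)) (q t)) (at t within {0..T}))"

text \<open>The first two components of \<open>q\<close> determine the control almost everywhere, so the length
  depends only on the curve although it is written in terms of the control.\<close>

definition traj_length :: "(real \<Rightarrow> real \<times> real) \<Rightarrow> real \<Rightarrow> real" where
  "traj_length u T = (LINT t|lebesgue_on {0..T}. sqrt ((snd (u t))\<^sup>2 - (fst (u t))\<^sup>2))"

definition attainable :: "R3 \<Rightarrow> R3 set" where
  "attainable p = {r. \<exists>q u T. admissible q u T \<and> q 0 = p \<and> q T = r}"

definition optimal_traj :: "R3 \<Rightarrow> R3 \<Rightarrow> (real \<Rightarrow> R3) \<Rightarrow> real \<Rightarrow> bool" where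
  "optimal_traj p r q T \<longleftrightarrow>
     (\<exists>u. admissible q u T \<and> q 0 = p \<and> q T = r \<and>
        (\<forall>q' u' T'. admissible q' u' T' \<and> q' 0 = p \<and> q' T' = r
            \<longrightarrow> traj_length u' T' \<le> traj_length u T))"

text \<open>Admissible curves may rest (\<open>u = 0\<close>) on time intervals of positive length, so a change of time
  is only required to be nondecreasing. Two curves are identified if they become equal after
  suitable changes of time from the common parameter interval \<open>[0, 1]\<close>.\<close>

definition time_change :: "(real \<Rightarrow> real) \<Rightarrow> real \<Rightarrow> bool" where
  "time_change \<phi> T \<longleftrightarrow> continuous_on {0..1} \<phi> \<and> mono_on {0..1} \<phi> \<and> \<phi> 0 = 0 \<and> \<phi> 1 = T"

definition same_up_to_time :: "(real \<Rightarrow> R3) \<Rightarrow> real \<Rightarrow> (real \<Rightarrow> R3) \<Rightarrow> real \<Rightarrow> bool" where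
  "same_up_to_time p S q T \<longleftrightarrow>
     (\<exists>\<phi> \<psi>. time_change \<phi> S \<and> time_change \<psi> T \<and> (\<forall>s \<in> {0..1}. p (\<phi> s) = q (\<psi> s)))"

definition unique_optimal :: "R3 \<Rightarrow> R3 \<Rightarrow> (real \<Rightarrow> R3) \<Rightarrow> real \<Rightarrow> bool" where
  "unique_optimal p r q T \<longleftrightarrow>
     optimal_traj p r q T \<and>
     (\<forall>q' T'. optimal_traj p r q' T' \<longrightarrow> same_up_to_time q' T' q T)"

definition exactly_two_optimal ::
  "R3 \<Rightarrow> R3 \<Rightarrow> (real \<Rightarrow> R3) \<Rightarrow> real \<Rightarrow> (real \<Rightarrow> R3) \<Rightarrow> real \<Rightarrow> bool" where
  "exactly_two_optimal p r qa Ta qb Tb \<longleftrightarrow>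
     optimal_traj p r qa Ta \<and> optimal_traj p r qb Tb \<and>
     \<not> same_up_to_time qa Ta qb Tb \<and>
     (\<forall>q' T'. optimal_traj p r q' T' \<longrightarrow>
        same_up_to_time q' T' qa Ta \<or> same_up_to_time q' T' qb Tb)"

definition extremal_field :: "real \<Rightarrow> real \<times> R3 \<Rightarrow> real \<times> R3" where
  "extremal_field c = (\<lambda>(\<psi>, x, y, z). (- c * x, sinh \<psi>, cosh \<psi>, x\<^sup>2 / 2 * cosh \<psi>))"

definition Exp :: "real \<times> real \<Rightarrow> real \<Rightarrow> R3" where
  "Exp = (\<lambda>(\<psi>0, c) t. snd (flow (extremal_field c) t (\<psi>0, 0, 0, 0)))"

definition ell_K :: "real \<Rightarrow> real" where
  "ell_K k = integral {0..pi / 2} (\<lambda>\<theta>. 1 / sqrt (1 - k\<^sup>2 * (sin \<theta>)\<^sup>2))"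

definition t_bound :: "real \<Rightarrow> real \<Rightarrow> ereal" where
  "t_bound \<psi>0 c =
     (if c = 0 \<or> \<psi>0 = 0 then \<infinity>
      else if c > 0 then
        (let k = sqrt ((cosh \<psi>0 - 1) / (cosh \<psi>0 + 1))
         in ereal (2 * sqrt (1 - k\<^sup>2) * ell_K k / sqrt c))
      else
        (let k = sqrt (2 / (1 + cosh \<psi>0))
         in ereal (k * ell_K k / sqrt (- c))))"

definition N_plus :: "((real \<times> real) \<times> real) set" where
  "N_plus = {((\<psi>0, c), t). \<psi>0 > 0 \<and> 0 < t \<and> ereal t < t_bound \<psi>0 c}"

definition N_minus :: "((real \<times> real) \<times> real) set" where
  "N_minus = {((\<psi>0, c), t). \<psi>0 < 0 \<and> 0 < t \<and> ereal t < t_bound \<psi>0 c}"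

definition N_zero :: "((real \<times> real) \<times> real) set" where
  "N_zero = {((\<psi>0, c), t). c > 0 \<and> \<psi>0 \<noteq> 0 \<and> ereal t = t_bound \<psi>0 c}"

definition Exp_preimages :: "((real \<times> real) \<times> real) set \<Rightarrow> R3 \<Rightarrow> ((real \<times> real) \<times> real) set" where
  "Exp_preimages N q = {(lam, t) \<in> N. Exp lam t = q}"

definition S1 :: "R3 set" where
  "S1 = {(x, y, z). y > 0 \<and> 0 \<le> x \<and> x \<le> y \<and>
           z = (- 3 * x^3 + 3 * x^2 * y + 3 * x * y^2 + y^3) / 24}"

definition S2 :: "R3 set" where
  "S2 = {(x, y, z). y > 0 \<and> - y \<le> x \<and> x \<le> 0 \<and>
           z = (3 * x^3 + 3 * x^2 * y - 3 * x * y^2 + y^3) / 24}"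

definition S3 :: "R3 set" where
  "S3 = {(x, y, z). y > 0 \<and> 0 \<le> x \<and> x \<le> y \<and> z = x^3 / 6}"

definition S4 :: "R3 set" where
  "S4 = {(x, y, z). y > 0 \<and> - y \<le> x \<and> x \<le> 0 \<and> z = - (x^3) / 6}"

text \<open>Follow \<open>X\<close> from \<open>q0\<close> up to time \<open>\<tau>\<close>, then switch to \<open>Y\<close>.\<close>

definition two_arcs :: "(R3 \<Rightarrow> R3) \<Rightarrow> real \<Rightarrow> (R3 \<Rightarrow> R3) \<Rightarrow> real \<Rightarrow> R3" where
  "two_arcs X \<tau> Y t = (if t \<le> \<tau> then flow X t q0 else flow Y (t - \<tau>) (flow X \<tau> q0))"

end

theory Submission
  imports Defs
begin

text \<open>
  Along an admissible curve \<open>y\<close> is nondecreasing and \<open>\<bar>dx\<bar> \<le> dy\<close>, so \<open>y\<close> is the natural parameter: the curve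
  becomes a 1-Lipschitz function \<open>x(y)\<close> on \<open>[0, Y]\<close> with \<open>z = \<integral> x\<^sup>2 / 2 dy\<close>, and the length to be maximised is
  \<open>\<integral> sqrt (1 - x'\<^sup>2) dy\<close>. With \<open>P = sinh \<psi>\<close> the extremals are the solutions of
  \<open>X' = P / sqrt (1 + P\<^sup>2)\<close>, \<open>P' = - c X\<close>. The clock \<open>Tm\<close> with \<open>Tm' = 1 / sqrt (1 + P\<^sup>2)\<close> is at once
  the time of the exponential mapping and the length. In contrast to the time parameter, the parameter
  \<open>y\<close> makes every extremal globally defined.

  For fixed \<open>c\<close> the functional \<open>length + c z\<close> is concave in \<open>w = x\<^sup>2\<close>: its integrand
  is \<open>sqrt (1 - w'\<^sup>2 / (4 w)) + c w / 2\<close>. Hence an extremal that stays positive between its endpoints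
  maximises the functional among all curves with the same \<open>x\<close>- and \<open>y\<close>-endpoints, whatever their \<open>z\<close>:
  \<open>length \<le> Tm Y + c (Z Y - z)\<close>. Concretely, the costate \<open>- P / (2 X)\<close>
  of \<open>w\<close> gives a calibration whose rate exceeds the speed by a positive multiple of a sum of two squares
  (\<open>calibration_identity\<close>). The squares also show what equality means: \<open>x / X(y)\<close> is constant along the
  curve. So a competitor of equal length with the same endpoint is \<open>\<plusminus>X\<close>, which leaves one curve if
  \<open>x\<^sub>1 \<noteq> 0\<close> and two if \<open>x\<^sub>1 = 0\<close> (\<open>calibration\<close>, \<open>reaches_unique\<close>, \<open>reaches_two\<close>).

  The same comparison makes the exponential mapping injective: two positive extremals with the same
  endpoint, even for different \<open>c\<close>, bound each other's length, so equality holds and they are proportional, hence equal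
  (\<open>extremal_pair_unique\<close>).

  For surjectivity fix \<open>\<xi> > 0\<close>. For each \<open>c\<close> shooting in the initial momentum yields a positive extremal
  with \<open>X Y = \<xi>\<close> (\<open>hits_ex\<close>), and by calibration only one (\<open>hits_unique\<close>); a function with compact
  graph is continuous, so the final \<open>z\<close> depends continuously on \<open>c\<close>. Comparing the extremal with the
  curves that realise the greatest and the least possible \<open>z\<close> shows that \<open>z\<close> gets within \<open>Y / \<bar>c\<bar>\<close>
  of these values, so all intermediate values are attained (\<open>hits_all_positive\<close>). Endpoints on \<open>x = 0\<close> are limits as \<open>\<xi> \<rightarrow> 0\<close> (\<open>hits_all_zero\<close>).

  The time bound comes from an angle \<open>\<phi>\<close> on the energy level: \<open>tanh (\<psi> / 2) = k cos \<phi>\<close> for \<open>c > 0\<close> and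
  \<open>1 / cosh (\<psi> / 2) = k cos \<phi>\<close> for \<open>c < 0\<close>. In this angle everything but \<open>y\<close> and \<open>t\<close> is elementary, and the
  first zero of \<open>X\<close>, respectively the escape to infinity, happens at the time given by the complete
  elliptic integral (\<open>oscillating_extremal\<close>, \<open>monotone_extremal\<close>). Thus \<open>t < t_bound \<psi>\<^sub>0 c\<close>, for \<open>\<psi>\<^sub>0 > 0\<close>, says
  precisely that \<open>X\<close> is positive after time \<open>0\<close> up to and including time \<open>t\<close> (\<open>t_bound_positivity\<close>).

  For boundary points the Lipschitz bound alone suffices: it gives \<open>\<bar>x\<bar>\<^sup>3 / 6 \<le> z \<le> zig 0 \<bar>x\<bar> y\<close>, and equality at the
  endpoint determines \<open>\<bar>x\<bar>\<close> as a function of \<open>y\<close> (\<open>upper_rigid\<close>, \<open>lower_rigid\<close>). Hence the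
  attaining curves are the only competitors, up to the sign of \<open>x\<close> and a change of time.
\<close>

section \<open>Lipschitz functions and the fundamental theorem of calculus\<close>

definition Lip :: "real set \<Rightarrow> (real \<Rightarrow> real) \<Rightarrow> bool" where
  "Lip S f \<longleftrightarrow> (\<exists>L. L-lipschitz_on S f)"

lemma LipE:
  assumes "Lip S f"
  obtains L where "L > 0" "\<And>s t. s \<in> S \<Longrightarrow> t \<in> S \<Longrightarrow> \<bar>f s - f t\<bar> \<le> L * \<bar>s - t\<bar>"
proof -
  obtain L where L: "L-lipschitz_on S f" using assms by (auto simp: Lip_def)
  have "\<bar>f s - f t\<bar> \<le> (L + 1) * \<bar>s - t\<bar>" if "s \<in> S" "t \<in> S" for s t
    using lipschitz_onD[OF L that] mult_right_mono[of L "L+1" "\<bar>s - t\<bar>"] by (simp add: dist_real_def)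
  then show ?thesis using that[of "L+1"] lipschitz_on_nonneg[OF L] by simp
qed

lemma LipI:
  assumes "\<And>s t. s \<in> S \<Longrightarrow> t \<in> S \<Longrightarrow> \<bar>f s - f t\<bar> \<le> L * \<bar>s - t\<bar>"
  shows "Lip S f"
  unfolding Lip_def
proof (rule exI[of _ "\<bar>L\<bar>"], rule lipschitz_onI)
  fix s t assume "s \<in> S" "t \<in> S"
  then show "dist (f s) (f t) \<le> \<bar>L\<bar> * dist s t"
    using order_trans[OF assms[of s t] mult_right_mono[of L "\<bar>L\<bar>" "\<bar>s - t\<bar>"]] by (simp add: dist_real_def)
qed simp

lemma Lip_subset: "Lip S f \<Longrightarrow> T \<subseteq> S \<Longrightarrow> Lip T f"
  unfolding Lip_def using lipschitz_on_subset by blast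

lemma Lip_continuous: "Lip S f \<Longrightarrow> continuous_on S f"
  unfolding Lip_def using lipschitz_on_continuous_on by blast

lemma Lip_const: "Lip S (\<lambda>_. c)"
  unfolding Lip_def using lipschitz_on_constant by blast

lemma Lip_id: "Lip S (\<lambda>t. t)" by (rule LipI[where L=1]) auto

lemma Lip_add: "Lip S f \<Longrightarrow> Lip S g \<Longrightarrow> Lip S (\<lambda>t. f t + g t)"
  unfolding Lip_def using lipschitz_on_add by blast

lemma Lip_diff: "Lip S f \<Longrightarrow> Lip S g \<Longrightarrow> Lip S (\<lambda>t. f t - g t)"
  unfolding Lip_def using lipschitz_on_diff by blast

lemma Lip_bounded:
  assumes "Lip {a..b} f"
  obtains B where "B > 0" "\<And>t. t \<in> {a..b} \<Longrightarrow> \<bar>f t\<bar> \<le> B"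
proof -
  have "compact (f ` {a..b})"
    using compact_continuous_image[OF Lip_continuous[OF assms]] by simp
  then have "bounded (f ` {a..b})" by (rule compact_imp_bounded)
  then show ?thesis using that unfolding bounded_pos by (auto simp: image_iff)
qed

lemma Lip_mult:
  assumes "Lip {a..b} f" "Lip {a..b} g"
  shows "Lip {a..b} (\<lambda>t. f t * g t)"
proof -
  obtain B where B: "B > 0" "\<And>t. t \<in> {a..b} \<Longrightarrow> \<bar>f t\<bar> \<le> B" using Lip_bounded[OF assms(1)] by metis
  obtain C where C: "C > 0" "\<And>t. t \<in> {a..b} \<Longrightarrow> \<bar>g t\<bar> \<le> C" using Lip_bounded[OF assms(2)] by metis
  obtain L where L: "L > 0" "\<And>s t. s \<in> {a..b} \<Longrightarrow> t \<in> {a..b} \<Longrightarrow> \<bar>f s - f t\<bar> \<le> L * \<bar>s - t\<bar>"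
    using LipE[OF assms(1)] by metis
  obtain M where M: "M > 0" "\<And>s t. s \<in> {a..b} \<Longrightarrow> t \<in> {a..b} \<Longrightarrow> \<bar>g s - g t\<bar> \<le> M * \<bar>s - t\<bar>"
    using LipE[OF assms(2)] by metis
  show ?thesis
  proof (rule LipI[where L="B * M + L * C"])
    fix s t assume st: "s \<in> {a..b}" "t \<in> {a..b}"
    have "\<bar>f s * g s - f t * g t\<bar> = \<bar>f s * (g s - g t) + (f s - f t) * g t\<bar>" by (simp add: algebra_simps)
    also have "\<dots> \<le> \<bar>f s\<bar> * \<bar>g s - g t\<bar> + \<bar>f s - f t\<bar> * \<bar>g t\<bar>"
      by (metis abs_mult abs_triangle_ineq)
    also have "\<dots> \<le> B * (M * \<bar>s - t\<bar>) + (L * \<bar>s - t\<bar>) * C"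
      using B C L(1) M(1) B(2)[OF st(1)] C(2)[OF st(2)] L(2)[OF st] M(2)[OF st]
      by (intro add_mono mult_mono) auto
    finally show "\<bar>f s * g s - f t * g t\<bar> \<le> (B * M + L * C) * \<bar>s - t\<bar>" by (simp add: algebra_simps)
  qed
qed

text \<open>Composing a Lipschitz function with a \<open>C\<^sup>1\<close> one keeps it within reach of
  \<open>Lip_fundamental_theorem\<close>; the calibration is evaluated along curves that are merely Lipschitz.\<close>
lemma Lip_compose_C1:
  assumes f: "Lip S f" "\<And>t. t \<in> S \<Longrightarrow> f t \<in> {p..q}"
    and h: "\<And>r. r \<in> {p..q} \<Longrightarrow> (h has_real_derivative h' r) (at r within {p..q})"
    and c: "continuous_on {p..q} h'"
  shows "Lip S (\<lambda>t. h (f t))"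
proof -
  have "bounded (h' ` {p..q})"
    using compact_continuous_image[OF c] by (simp add: compact_imp_bounded)
  then obtain B where B: "B > 0" "\<And>r. r \<in> {p..q} \<Longrightarrow> \<bar>h' r\<bar> \<le> B"
    unfolding bounded_pos by (auto simp: image_iff)
  have "B-lipschitz_on {p..q} h"
  proof (rule bounded_derivative_imp_lipschitz)
    fix r assume "r \<in> {p..q}"
    then show "(h has_derivative (*) (h' r)) (at r within {p..q})"
      using h has_field_derivative_def by blast
    show "onorm ((*) (h' r)) \<le> B"
      by (rule onorm_le) (use B(2)[OF \<open>r \<in> {p..q}\<close>] in \<open>auto simp: abs_mult mult_right_mono\<close>)
  qed (use B in auto)
  then have hL: "Lip {p..q} h" unfolding Lip_def by blast
  obtain L where L: "L > 0" "\<And>s t. s \<in> S \<Longrightarrow> t \<in> S \<Longrightarrow> \<bar>f s - f t\<bar> \<le> L * \<bar>s - t\<bar>"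
    using LipE[OF f(1)] by metis
  obtain M where M: "M > 0" "\<And>s t. s \<in> {p..q} \<Longrightarrow> t \<in> {p..q} \<Longrightarrow> \<bar>h s - h t\<bar> \<le> M * \<bar>s - t\<bar>"
    using LipE[OF hL] by metis
  show ?thesis
  proof (rule LipI[where L="M * L"])
    fix s t assume st: "s \<in> S" "t \<in> S"
    have "\<bar>h (f s) - h (f t)\<bar> \<le> M * \<bar>f s - f t\<bar>" using M(2) f(2) st by blast
    also have "\<dots> \<le> M * (L * \<bar>s - t\<bar>)" using M(1) L(2)[OF st] by simp
    finally show "\<bar>h (f s) - h (f t)\<bar> \<le> M * L * \<bar>s - t\<bar>" by (simp add: mult.assoc)
  qed
qed

text \<open>The difference quotients of a Lipschitz function are bounded by its Lipschitz constant, so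
  dominated convergence passes to the derivative, and their integrals telescope to averages of \<open>f\<close> at
  the two ends.\<close>
theorem Lip_fundamental_theorem:
  fixes f g :: "real \<Rightarrow> real"
  assumes ab: "a \<le> b" and lip: "Lip {a..b} f" and N: "negligible N"
    and der: "\<And>t. t \<in> {a..b} - N \<Longrightarrow> (f has_real_derivative g t) (at t within {a..b})"
  shows "(g has_integral (f b - f a)) {a..b}"
proof -
  \<comment> \<open>continues \<open>f\<close> beyond \<open>b\<close> by a constant, so that forward quotients exist on all of \<open>[a, b]\<close>\<close>
  define e where "e = (\<lambda>t. f (min t b))"
  obtain L where L: "L > 0" "\<And>s t. s \<in> {a..b} \<Longrightarrow> t \<in> {a..b} \<Longrightarrow> \<bar>f s - f t\<bar> \<le> L * \<bar>s - t\<bar>"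
    using LipE[OF lip] by metis
  have eL: "\<bar>e s - e t\<bar> \<le> L * \<bar>s - t\<bar>" if "s \<ge> a" "t \<ge> a" for s t
  proof -
    have "\<bar>e s - e t\<bar> \<le> L * \<bar>min s b - min t b\<bar>"
      unfolding e_def using that ab by (intro L(2)) auto
    also have "\<dots> \<le> L * \<bar>s - t\<bar>" using L(1) by (intro mult_left_mono) (auto simp: min_def)
    finally show ?thesis .
  qed
  have e_cont: "continuous_on {a..} e"
    by (rule Lip_continuous, rule LipI[where L=L]) (use eL in auto)
  have e_int: "e integrable_on {s..t}" if "a \<le> s" for s t
    by (rule integrable_continuous_real, rule continuous_on_subset[OF e_cont]) (use that in auto)
  define h where "h = (\<lambda>n::nat. inverse (real (Suc n)))"
  have h_pos: "h n > 0" and h_le: "h n \<le> 1" for n by (auto simp: h_def field_simps)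
  have h_lim: "h \<longlonglongrightarrow> 0" unfolding h_def by (rule LIMSEQ_inverse_real_of_nat)
  define Q where "Q = (\<lambda>n t. (e (t + h n) - e t) / h n)"
  define M where "M = insert b N"
  have M: "negligible M" using N by (simp add: M_def)
  define Q' where "Q' = (\<lambda>n t. if t \<in> M then 0 else Q n t)"
  define g' where "g' = (\<lambda>t. if t \<in> M then 0 else g t)"
  have Qint: "(Q n has_integral (integral {b..b + h n} e - integral {a..a + h n} e) / h n) {a..b}" for n
  proof -
    have 1: "((\<lambda>t. e (t + h n)) has_integral integral {a + h n..b + h n} e) {a..b}"
    proof -
      have "(e has_integral integral {a + h n..b + h n} e) ((\<lambda>t. t + h n) ` {a..b})"
        using e_int[of "a + h n" "b + h n"] h_pos[of n] by (simp add: integrable_integral less_imp_le)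
      then have "(e has_integral integral {a + h n..b + h n} e) {a + h n..b + h n}" by simp
      from has_integral_affinity'[OF this[unfolded box_real[symmetric] cbox_interval[symmetric]], of 1 "h n"]
      show ?thesis by simp
    qed
    have eqs: "integral {a..b} e + integral {b..b + h n} e = integral {a..b + h n} e"
      "integral {a..a + h n} e + integral {a + h n..b + h n} e = integral {a..b + h n} e"
      using e_int ab h_pos[of n] by (auto intro!: Henstock_Kurzweil_Integration.integral_combine)
    have "((\<lambda>t. (e (t + h n) - e t) / h n) has_integral (integral {a + h n..b + h n} e - integral {a..b} e) / h n) {a..b}"
      by (intro has_integral_divide has_integral_diff 1 integrable_integral e_int order_refl)
    moreover have "integral {a + h n..b + h n} e - integral {a..b} e = integral {b..b + h n} e - integral {a..a + h n} e"
      using eqs by linarith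
    ultimately show ?thesis by (simp add: Q_def)
  qed
  have Q'int: "(Q' n has_integral (integral {b..b + h n} e - integral {a..a + h n} e) / h n) {a..b}" for n
    by (rule has_integral_spike[OF M _ Qint]) (auto simp: Q'_def)
  have dc: "g' integrable_on {a..b}" "(\<lambda>n. integral {a..b} (Q' n)) \<longlonglongrightarrow> integral {a..b} g'"
  proof -
    have i: "Q' n integrable_on {a..b}" for n using Q'int by blast
    have ii: "(\<lambda>_. L) integrable_on {a..b}" by (rule integrable_const_ivl)
    have iii: "norm (Q' n t) \<le> L" if "t \<in> {a..b}" for n t
    proof -
      have "\<bar>e (t + h n) - e t\<bar> \<le> L * h n" using eL[of "t + h n" t] that h_pos[of n] by auto
      then have "\<bar>Q n t\<bar> \<le> L" using h_pos[of n] by (simp add: Q_def field_simps)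
      then show ?thesis using L(1) by (auto simp: Q'_def)
    qed
    have iv: "(\<lambda>n. Q' n t) \<longlonglongrightarrow> g' t" if t: "t \<in> {a..b}" for t
    proof (cases "t \<in> M")
      case True then show ?thesis by (simp add: Q'_def g'_def)
    next
      case False
      then have tb: "t < b" and tN: "t \<notin> N" using t by (auto simp: M_def)
      have ev: "\<forall>\<^sub>F n in sequentially. h n < b - t"
        using order_tendstoD(2)[OF h_lim, of "b - t"] tb by simp
      have "((\<lambda>s. (f s - f t) / (s - t)) \<longlongrightarrow> g t) (at t within {a..b})"
        using der[of t] t tN by (simp add: has_field_derivative_iff)
      moreover have "filterlim (\<lambda>n. t + h n) (at t within {a..b}) sequentially"
        unfolding filterlim_at
      proof
        show "\<forall>\<^sub>F n in sequentially. t + h n \<in> {a..b} \<and> t + h n \<noteq> t"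
          using ev
        proof eventually_elim
          case (elim n) then show ?case using t h_pos[of n] by auto
        qed
        show "(\<lambda>n. t + h n) \<longlonglongrightarrow> t" using tendsto_add[OF tendsto_const[of t] h_lim] by simp
      qed
      ultimately have "(\<lambda>n. (f (t + h n) - f t) / (t + h n - t)) \<longlonglongrightarrow> g t"
        by (rule filterlim_compose)
      moreover have "\<forall>\<^sub>F n in sequentially. (f (t + h n) - f t) / (t + h n - t) = Q' n t"
        using ev
      proof eventually_elim
        case (elim n) then show ?case using False tb by (simp add: Q'_def Q_def e_def)
      qed
      ultimately have "(\<lambda>n. Q' n t) \<longlonglongrightarrow> g t" by (rule Lim_transform_eventually)
      then show ?thesis using False by (simp add: g'_def)
    qed
    show "g' integrable_on {a..b}" by (rule dominated_convergence[OF i ii iii iv])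
    show "(\<lambda>n. integral {a..b} (Q' n)) \<longlonglongrightarrow> integral {a..b} g'"
      by (rule dominated_convergence[OF i ii iii iv])
  qed
  have avg: "(\<lambda>n. integral {r..r + h n} e / h n) \<longlonglongrightarrow> e r" if "r \<ge> a" for r
  proof (rule Lim_null_comparison[THEN LIM_zero_cancel])
    show "(\<lambda>n. L * h n) \<longlonglongrightarrow> 0" using tendsto_mult_left[OF h_lim, of L] by simp
    show "\<forall>\<^sub>F n in sequentially. norm (integral {r..r + h n} e / h n - e r) \<le> L * h n"
    proof (rule always_eventually, rule allI)
      fix n
      have "((\<lambda>t. e t - e r) has_integral integral {r..r + h n} e - e r * h n) {r..r + h n}"
        using has_integral_diff[OF integrable_integral[OF e_int[OF that, of "r + h n"]] has_integral_const_real[of "e r" r "r + h n"]]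
        h_pos[of n] by (simp add: mult.commute)
      moreover have "norm (e t - e r) \<le> L * h n" if "t \<in> {r..r + h n} - {}" for t
      proof -
        have "\<bar>e t - e r\<bar> \<le> L * \<bar>t - r\<bar>" and "\<bar>t - r\<bar> \<le> h n"
          using eL[of t r] that \<open>r \<ge> a\<close> by auto
        then show ?thesis using L(1) by (smt (verit) mult_left_mono real_norm_def)
      qed
      ultimately have "norm (integral {r..r + h n} e - e r * h n) \<le> (L * h n) * measure lborel {r..r + h n}"
        using L(1) h_pos[of n] by (intro has_integral_bound_real[OF _ finite.emptyI]) auto
      then show "norm (integral {r..r + h n} e / h n - e r) \<le> L * h n"
        using h_pos[of n] by (simp add: field_simps abs_mult power2_eq_square)
    qed
  qed
  have "(\<lambda>n. integral {a..b} (Q' n)) \<longlonglongrightarrow> e b - e a"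
    using tendsto_diff[OF avg[OF ab] avg[OF order_refl]] Q'int[THEN integral_unique]
    by (simp add: diff_divide_distrib)
  then have "integral {a..b} g' = e b - e a" using dc(2) LIMSEQ_unique by blast
  then have "(g' has_integral (f b - f a)) {a..b}"
    using dc(1) ab by (metis e_def integrable_integral min.idem min.absorb1)
  then show ?thesis
    by (rule has_integral_spike[OF M, rotated]) (auto simp: g'_def)
qed

lemma Lip_mono:
  assumes "a \<le> b" "Lip {a..b} f" "negligible N"
    and "\<And>t. t \<in> {a..b} - N \<Longrightarrow> (f has_real_derivative g t) (at t within {a..b})"
    and "\<And>t. t \<in> {a..b} - N \<Longrightarrow> g t \<ge> 0"
  shows "f a \<le> f b"
proof -
  have "(g has_integral (f b - f a)) {a..b}"
    by (rule Lip_fundamental_theorem[OF assms(1-4)])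
  then have "((\<lambda>t. if t \<in> N then 0 else g t) has_integral (f b - f a)) {a..b}"
    by (rule has_integral_spike[OF assms(3), rotated]) auto
  then have "0 \<le> f b - f a" by (rule has_integral_nonneg) (use assms(5) in auto)
  then show ?thesis by simp
qed

section \<open>Curves in the cone and the extremal values of z\<close>

text \<open>The coordinates of an admissible curve from the origin. Writing the conditions in
  real functions with an explicit exceptional null set \<open>N\<close> keeps Lebesgue measure out of the estimates;
  \<open>speed_integrable\<close> is the trace left by the measurability of the control.\<close>
locale trajectory =
  fixes x y z u v :: "real \<Rightarrow> real" and T :: real and N :: "real set"
  assumes T_nonneg: "0 \<le> T" and negligible: "negligible N"
    and lip: "Lip {0..T} x" "Lip {0..T} y" "Lip {0..T} z"
    and cone: "\<And>t. t \<in> {0..T} \<Longrightarrow> \<bar>u t\<bar> \<le> v t"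
    and deriv_x: "\<And>t. t \<in> {0..T} - N \<Longrightarrow> (x has_real_derivative u t) (at t within {0..T})"
    and deriv_y: "\<And>t. t \<in> {0..T} - N \<Longrightarrow> (y has_real_derivative v t) (at t within {0..T})"
    and deriv_z: "\<And>t. t \<in> {0..T} - N \<Longrightarrow> (z has_real_derivative (x t)\<^sup>2 / 2 * v t) (at t within {0..T})"
    and start: "x 0 = 0" "y 0 = 0" "z 0 = 0"
    and speed_integrable: "(\<lambda>t. sqrt ((v t)\<^sup>2 - (u t)\<^sup>2)) integrable_on {0..T}"
begin

definition len :: real where
  "len = integral {0..T} (\<lambda>t. sqrt ((v t)\<^sup>2 - (u t)\<^sup>2))"

lemma increment:
  assumes "0 \<le> s" "s \<le> t" "t \<le> T" "Lip {s..t} f"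
    and "\<And>r. r \<in> {s..t} - N \<Longrightarrow> (f has_real_derivative g r) (at r within {0..T})"
  shows "(g has_integral (f t - f s)) {s..t}"
proof (rule Lip_fundamental_theorem[OF assms(2,4) negligible])
  fix r assume "r \<in> {s..t} - N"
  then show "(f has_real_derivative g r) (at r within {s..t})"
    using assms(1,3) by (intro DERIV_subset[OF assms(5)]) auto
qed

lemma monotone:
  assumes "0 \<le> s" "s \<le> t" "t \<le> T" "Lip {s..t} f"
    and "\<And>r. r \<in> {s..t} - N \<Longrightarrow> (f has_real_derivative g r) (at r within {0..T})"
    and "\<And>r. r \<in> {s..t} - N \<Longrightarrow> g r \<ge> 0"
  shows "f s \<le> f t"
proof (rule Lip_mono[OF assms(2,4) negligible _ assms(6)])
  fix r assume "r \<in> {s..t} - N"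
  then show "(f has_real_derivative g r) (at r within {s..t})"
    using assms(1,3) by (intro DERIV_subset[OF assms(5)]) auto
qed

lemma lip_sub: 
  assumes "0 \<le> s" "t \<le> T"
  shows "Lip {s..t} x" "Lip {s..t} y" "Lip {s..t} z"
  using lip assms by (auto elim!: Lip_subset)

lemma y_mono: "0 \<le> s \<Longrightarrow> s \<le> t \<Longrightarrow> t \<le> T \<Longrightarrow> y s \<le> y t"
  by (rule monotone[where f=y and g=v], auto intro: lip_sub deriv_y order_trans[OF abs_ge_zero cone])

lemma x_step:
  assumes st: "0 \<le> s" "s \<le> t" "t \<le> T"
  shows "\<bar>x t - x s\<bar> \<le> y t - y s"
proof -
  note L = lip_sub[OF st(1,3)]
  have sub: "r \<in> {0..T} - N" "\<bar>u r\<bar> \<le> v r" if "r \<in> {s..t} - N" for r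
    using that st cone[of r] by auto
  have "y s - x s \<le> y t - x t"
    by (rule monotone[OF st Lip_diff[OF L(2,1)] DERIV_diff[OF deriv_y[OF sub(1)] deriv_x[OF sub(1)]]])
      (assumption | (drule sub(2), linarith))+
  moreover have "y s + x s \<le> y t + x t"
    by (rule monotone[OF st Lip_add[OF L(2,1)] DERIV_add[OF deriv_y[OF sub(1)] deriv_x[OF sub(1)]]])
      (assumption | (drule sub(2), linarith))+
  ultimately show ?thesis by linarith
qed

lemma x_le_y: "0 \<le> t \<Longrightarrow> t \<le> T \<Longrightarrow> \<bar>x t\<bar> \<le> y t"
  using x_step[of 0 t] start by simp

lemma z_mono: "0 \<le> s \<Longrightarrow> s \<le> t \<Longrightarrow> t \<le> T \<Longrightarrow> z s \<le> z t"
  by (rule monotone[where f=z and g="\<lambda>t. (x t)\<^sup>2 / 2 * v t"],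
      auto intro!: lip_sub deriv_z[simplified] mult_nonneg_nonneg order_trans[OF abs_ge_zero cone])

lemma y_intermediate:
  assumes "0 \<le> s" "s \<le> t" "t \<le> T" "y s \<le> \<eta>" "\<eta> \<le> y t"
  obtains r where "s \<le> r" "r \<le> t" "y r = \<eta>"
  using IVT'[of y s \<eta> t] assms Lip_continuous[OF lip_sub(2)[of s t]] by blast

text \<open>Since \<open>dz = x\<^sup>2 / 2 dy\<close>, comparing \<open>\<bar>x\<bar>\<close> with the cone \<open>\<bar>y - e\<bar>\<close> compares \<open>z\<close> with
  \<open>(y - e)\<^sup>3 / 6\<close>.\<close>
lemma
  assumes st: "0 \<le> s" "s \<le> t" "t \<le> T"
  shows z_increment_le: "(\<And>r. r \<in> {s..t} \<Longrightarrow> (x r)\<^sup>2 \<le> (y r - e)\<^sup>2) \<Longrightarrow> z t - z s \<le> ((y t - e)^3 - (y s - e)^3) / 6"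
    and z_increment_ge: "(\<And>r. r \<in> {s..t} \<Longrightarrow> (y r - e)\<^sup>2 \<le> (x r)\<^sup>2) \<Longrightarrow> ((y t - e)^3 - (y s - e)^3) / 6 \<le> z t - z s"
proof -
  let ?c = "\<lambda>r. 1/6 * ((y r - e) * ((y r - e) * (y r - e)))"
  note L = lip_sub[OF st(1,3)]
  have Lc: "Lip {s..t} ?c" by (intro Lip_mult Lip_const Lip_diff L)
  have d: "(?c has_real_derivative (y r - e)\<^sup>2 / 2 * v r) (at r within {0..T})" if "r \<in> {s..t} - N" for r
    using that st by (auto intro!: derivative_eq_intros deriv_y simp: power2_eq_square field_simps)
  have dz: "(z has_real_derivative (x r)\<^sup>2 / 2 * v r) (at r within {0..T})" if "r \<in> {s..t} - N" for r
    using that st by (intro deriv_z) auto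
  have v0: "v r \<ge> 0" if "r \<in> {s..t}" for r using cone[of r] that st by auto
  { assume *: "\<And>r. r \<in> {s..t} \<Longrightarrow> (x r)\<^sup>2 \<le> (y r - e)\<^sup>2"
    have "?c s - z s \<le> ?c t - z t"
    proof (rule monotone[OF st Lip_diff[OF Lc L(3)] DERIV_diff[OF d dz]])
      fix r assume "r \<in> {s..t} - N"
      then show "0 \<le> (y r - e)\<^sup>2 / 2 * v r - (x r)\<^sup>2 / 2 * v r"
        using * [of r] v0[of r] by (simp add: mult_right_mono)
    qed
    then show "z t - z s \<le> ((y t - e)^3 - (y s - e)^3) / 6" by (simp add: power3_eq_cube field_simps)
  }
  { assume *: "\<And>r. r \<in> {s..t} \<Longrightarrow> (y r - e)\<^sup>2 \<le> (x r)\<^sup>2"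
    have "z s - ?c s \<le> z t - ?c t"
    proof (rule monotone[OF st Lip_diff[OF L(3) Lc] DERIV_diff[OF dz d]])
      fix r assume "r \<in> {s..t} - N"
      then show "0 \<le> (x r)\<^sup>2 / 2 * v r - (y r - e)\<^sup>2 / 2 * v r"
        using * [of r] v0[of r] by (simp add: mult_right_mono)
    qed
    then show "((y t - e)^3 - (y s - e)^3) / 6 \<le> z t - z s" by (simp add: power3_eq_cube field_simps)
  }
qed

end

text \<open>The largest gain of \<open>z\<close> while \<open>y\<close> grows by \<open>h\<close> and \<open>\<bar>x\<bar>\<close> goes from \<open>a\<close> to \<open>b\<close>: climb with slope 1
  to the height \<open>(a + b + h) / 2\<close>, then descend with slope -1. The surfaces \<open>S1\<close> and \<open>S2\<close> are
  \<open>z = zig 0 \<bar>x\<bar> y\<close>.\<close>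
definition zig :: "real \<Rightarrow> real \<Rightarrow> real \<Rightarrow> real" where
  "zig a b h = (2 * ((a + b + h) / 2) ^ 3 - a ^ 3 - b ^ 3) / 6"

lemma zig_additive: "a = h \<or> a = b + k \<Longrightarrow> zig 0 a h + zig a b k = zig 0 b (h + k)"
  unfolding zig_def by (elim disjE) (simp_all add: field_simps power3_eq_cube)

text \<open>Stopping over at a height \<open>a\<close> that lies on neither slope of the zigzag from \<open>0\<close> to \<open>b\<close> costs
  a definite amount of \<open>z\<close>.\<close>
lemma zig_additive_strict:
  assumes "a < h" "a < b + k" "a \<ge> 0"
  shows "zig 0 a h + zig a b k < zig 0 b (h + k)"
proof -
  define s r where "s = h - a" and "r = b + k - a"
  have pos: "s > 0" "r > 0" using assms by (auto simp: s_def r_def)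
  have "zig 0 b (h + k) - (zig 0 a h + zig a b k) = s * r * (4 * a + s + r) / 8"
    unfolding zig_def s_def r_def by (simp add: field_simps power3_eq_cube)
  moreover have "\<dots> > 0" using pos assms by simp
  ultimately show ?thesis by linarith
qed

context trajectory
begin

text \<open>Until \<open>y\<close> has grown by \<open>p - \<bar>x s\<bar>\<close>, where \<open>p\<close> is the height of the peak, the Lipschitz bound on
  \<open>\<bar>x\<bar>\<close> from the initial point is the sharper one, afterwards the bound from the final point.\<close>
lemma z_upper:
  assumes st: "0 \<le> s" "s \<le> t" "t \<le> T"
  shows "z t - z s \<le> zig \<bar>x s\<bar> \<bar>x t\<bar> (y t - y s)"
proof -
  define p where "p = (\<bar>x s\<bar> + \<bar>x t\<bar> + (y t - y s)) / 2"
  obtain r where r: "s \<le> r" "r \<le> t" "y r = y s + (p - \<bar>x s\<bar>)"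
  proof (rule y_intermediate[OF st, of "y s + (p - \<bar>x s\<bar>)"])
    show "y s \<le> y s + (p - \<bar>x s\<bar>)" "y s + (p - \<bar>x s\<bar>) \<le> y t"
      using x_step[OF st] unfolding p_def by argo+
  qed
  have "z r - z s \<le> ((y r - (y s - \<bar>x s\<bar>))^3 - (y s - (y s - \<bar>x s\<bar>))^3) / 6"
  proof (rule z_increment_le)
    fix q assume q: "q \<in> {s..r}"
    have "\<bar>x q\<bar> \<le> \<bar>y q - (y s - \<bar>x s\<bar>)\<bar>" using x_step[of s q] q st r by auto
    then show "(x q)\<^sup>2 \<le> (y q - (y s - \<bar>x s\<bar>))\<^sup>2" by (simp add: abs_le_square_iff)
  qed (use st r in auto)
  then have "z r - z s \<le> (p^3 - \<bar>x s\<bar>^3) / 6" using r(3) by simp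
  moreover have "z t - z r \<le> ((y t - (y t + \<bar>x t\<bar>))^3 - (y r - (y t + \<bar>x t\<bar>))^3) / 6"
  proof (rule z_increment_le)
    fix q assume q: "q \<in> {r..t}"
    have "\<bar>x q\<bar> \<le> \<bar>y q - (y t + \<bar>x t\<bar>)\<bar>" using x_step[of q t] q st r by auto
    then show "(x q)\<^sup>2 \<le> (y q - (y t + \<bar>x t\<bar>))\<^sup>2" by (simp add: abs_le_square_iff)
  qed (use st r in auto)
  moreover have "y r - (y t + \<bar>x t\<bar>) = - p"
    using r(3) unfolding p_def by (auto simp: field_simps)
  moreover have "zig \<bar>x s\<bar> \<bar>x t\<bar> (y t - y s) = (2 * p^3 - \<bar>x s\<bar>^3 - \<bar>x t\<bar>^3) / 6" by (simp add: zig_def p_def)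
  ultimately show ?thesis by simp
qed

text \<open>To reach \<open>\<bar>x t\<bar>\<close> in time, \<open>\<bar>x\<bar>\<close> has to lie above the line of slope 1 through the endpoint as long as
  that line is positive.\<close>
lemma z_lower:
  assumes st: "0 \<le> s" "s \<le> t" "t \<le> T"
  shows "(\<bar>x t\<bar> ^ 3 - (max 0 (\<bar>x t\<bar> - (y t - y s))) ^ 3) / 6 \<le> z t - z s"
proof -
  define e where "e = y t - \<bar>x t\<bar>"
  have "e \<le> y t" "y s \<le> max (y s) e" by (auto simp: e_def)
  then obtain r where r: "s \<le> r" "r \<le> t" "y r = max (y s) e"
    using y_intermediate[OF st, of "max (y s) e"] y_mono[OF st] by auto
  have "((y t - e)^3 - (y r - e)^3) / 6 \<le> z t - z r"
  proof (rule z_increment_ge)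
    fix q assume q: "q \<in> {r..t}"
    have "y q \<ge> y r" using y_mono[of r q] q st r by auto
    then have "\<bar>y q - e\<bar> \<le> \<bar>x q\<bar>" using x_step[of q t] q st r by (auto simp: e_def)
    then show "(y q - e)\<^sup>2 \<le> (x q)\<^sup>2" by (simp add: abs_le_square_iff)
  qed (use st r in auto)
  moreover have "z s \<le> z r" using z_mono[of s r] st r by auto
  moreover have "y r - e = max 0 (\<bar>x t\<bar> - (y t - y s))" using r(3) by (auto simp: e_def max_def)
  ultimately show ?thesis by (simp add: e_def)
qed

lemma z_ge_cube: "0 \<le> t \<Longrightarrow> t \<le> T \<Longrightarrow> \<bar>x t\<bar> ^ 3 / 6 \<le> z t"
  using z_lower[of 0 t] x_le_y[of t] start by (simp add: max_def split: if_splits)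

lemma z_le_zig: "0 \<le> t \<Longrightarrow> t \<le> T \<Longrightarrow> z t \<le> zig 0 \<bar>x t\<bar> (y t)"
  using z_upper[of 0 t] start by simp

text \<open>A stopover strictly below both slopes would make \<open>z\<close> strictly smaller than its maximum.\<close>
lemma upper_rigid:
  assumes eq: "z T = zig 0 \<bar>x T\<bar> (y T)" and t: "0 \<le> t" "t \<le> T"
  shows "\<bar>x t\<bar> = min (y t) (\<bar>x T\<bar> + y T - y t)"
proof -
  have "\<bar>x t\<bar> \<le> y t" "\<bar>x t\<bar> \<le> \<bar>x T\<bar> + (y T - y t)" using x_le_y[OF t] x_step[OF t] by auto
  moreover have "z T \<le> zig 0 \<bar>x t\<bar> (y t) + zig \<bar>x t\<bar> \<bar>x T\<bar> (y T - y t)"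
    using z_le_zig[OF t] z_upper[of t T] t by simp
  moreover from this have "\<not> (\<bar>x t\<bar> < y t \<and> \<bar>x t\<bar> < \<bar>x T\<bar> + (y T - y t))"
    using zig_additive_strict[of "\<bar>x t\<bar>" "y t" "\<bar>x T\<bar>" "y T - y t"] eq by auto
  ultimately show ?thesis by (simp add: min_def) linarith
qed

text \<open>The part of \<open>z\<close> gained after \<open>t\<close> leaves too little for \<open>\<bar>x t\<bar>\<close> to exceed the line of slope 1.\<close>
lemma lower_rigid:
  assumes eq: "z T = \<bar>x T\<bar> ^ 3 / 6" and t: "0 \<le> t" "t \<le> T"
  shows "\<bar>x t\<bar> = max 0 (y t - (y T - \<bar>x T\<bar>))"
proof -
  define w where "w = max 0 (\<bar>x T\<bar> - (y T - y t))"
  have "(\<bar>x T\<bar> ^ 3 - w ^ 3) / 6 \<le> z T - z t" using z_lower[of t T] t by (simp add: w_def)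
  then have "\<bar>x t\<bar> ^ 3 \<le> w ^ 3" using z_ge_cube[OF t] eq by (simp add: field_simps)
  then have "\<bar>x t\<bar> \<le> w" by (rule power_le_imp_le_base[of _ 2, simplified, unfolded numeral_3_eq_3[symmetric]]) (auto simp: w_def)
  moreover have "w \<le> \<bar>x t\<bar>" using x_step[of t T] t by (auto simp: w_def)
  ultimately show ?thesis by (simp add: w_def algebra_simps)
qed

text \<open>Where \<open>x = a y + b\<close> the control satisfies \<open>u = a v\<close> almost everywhere, because derivatives are
  unique, and \<open>\<integral> v = y t - y s\<close>.\<close>
lemma length_affine:
  assumes st: "0 \<le> s" "s \<le> t" "t \<le> T" and a: "\<bar>a\<bar> \<le> 1"
    and x: "\<And>r. r \<in> {s..t} \<Longrightarrow> x r = a * y r + b"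
  shows "((\<lambda>r. sqrt ((v r)\<^sup>2 - (u r)\<^sup>2)) has_integral sqrt (1 - a\<^sup>2) * (y t - y s)) {s..t}"
proof -
  have "(v has_integral (y t - y s)) {s..t}"
    by (rule increment[OF st lip_sub(2)[OF st(1,3)]]) (use st in \<open>auto intro: deriv_y\<close>)
  then have I: "((\<lambda>r. sqrt (1 - a\<^sup>2) * v r) has_integral sqrt (1 - a\<^sup>2) * (y t - y s)) {s..t}"
    by (rule has_integral_mult_right)
  have neg: "negligible (insert s (insert t N))" using negligible by simp
  show ?thesis
  proof (rule has_integral_spike[OF neg _ I])
    fix r assume r: "r \<in> {s..t} - insert s (insert t N)"
    then have rr: "r \<in> {s<..<t}" "r \<in> {0..T} - N" using st by auto
    have at: "at r within {s..t} = at r" using rr(1) by (intro at_within_interior) simp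
    have "(x has_real_derivative u r) (at r within {s..t})"
      using st by (intro DERIV_subset[OF deriv_x[OF rr(2)]]) auto
    moreover have "((\<lambda>r. a * y r + b) has_real_derivative a * v r) (at r within {s..t})"
      using st by (auto intro!: derivative_eq_intros DERIV_subset[OF deriv_y[OF rr(2)]])
    then have "(x has_real_derivative a * v r) (at r within {s..t})"
      by (rule has_field_derivative_transform_within[OF _ zero_less_one]) (use x rr(1) in auto)
    ultimately have "u r = a * v r" unfolding at by (rule DERIV_unique)
    moreover have "v r \<ge> 0" using cone[of r] rr by auto
    moreover have "(v r)\<^sup>2 - (a * v r)\<^sup>2 = (1 - a\<^sup>2) * (v r)\<^sup>2" by (simp add: power_mult_distrib left_diff_distrib)
    ultimately show "sqrt ((v r)\<^sup>2 - (u r)\<^sup>2) = sqrt (1 - a\<^sup>2) * v r"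
      by (simp add: real_sqrt_mult)
  qed
qed

lemma len_nonneg: "len \<ge> 0"
  unfolding len_def
proof (rule integral_nonneg[OF speed_integrable])
  fix t assume "t \<in> {0..T}"
  then show "0 \<le> sqrt ((v t)\<^sup>2 - (u t)\<^sup>2)" using cone[of t] by (simp add: abs_le_square_iff[symmetric])
qed

lemma len_two_affine:
  assumes "0 \<le> s" "s \<le> T" "\<bar>a\<bar> \<le> 1" "\<bar>a'\<bar> \<le> 1"
    and "\<And>r. r \<in> {0..s} \<Longrightarrow> x r = a * y r" "\<And>r. r \<in> {s..T} \<Longrightarrow> x r = a' * y r + b"
  shows "len = sqrt (1 - a\<^sup>2) * y s + sqrt (1 - a'\<^sup>2) * (y T - y s)"
proof -
  have "((\<lambda>r. sqrt ((v r)\<^sup>2 - (u r)\<^sup>2)) has_integral sqrt (1 - a\<^sup>2) * (y s - y 0)) {0..s}"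
    by (rule length_affine[where b=0]) (use assms in auto)
  moreover have "((\<lambda>r. sqrt ((v r)\<^sup>2 - (u r)\<^sup>2)) has_integral sqrt (1 - a'\<^sup>2) * (y T - y s)) {s..T}"
    by (rule length_affine[where b=b]) (use assms in auto)
  ultimately have "((\<lambda>r. sqrt ((v r)\<^sup>2 - (u r)\<^sup>2)) has_integral
      sqrt (1 - a\<^sup>2) * (y s - y 0) + sqrt (1 - a'\<^sup>2) * (y T - y s)) {0..T}"
    using assms(1,2) has_integral_combine by blast
  then show ?thesis using start by (simp add: len_def integral_unique)
qed

end

section \<open>Extremals and the calibration\<close>

text \<open>Extremals parametrised by \<open>y\<close>, with \<open>P = sinh \<psi>\<close>. \<open>X_deriv\<close> then has the bounded right-hand side
  \<open>tanh \<psi>\<close> and \<open>P_deriv\<close> is linear, which is why solutions exist for all \<open>y\<close>. \<open>Tm\<close> is the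
  time \<open>t\<close> of the extremal system, with \<open>dy / dt = cosh \<psi>\<close>.\<close>
locale extremal =
  fixes c :: real and X P Tm Z :: "real \<Rightarrow> real"
  assumes X_deriv: "\<And>\<eta>. (X has_real_derivative P \<eta> / sqrt (1 + (P \<eta>)\<^sup>2)) (at \<eta>)"
    and P_deriv: "\<And>\<eta>. (P has_real_derivative - c * X \<eta>) (at \<eta>)"
    and Tm_deriv: "\<And>\<eta>. (Tm has_real_derivative 1 / sqrt (1 + (P \<eta>)\<^sup>2)) (at \<eta>)"
    and Z_deriv: "\<And>\<eta>. (Z has_real_derivative (X \<eta>)\<^sup>2 / 2) (at \<eta>)"
    and X0: "X 0 = 0" and Tm0: "Tm 0 = 0" and Z0: "Z 0 = 0"
begin

abbreviation F :: "real \<Rightarrow> real" where "F \<eta> \<equiv> 1 / sqrt (1 + (P \<eta>)\<^sup>2)"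

lemma sqrt_pos: "sqrt (1 + (P \<eta>)\<^sup>2) > 0" "1 + (P \<eta>)\<^sup>2 > 0" "1 + (P \<eta>)\<^sup>2 \<noteq> 0"
  by (auto simp: add_pos_nonneg add_nonneg_eq_0_iff)

lemma continuous: "continuous_on S X" "continuous_on S P" "continuous_on S Tm" "continuous_on S Z"
  using X_deriv P_deriv Tm_deriv Z_deriv
  by (auto intro!: DERIV_atLeastAtMost_imp_continuous_on continuous_at_imp_continuous_on DERIV_isCont)

text \<open>The conserved quantity \<open>cosh \<psi> + c x\<^sup>2 / 2\<close>.\<close>
lemma energy: "sqrt (1 + (P \<eta>)\<^sup>2) + c * (X \<eta>)\<^sup>2 / 2 = sqrt (1 + (P 0)\<^sup>2)"
proof -
  define E where "E = (\<lambda>\<eta>. sqrt (1 + (P \<eta>)\<^sup>2) + c * (X \<eta>)\<^sup>2 / 2)"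
  have "(E has_real_derivative 0) (at r)" for r
  proof -
    have "((\<lambda>\<eta>. 1 + (P \<eta>)\<^sup>2) has_real_derivative 2 * P r * (- c * X r)) (at r)"
      by (auto intro!: derivative_eq_intros P_deriv)
    note d = DERIV_chain2[OF DERIV_real_sqrt[OF sqrt_pos(2)] this]
    show ?thesis
      unfolding E_def
      by (rule DERIV_cong[OF DERIV_add[OF d DERIV_cdivide[OF DERIV_cmult[OF DERIV_power[OF X_deriv]]]]])
        (simp add: field_simps)
  qed
  then have "E \<eta> = E 0" using DERIV_isconst_all by blast
  then show ?thesis by (simp add: E_def X0)
qed

lemma P_at_zero: "X \<eta> = 0 \<Longrightarrow> \<bar>P \<eta>\<bar> = \<bar>P 0\<bar>"
  using energy[of \<eta>] by (simp add: power2_eq_iff abs_eq_iff)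

lemma slope_lt_1: "\<bar>P \<eta> / sqrt (1 + (P \<eta>)\<^sup>2)\<bar> < 1"
proof -
  have "\<bar>P \<eta>\<bar> < sqrt (1 + (P \<eta>)\<^sup>2)" by (rule real_less_rsqrt) simp
  then show ?thesis using sqrt_pos[of \<eta>] by (simp add: abs_divide)
qed

lemma F_le_1: "F \<eta> \<le> 1"
proof -
  have "1 \<le> sqrt (1 + (P \<eta>)\<^sup>2)" by (rule real_le_rsqrt) simp
  then show ?thesis using sqrt_pos(1)[of \<eta>] by (simp add: divide_le_eq)
qed

lemma X_lipschitz: "\<bar>X a - X b\<bar> \<le> \<bar>a - b\<bar>"
proof -
  have "1-lipschitz_on UNIV X"
  proof (rule bounded_derivative_imp_lipschitz)
    fix r :: real
    show "(X has_derivative (*) (P r / sqrt (1 + (P r)\<^sup>2))) (at r within UNIV)"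
      using X_deriv[of r] by (simp add: has_field_derivative_def)
    show "onorm ((*) (P r / sqrt (1 + (P r)\<^sup>2))) \<le> 1"
    proof (rule onorm_le)
      fix s :: real
      show "norm (P r / sqrt (1 + (P r)\<^sup>2) * s) \<le> 1 * norm s"
        unfolding norm_mult using slope_lt_1[of r] by (intro mult_right_mono) auto
    qed
  qed auto
  from lipschitz_onD[OF this, of a b] show ?thesis by (simp add: dist_real_def)
qed

lemma Tm_strict_mono: "a < b \<Longrightarrow> Tm a < Tm b"
  by (rule DERIV_pos_imp_increasing) (use Tm_deriv sqrt_pos in fastforce)+

lemma Tm_le: "0 \<le> \<eta> \<Longrightarrow> Tm \<eta> \<le> \<eta>"
proof -
  assume "0 \<le> \<eta>"
  have "0 - Tm 0 \<le> \<eta> - Tm \<eta>"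
    by (rule DERIV_nonneg_imp_nondecreasing[OF \<open>0 \<le> \<eta>\<close>])
      (use F_le_1 in \<open>auto intro!: exI derivative_eq_intros Tm_deriv\<close>)
  then show ?thesis by (simp add: Tm0)
qed

text \<open>The slope \<open>P / (2 X)\<close> of the calibration is singular where \<open>X\<close> vanishes. As \<open>X\<close> vanishes
  only to first order, the following two limits make the boundary terms disappear.\<close>
lemma vanishing_rate_left:
  assumes "P 0 > 0"
  shows "((\<lambda>\<epsilon>. \<epsilon>\<^sup>2 / X \<epsilon>) \<longlongrightarrow> 0) (at_right 0)"
proof -
  have "((\<lambda>\<epsilon>. X \<epsilon> / \<epsilon>) \<longlongrightarrow> P 0 / sqrt (1 + (P 0)\<^sup>2)) (at_right 0)"
    using X_deriv[of 0] X0 by (auto simp: has_field_derivative_iff intro: filterlim_mono[OF _ order_refl at_le])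
  then have "((\<lambda>\<epsilon>. \<epsilon> / (X \<epsilon> / \<epsilon>)) \<longlongrightarrow> 0 / (P 0 / sqrt (1 + (P 0)\<^sup>2))) (at_right 0)"
    by (rule tendsto_divide[OF tendsto_ident_at]) (use assms sqrt_pos[of 0] in simp)
  then show ?thesis by (simp add: power2_eq_square)
qed

lemma vanishing_rate_right:
  assumes "P 0 > 0"
  shows "((\<lambda>\<epsilon>. \<epsilon>\<^sup>2 / X (Y - \<epsilon>)) \<longlongrightarrow> 0) (at_right 0)"
proof (cases "X Y = 0")
  case True
  define V where "V = P Y / sqrt (1 + (P Y)\<^sup>2)"
  have "P Y \<noteq> 0" using P_at_zero[OF True] assms by auto
  then have V: "V \<noteq> 0" using sqrt_pos[of Y] by (simp add: V_def)
  have "((\<lambda>\<epsilon>. X (Y - \<epsilon>)) has_real_derivative - V) (at 0)"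
    using DERIV_chain2[OF X_deriv[of "Y - 0"] DERIV_diff[OF DERIV_const DERIV_ident]] by (simp add: V_def)
  then have "((\<lambda>\<epsilon>. X (Y - \<epsilon>) / \<epsilon>) \<longlongrightarrow> - V) (at_right 0)"
    using True by (auto simp: has_field_derivative_iff intro: filterlim_mono[OF _ order_refl at_le])
  then have "((\<lambda>\<epsilon>. \<epsilon> / (X (Y - \<epsilon>) / \<epsilon>)) \<longlongrightarrow> 0 / (- V)) (at_right 0)"
    by (rule tendsto_divide[OF tendsto_ident_at]) (use V in simp)
  then show ?thesis by (simp add: power2_eq_square)
next
  case False
  have "isCont X (Y - 0)" using X_deriv DERIV_isCont by blast
  then have "((\<lambda>\<epsilon>. \<epsilon>\<^sup>2 / X (Y - \<epsilon>)) \<longlongrightarrow> 0\<^sup>2 / X (Y - 0)) (at_right 0)"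
    using False by (intro tendsto_intros isCont_tendsto_compose[where g=X]) auto
  then show ?thesis by simp
qed

end

text \<open>The pointwise core of the optimality proof. Here \<open>g\<close> is the rate of change of the calibration
  along a curve at the point \<open>x\<close> with control \<open>(u, v)\<close>, and \<open>S\<close> the speed. The excess \<open>g - S\<close> is a sum of
  two squares up to a factor because \<open>S\<^sup>2 + u\<^sup>2 = v\<^sup>2\<close> and \<open>F\<^sup>2 (1 + p\<^sup>2) = 1\<close>: both \<open>(S, u)\<close> and \<open>(F, p F)\<close> lie on circles. The
  second square vanishes exactly if the curve moves along the family of multiples of \<open>X\<close>.\<close>
lemma calibration_identity:
  fixes p X x u v :: real
  assumes X: "X > 0" and uv: "\<bar>u\<bar> \<le> v"
  defines "F \<equiv> 1 / sqrt (1 + p\<^sup>2)" and "m \<equiv> p / (2 * X)" and "S \<equiv> sqrt (v\<^sup>2 - u\<^sup>2)"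
  defines "g \<equiv> v * F + m * (p * F) / X * v * (x\<^sup>2 - X\<^sup>2) - m * (2 * x * u - 2 * X * (p * F) * v)"
  shows "2 * F * v * (g - S) = (S - F * v)\<^sup>2 + (u - (p * F * x / X) * v)\<^sup>2" and "S \<le> g"
proof -
  have q: "1 + p\<^sup>2 > 0" by (simp add: add_pos_nonneg)
  have F: "F > 0" "F\<^sup>2 * (1 + p\<^sup>2) = 1" using q by (auto simp: F_def power_divide)
  have S: "S\<^sup>2 = v\<^sup>2 - u\<^sup>2" using uv by (auto simp: S_def abs_le_square_iff[symmetric])
  define r where "r = x / X"
  have x: "x = r * X" using X by (simp add: r_def)
  have g: "g = v * F + p\<^sup>2 * F * v * (r\<^sup>2 - 1) / 2 - p * r * u + p\<^sup>2 * F * v"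
    using X unfolding g_def m_def x by (simp add: field_simps power2_eq_square)
  have "2 * F * v * (g - S) - ((S - F * v)\<^sup>2 + (u - (p * F * r) * v)\<^sup>2)
     = v\<^sup>2 * (F\<^sup>2 * (1 + p\<^sup>2)) - (S\<^sup>2 + u\<^sup>2)"
    unfolding g by (simp add: field_simps power2_eq_square)
  also have "\<dots> = 0" using S F by simp
  finally show id: "2 * F * v * (g - S) = (S - F * v)\<^sup>2 + (u - (p * F * x / X) * v)\<^sup>2"
    by (simp add: r_def)
  show "S \<le> g"
  proof (cases "v > 0")
    case True
    have "0 \<le> (2 * F * v) * (g - S)" unfolding id by simp
    moreover have "2 * F * v > 0" using True F by simp
    ultimately have "0 \<le> g - S" by (simp only: zero_le_mult_iff) linarith
    then show ?thesis by simp
  next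
    case False
    then have "v = 0" "u = 0" using uv by auto
    then show ?thesis by (simp add: S_def g_def)
  qed
qed

text \<open>A competitor together with a positive extremal ending above the same \<open>(x, y)\<close>. Their final \<open>z\<close> may
  differ.\<close>
locale calibrated = trajectory + extremal +
  fixes Y
  defines "Y \<equiv> y T"
  assumes Y_pos: "0 < Y" and P0_pos: "0 < P 0" and X_pos: "\<And>\<eta>. 0 < \<eta> \<Longrightarrow> \<eta> < Y \<Longrightarrow> 0 < X \<eta>"
    and endpoint: "x T = X Y"
begin

text \<open>Minus the costate of \<open>w = x\<^sup>2\<close> along the extremal, that is minus the derivative of
  \<open>sqrt (1 - w'\<^sup>2 / (4 w))\<close> with respect to \<open>w'\<close>. It depends on \<open>y\<close> only, so the calibration below is affine in \<open>w\<close>.\<close>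
definition m :: "real \<Rightarrow> real" where "m \<eta> = P \<eta> / (2 * X \<eta>)"

definition cal :: "real \<Rightarrow> real" where
  "cal t = Tm (y t) + c * Z (y t) - c * z t - m (y t) * (x t * x t - X (y t) * X (y t))"

definition cal_rate :: "real \<Rightarrow> real" where
  "cal_rate t = v t * F (y t) + m (y t) * (P (y t) * F (y t)) / X (y t) * v t * ((x t)\<^sup>2 - (X (y t))\<^sup>2)
     - m (y t) * (2 * x t * u t - 2 * X (y t) * (P (y t) * F (y t)) * v t)"

lemma m_deriv:
  assumes "0 < \<eta>" "\<eta> < Y"
  shows "(m has_real_derivative - c / 2 - m \<eta> * (P \<eta> * F \<eta>) / X \<eta>) (at \<eta>)"
proof -
  have X: "X \<eta> > 0" using X_pos assms by blast
  show ?thesis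
    unfolding m_def
    by (rule DERIV_cong[OF DERIV_divide[OF P_deriv DERIV_cmult[OF X_deriv]]])
      (use X sqrt_pos[of \<eta>] in \<open>auto simp: field_simps power2_eq_square\<close>)
qed

lemma y_le_Y: "0 \<le> t \<Longrightarrow> t \<le> T \<Longrightarrow> y t \<le> Y" "0 \<le> t \<Longrightarrow> t \<le> T \<Longrightarrow> 0 \<le> y t"
  using y_mono[of t T] y_mono[of 0 t] T_nonneg start by (auto simp: Y_def)

context
  fixes s t
  assumes st: "0 \<le> s" "s \<le> t" "t \<le> T" and in_field: "0 < y s" "y t < Y"
begin

lemma y_between: "r \<in> {s..t} \<Longrightarrow> y r \<in> {y s..y t}"
  using y_mono[of s r] y_mono[of r t] st by auto

lemma X_pos_between: "\<eta> \<in> {y s..y t} \<Longrightarrow> 0 < X \<eta>"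
  using X_pos in_field by auto

lemma Lip_compose_y:
  assumes "\<And>\<eta>. \<eta> \<in> {y s..y t} \<Longrightarrow> (h has_real_derivative h' \<eta>) (at \<eta>)" "continuous_on {y s..y t} h'"
  shows "Lip {s..t} (\<lambda>r. h (y r))"
  by (rule Lip_compose_C1[OF lip_sub(2)[OF st(1,3)] y_between _ assms(2)])
    (use assms(1) has_field_derivative_at_within in blast)+

lemma Lip_cal: "Lip {s..t} cal"
proof -
  have P: "continuous_on {y s..y t} (\<lambda>\<eta>. sqrt (1 + (P \<eta>)\<^sup>2))"
    by (intro continuous_intros continuous)
  have cF: "continuous_on {y s..y t} F"
    using sqrt_pos by (intro continuous_intros continuous) (simp add: less_imp_neq[symmetric])
  have cV: "continuous_on {y s..y t} (\<lambda>\<eta>. P \<eta> / sqrt (1 + (P \<eta>)\<^sup>2))"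
    using sqrt_pos by (intro continuous_intros continuous) (simp add: less_imp_neq[symmetric])
  have cm: "continuous_on {y s..y t} m"
    unfolding m_def using X_pos_between by (intro continuous_intros continuous) fastforce
  have cm': "continuous_on {y s..y t} (\<lambda>\<eta>. - c / 2 - m \<eta> * (P \<eta> * F \<eta>) / X \<eta>)"
    using X_pos_between by (intro continuous_intros continuous cm cF) fastforce
  have "Lip {s..t} (\<lambda>r. Tm (y r))" by (rule Lip_compose_y[OF Tm_deriv cF])
  moreover have "Lip {s..t} (\<lambda>r. Z (y r))"
    by (rule Lip_compose_y[OF Z_deriv]) (intro continuous_intros continuous, simp)
  moreover have "Lip {s..t} (\<lambda>r. X (y r))" by (rule Lip_compose_y[OF X_deriv cV])
  moreover have "Lip {s..t} (\<lambda>r. m (y r))"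
    by (rule Lip_compose_y[OF m_deriv cm']) (use in_field in auto)
  ultimately show ?thesis
    unfolding cal_def using lip_sub[OF st(1,3)]
    by (intro Lip_diff Lip_add Lip_mult Lip_const)
qed

lemma cal_deriv:
  assumes r: "r \<in> {s..t} - N"
  shows "(cal has_real_derivative cal_rate r) (at r within {0..T})"
proof -
  have r': "r \<in> {0..T} - N" using r st by auto
  have yr: "0 < y r" "y r < Y" using y_between[of r] r in_field by auto
  note dx = deriv_x[OF r'] and dy = deriv_y[OF r'] and dz = deriv_z[OF r']
  note chain = DERIV_chain2[OF _ dy]
  have dW: "((\<lambda>r. x r * x r - X (y r) * X (y r)) has_real_derivative
      2 * x r * u r - 2 * X (y r) * (P (y r) * F (y r)) * v r) (at r within {0..T})"
    by (rule DERIV_cong[OF DERIV_diff[OF DERIV_mult[OF dx dx] DERIV_mult[OF chain[OF X_deriv] chain[OF X_deriv]]]])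
      (simp add: algebra_simps)
  show ?thesis
    unfolding cal_def
    by (rule DERIV_cong[OF DERIV_diff[OF DERIV_diff[OF DERIV_add[OF chain[OF Tm_deriv]
            DERIV_cmult[OF chain[OF Z_deriv]]] DERIV_cmult[OF dz]] DERIV_mult[OF chain[OF m_deriv[OF yr]] dW]]])
      (simp add: cal_rate_def algebra_simps power2_eq_square add_divide_distrib diff_divide_distrib)
qed

lemma cal_integral: "(cal_rate has_integral (cal t - cal s)) {s..t}"
  by (rule increment[OF st Lip_cal cal_deriv])

lemma speed_le_cal_rate:
  assumes "r \<in> {s..t}"
  shows "sqrt ((v r)\<^sup>2 - (u r)\<^sup>2) \<le> cal_rate r"
  unfolding cal_rate_def m_def
  by (rule calibration_identity(2)) (use assms X_pos_between y_between cone st in auto)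

end

end

section \<open>Optimality and rigidity from the calibration\<close>

context calibrated
begin

abbreviation speed :: "real \<Rightarrow> real" where "speed t \<equiv> sqrt ((v t)\<^sup>2 - (u t)\<^sup>2)"

definition defect :: "real \<Rightarrow> real" where "defect t = cal_rate t - speed t"

lemma speed_integrable_on: "0 \<le> s \<Longrightarrow> t \<le> T \<Longrightarrow> speed integrable_on {s..t}"
  by (rule integrable_on_subinterval[OF speed_integrable]) auto

lemma speed_integral_le: 
  assumes st: "0 \<le> s" "s \<le> t" "t \<le> T"
  shows "integral {s..t} speed \<le> y t - y s"
proof (rule has_integral_le[OF integrable_integral[OF speed_integrable_on[OF st(1,3)]]])
  show "(v has_integral (y t - y s)) {s..t}"
    by (rule increment[OF st lip_sub(2)[OF st(1,3)]]) (use st in \<open>auto intro: deriv_y\<close>)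
  show "speed r \<le> v r" if "r \<in> {s..t}" for r
    using cone[of r] that st by (intro real_le_lsqrt) auto
qed

lemma z_increment_small:
  assumes st: "0 \<le> s" "s \<le> t" "t \<le> T"
  shows "z t - z s \<le> Y\<^sup>2 / 2 * (y t - y s)"
proof -
  have "(Y\<^sup>2 / 2) * y s - z s \<le> (Y\<^sup>2 / 2) * y t - z t"
  proof (rule monotone[OF st])
    show "Lip {s..t} (\<lambda>r. (Y\<^sup>2 / 2) * y r - z r)"
      by (intro Lip_diff Lip_mult Lip_const lip_sub st)
    fix r assume r: "r \<in> {s..t} - N"
    then have r': "r \<in> {0..T} - N" using st by auto
    show "((\<lambda>r. (Y\<^sup>2 / 2) * y r - z r) has_real_derivative (Y\<^sup>2 / 2) * v r - (x r)\<^sup>2 / 2 * v r) (at r within {0..T})"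
      by (rule DERIV_diff[OF DERIV_cmult[OF deriv_y[OF r']] deriv_z[OF r']])
    have "\<bar>x r\<bar> \<le> Y" "0 \<le> v r" using x_le_y[of r] y_le_Y(1)[of r] cone[of r] r' by auto
    then have "(x r)\<^sup>2 \<le> Y\<^sup>2" using abs_le_square_iff[of "x r" Y] by auto
    then show "0 \<le> (Y\<^sup>2 / 2) * v r - (x r)\<^sup>2 / 2 * v r"
      using \<open>0 \<le> v r\<close> by (simp add: mult_right_mono)
  qed
  then show ?thesis by (simp add: algebra_simps)
qed

lemma defect_integrable:
  assumes "0 \<le> s" "s \<le> t" "t \<le> T" "0 < y s" "y t < Y"
  shows "(defect has_integral (cal t - cal s - integral {s..t} speed)) {s..t}"
  unfolding defect_def
  by (rule has_integral_diff[OF cal_integral[OF assms]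
        integrable_integral[OF speed_integrable_on[OF assms(1,3)]]])

lemma defect_nonneg:
  assumes "0 \<le> s" "s \<le> t" "t \<le> T" "0 < y s" "y t < Y" "r \<in> {s..t}"
  shows "0 \<le> defect r"
  using speed_le_cal_rate[OF assms] by (simp add: defect_def)

text \<open>Everything that is lost by cutting the curve off where \<open>y\<close> is within \<open>\<epsilon>\<close> of \<open>0\<close> or of \<open>Y\<close>: the
  length of the two ends, the variation of \<open>Tm\<close>, \<open>Z\<close> and \<open>z\<close> there, and the two boundary terms of the calibration.\<close>
definition err :: "real \<Rightarrow> real" where
  "err \<epsilon> = 2 * \<epsilon> + (\<bar>Tm \<epsilon>\<bar> + \<bar>c * Z \<epsilon>\<bar> + \<bar>Tm Y - Tm (Y - \<epsilon>)\<bar> + \<bar>c * (Z Y - Z (Y - \<epsilon>))\<bar>) + \<bar>c\<bar> * (Y\<^sup>2 * \<epsilon>)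
     + \<bar>P \<epsilon>\<bar> * (2 * \<epsilon> + 2 * (\<epsilon>\<^sup>2 / X \<epsilon>)) + \<bar>P (Y - \<epsilon>)\<bar> * (2 * \<epsilon> + 2 * (\<epsilon>\<^sup>2 / X (Y - \<epsilon>)))"

lemma err_tendsto: "(err \<longlongrightarrow> 0) (at_right 0)"
proof -
  have c: "isCont X r" "isCont P r" "isCont Tm r" "isCont Z r" for r
    using X_deriv P_deriv Tm_deriv Z_deriv DERIV_isCont by blast+
  have 0: "((\<lambda>\<epsilon>. \<epsilon>) \<longlongrightarrow> 0) (at_right (0::real))" by (rule tendsto_ident_at)
  have y: "((\<lambda>\<epsilon>. Y - \<epsilon>) \<longlongrightarrow> Y) (at_right (0::real))" using tendsto_diff[OF tendsto_const[of Y] 0] by simp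
  note t0 = isCont_tendsto_compose[OF _ 0] and tY = isCont_tendsto_compose[OF _ y]
  have "(err \<longlongrightarrow> 2 * 0 + (\<bar>Tm 0\<bar> + \<bar>c * Z 0\<bar> + \<bar>Tm Y - Tm Y\<bar> + \<bar>c * (Z Y - Z Y)\<bar>) + \<bar>c\<bar> * (Y\<^sup>2 * 0)
     + \<bar>P 0\<bar> * (2 * 0 + 2 * 0) + \<bar>P Y\<bar> * (2 * 0 + 2 * 0)) (at_right 0)"
    unfolding err_def
    by (intro tendsto_intros 0 t0[OF c(2)] t0[OF c(3)] t0[OF c(4)] tY[OF c(2)] tY[OF c(3)] tY[OF c(4)]
        vanishing_rate_left vanishing_rate_right P0_pos)
  then show ?thesis by (simp add: Tm0 Z0)
qed

text \<open>Only \<open>x - X = O(\<epsilon>)\<close> is known near the ends, so one factor \<open>\<epsilon>\<close> has to beat the pole of \<open>m\<close>;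
  what remains is \<open>\<epsilon>\<^sup>2 / X\<close>.\<close>
lemma boundary_term:
  assumes d: "\<bar>a - X \<eta>\<bar> \<le> 2 * \<epsilon>" and \<eta>: "0 < \<eta>" "\<eta> < Y"
  shows "\<bar>m \<eta> * (a * a - X \<eta> * X \<eta>)\<bar> \<le> \<bar>P \<eta>\<bar> * (2 * \<epsilon> + 2 * (\<epsilon>\<^sup>2 / X \<eta>))"
proof -
  have X: "X \<eta> > 0" using X_pos \<eta> by blast
  have "\<bar>a + X \<eta>\<bar> \<le> 2 * \<epsilon> + 2 * X \<eta>" using d X by linarith
  then have "\<bar>(a - X \<eta>) * (a + X \<eta>)\<bar> \<le> (2 * \<epsilon>) * (2 * \<epsilon> + 2 * X \<eta>)"
    unfolding abs_mult using d by (intro mult_mono) auto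
  then have "\<bar>P \<eta>\<bar> / (2 * X \<eta>) * \<bar>(a - X \<eta>) * (a + X \<eta>)\<bar> \<le> \<bar>P \<eta>\<bar> / (2 * X \<eta>) * ((2 * \<epsilon>) * (2 * \<epsilon> + 2 * X \<eta>))"
    using X by (intro mult_left_mono) auto
  also have "\<dots> = \<bar>P \<eta>\<bar> * (2 * \<epsilon> + 2 * (\<epsilon>\<^sup>2 / X \<eta>))"
    using X by (simp add: field_simps power2_eq_square)
  also have "\<bar>P \<eta>\<bar> / (2 * X \<eta>) * \<bar>(a - X \<eta>) * (a + X \<eta>)\<bar> = \<bar>m \<eta> * (a * a - X \<eta> * X \<eta>)\<bar>"
  proof -
    have "a * a - X \<eta> * X \<eta> = (a - X \<eta>) * (a + X \<eta>)" by (simp add: algebra_simps)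
    then show ?thesis using X by (simp add: m_def abs_mult)
  qed
  finally show ?thesis .
qed

text \<open>The length inequality, strengthened by the defect accumulated on any inner piece. This is
  what turns equality into vanishing of the defect. Cut off the ends, integrate the calibration between, and let
  \<open>\<epsilon>\<close> tend to \<open>0\<close>.\<close>
lemma len_with_defect:
  assumes st: "0 \<le> s" "s \<le> t" "t \<le> T" "0 < y s" "y t < Y"
  shows "len + integral {s..t} defect \<le> Tm Y + c * (Z Y - z T)"
proof -
  have yT: "y T = Y" by (simp add: Y_def)
  define \<delta> where "\<delta> = Min {y s, Y - y t, Y / 3}"
  have \<delta>: "\<delta> > 0" using st Y_pos by (simp add: \<delta>_def)
  have bound: "len + integral {s..t} defect - (Tm Y + c * (Z Y - z T)) \<le> err \<epsilon>" if \<epsilon>: "0 < \<epsilon>" "\<epsilon> < \<delta>" for \<epsilon>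
  proof -
    have \<epsilon>': "\<epsilon> < y s" "\<epsilon> < Y - y t" "\<epsilon> < Y / 3" using \<epsilon> by (auto simp: \<delta>_def)
    have ys: "y s \<le> y t" using y_mono st by blast
    obtain a where a: "0 \<le> a" "a \<le> s" "y a = \<epsilon>"
      by (rule y_intermediate[of 0 s \<epsilon>]) (use st \<epsilon> \<epsilon>' start in simp_all)
    obtain b where b: "t \<le> b" "b \<le> T" "y b = Y - \<epsilon>"
      by (rule y_intermediate[of t T "Y - \<epsilon>"]) (use st \<epsilon> \<epsilon>' in \<open>simp_all add: Y_def[symmetric]\<close>)
    have ab: "0 \<le> a" "a \<le> b" "b \<le> T" "0 < y a" "y b < Y" using a b st \<epsilon> by auto
    have I1: "integral {0..a} speed + integral {a..b} speed + integral {b..T} speed = len"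
    proof -
      have "integral {0..a} speed + integral {a..T} speed = integral {0..T} speed"
        using ab by (intro Henstock_Kurzweil_Integration.integral_combine speed_integrable_on) auto
      moreover have "integral {a..b} speed + integral {b..T} speed = integral {a..T} speed"
        using ab by (intro Henstock_Kurzweil_Integration.integral_combine speed_integrable_on) auto
      ultimately show ?thesis unfolding len_def by simp
    qed
    have I2: "integral {0..a} speed \<le> \<epsilon>" "integral {b..T} speed \<le> \<epsilon>"
    proof -
      show "integral {0..a} speed \<le> \<epsilon>" using speed_integral_le[of 0 a] ab a start by linarith
      show "integral {b..T} speed \<le> \<epsilon>" using speed_integral_le[of b T] ab b yT by linarith
    qed
    have D: "(defect has_integral (cal b - cal a - integral {a..b} speed)) {a..b}"
      by (rule defect_integrable[OF ab])
    have I3: "integral {s..t} defect \<le> integral {a..b} defect"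
    proof (rule integral_subset_le)
      show "{s..t} \<subseteq> {a..b}" using a b by auto
      show "defect integrable_on {s..t}" by (rule has_integral_integrable[OF defect_integrable[OF st]])
      show "defect integrable_on {a..b}" by (rule has_integral_integrable[OF D])
      show "\<forall>r\<in>{a..b}. 0 \<le> defect r" by (intro ballI defect_nonneg[OF ab])
    qed
    have I4: "integral {a..b} defect = cal b - cal a - integral {a..b} speed" using D by (rule integral_unique)
    have xa: "\<bar>x a - X \<epsilon>\<bar> \<le> 2 * \<epsilon>"
    proof -
      have "\<bar>x a\<bar> \<le> \<epsilon>" using x_le_y[of a] a(3) ab by linarith
      moreover have "\<bar>X \<epsilon>\<bar> \<le> \<epsilon>" using X_lipschitz[of \<epsilon> 0] X0 \<epsilon>(1) by linarith
      ultimately show ?thesis by linarith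
    qed
    have B1: "\<bar>m \<epsilon> * (x a * x a - X \<epsilon> * X \<epsilon>)\<bar> \<le> \<bar>P \<epsilon>\<bar> * (2 * \<epsilon> + 2 * (\<epsilon>\<^sup>2 / X \<epsilon>))"
      by (rule boundary_term[OF xa]) (use \<epsilon> \<epsilon>' Y_pos in linarith)+
    have xb: "\<bar>x b - X (Y - \<epsilon>)\<bar> \<le> 2 * \<epsilon>"
    proof -
      have "\<bar>X Y - x b\<bar> \<le> \<epsilon>" using x_step[of b T] yT b(3) endpoint ab by linarith
      moreover have "\<bar>X (Y - \<epsilon>) - X Y\<bar> \<le> \<epsilon>" using X_lipschitz[of "Y - \<epsilon>" Y] \<epsilon>(1) by linarith
      ultimately show ?thesis by linarith
    qed
    have B2: "\<bar>m (Y - \<epsilon>) * (x b * x b - X (Y - \<epsilon>) * X (Y - \<epsilon>))\<bar>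
       \<le> \<bar>P (Y - \<epsilon>)\<bar> * (2 * \<epsilon> + 2 * (\<epsilon>\<^sup>2 / X (Y - \<epsilon>)))"
      by (rule boundary_term[OF xb]) (use \<epsilon> \<epsilon>' Y_pos in linarith)+
    have Za: "0 \<le> z a" "0 \<le> z T - z b"
      using z_mono[of 0 a] z_mono[of b T] ab start by simp_all
    have Zb: "z a \<le> Y\<^sup>2 / 2 * \<epsilon>"
      using z_increment_small[of 0 a] ab a(3) start by simp
    have "y T - y b = \<epsilon>" using yT b(3) by linarith
    then have Zc: "z T - z b \<le> Y\<^sup>2 / 2 * \<epsilon>"
      using z_increment_small[of b T] ab by simp
    have "\<bar>c * (z T - z b + z a)\<bar> \<le> \<bar>c\<bar> * (Y\<^sup>2 * \<epsilon>)"
      unfolding abs_mult using Za Zb Zc by (intro mult_left_mono) auto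
    then have B3: "c * (z T - z b + z a) \<le> \<bar>c\<bar> * (Y\<^sup>2 * \<epsilon>)" by linarith
    have "len + integral {s..t} defect \<le> 2 * \<epsilon> + (cal b - cal a)" using I1 I2 I3 I4 by linarith
    also have "cal b - cal a = (Tm (Y - \<epsilon>) - Tm \<epsilon>) + c * (Z (Y - \<epsilon>) - Z \<epsilon>) - c * (z b - z a)
       - m (Y - \<epsilon>) * (x b * x b - X (Y - \<epsilon>) * X (Y - \<epsilon>)) + m \<epsilon> * (x a * x a - X \<epsilon> * X \<epsilon>)"
      unfolding cal_def a(3) b(3) by (simp add: algebra_simps)
    also have "\<dots> = (Tm Y + c * (Z Y - z T)) - (Tm Y - Tm (Y - \<epsilon>)) - Tm \<epsilon> - c * (Z Y - Z (Y - \<epsilon>)) - c * Z \<epsilon>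
        + c * (z T - z b + z a) 
       - m (Y - \<epsilon>) * (x b * x b - X (Y - \<epsilon>) * X (Y - \<epsilon>)) + m \<epsilon> * (x a * x a - X \<epsilon> * X \<epsilon>)"
      by (simp add: algebra_simps)
    finally have total: "len + integral {s..t} defect \<le> 2 * \<epsilon> + ((Tm Y + c * (Z Y - z T)) - (Tm Y - Tm (Y - \<epsilon>)) - Tm \<epsilon>
        - c * (Z Y - Z (Y - \<epsilon>)) - c * Z \<epsilon> + c * (z T - z b + z a)
        - m (Y - \<epsilon>) * (x b * x b - X (Y - \<epsilon>) * X (Y - \<epsilon>)) + m \<epsilon> * (x a * x a - X \<epsilon> * X \<epsilon>))" .
    have abs: "- r \<le> \<bar>r\<bar>" for r :: real by simp
    have sum8: "2 * \<epsilon> + (M - t3 - t1 - t4 - t2 + t5 - t7 + t6) \<le> 2 * \<epsilon> + (a1 + a2 + a3 + a4) + a5 + a6 + a7 + M"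
      if "- t1 \<le> a1" "- t2 \<le> a2" "- t3 \<le> a3" "- t4 \<le> a4" "t5 \<le> a5" "t6 \<le> a6" "- t7 \<le> a7"
      for M t1 t2 t3 t4 t5 t6 t7 a1 a2 a3 a4 a5 a6 a7 :: real
      using that by linarith
    show ?thesis
      unfolding err_def diff_le_eq
      by (rule order_trans[OF total], rule sum8[OF abs abs abs abs B3 order_trans[OF abs_ge_self B1] order_trans[OF abs B2]])
  qed
  have "len + integral {s..t} defect - (Tm Y + c * (Z Y - z T)) \<le> 0"
  proof (rule tendsto_lowerbound[OF err_tendsto])
    show "\<forall>\<^sub>F \<epsilon> in at_right 0. len + integral {s..t} defect - (Tm Y + c * (Z Y - z T)) \<le> err \<epsilon>"
      unfolding eventually_at_right_field using bound \<delta> by (intro exI[of _ \<delta>]) auto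
  qed simp
  then show ?thesis by simp
qed

lemma midpoint: obtains t where "0 \<le> t" "t \<le> T" "y t = Y / 2"
proof (rule y_intermediate[of 0 T "Y / 2"])
  show "y 0 \<le> Y / 2" "Y / 2 \<le> y T" using start Y_pos by (auto simp: Y_def)
  show thesis if "0 \<le> r" "r \<le> T" "y r = Y / 2" for r by (rule \<open>\<And>t. 0 \<le> t \<Longrightarrow> t \<le> T \<Longrightarrow> y t = Y / 2 \<Longrightarrow> thesis\<close>[OF that])
qed (rule order_refl T_nonneg)+

theorem len_le: "len \<le> Tm Y + c * (Z Y - z T)"
proof -
  obtain t where t: "0 \<le> t" "t \<le> T" "y t = Y / 2" by (rule midpoint)
  then have "len + integral {t..t} defect \<le> Tm Y + c * (Z Y - z T)"
    using Y_pos by (intro len_with_defect) auto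
  then show ?thesis by simp
qed

text \<open>If equality holds, the defect has integral zero on every inner piece, and by the
  second square in \<open>calibration_identity\<close> it controls the derivative of \<open>x / X(y)\<close>.\<close>
lemma ratio_constant:
  assumes eq: "len = Tm Y + c * (Z Y - z T)"
    and st: "0 \<le> s" "s \<le> t" "t \<le> T" "0 < y s" "y t < Y"
  shows "x s / X (y s) = x t / X (y t)"
proof -
  define \<rho> where "\<rho> = (\<lambda>r. x r * (1 / X (y r)))"
  define \<rho>' where "\<rho>' = (\<lambda>r. (u r - (P (y r) * F (y r) * x r / X (y r)) * v r) / X (y r))"
  have Xp: "0 < X (y r)" if "r \<in> {s..t}" for r
    by (rule X_pos_between[OF st y_between[OF st that]])
  have Xp': "0 < X \<eta>" if "\<eta> \<in> {y s..y t}" for \<eta>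
    by (rule X_pos_between[OF st that])
  have vint: "(v has_integral (y t - y s)) {s..t}"
    by (rule increment[OF st(1-3) lip_sub(2)[OF st(1,3)]]) (use st in \<open>auto intro: deriv_y\<close>)
  have dint: "(defect has_integral 0) {s..t}"
  proof -
    have "integral {s..t} defect \<le> 0" using len_with_defect[OF st] eq by simp
    moreover have i: "defect integrable_on {s..t}"
      by (rule has_integral_integrable[OF defect_integrable[OF st]])
    moreover have "0 \<le> integral {s..t} defect"
      by (rule integral_nonneg[OF i defect_nonneg[OF st]])
    ultimately show ?thesis using integrable_integral[OF i] by simp
  qed
  have "(\<rho>' has_integral (\<rho> t - \<rho> s)) {s..t}"
  proof (rule increment[OF st(1-3)])
    have "Lip {s..t} (\<lambda>r. 1 / X (y r))"
    proof (rule Lip_compose_y[OF st])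
      fix \<eta> assume \<eta>: "\<eta> \<in> {y s..y t}"
      show "((\<lambda>\<eta>. 1 / X \<eta>) has_real_derivative - (P \<eta> / sqrt (1 + (P \<eta>)\<^sup>2)) / (X \<eta> * X \<eta>)) (at \<eta>)"
        by (rule DERIV_cong[OF DERIV_divide[OF DERIV_const X_deriv]]) (use Xp'[OF \<eta>] in auto)
    next
      show "continuous_on {y s..y t} (\<lambda>\<eta>. - (P \<eta> / sqrt (1 + (P \<eta>)\<^sup>2)) / (X \<eta> * X \<eta>))"
        using Xp' sqrt_pos by (intro continuous_intros continuous) (auto simp: less_imp_neq[symmetric])
    qed
    then show "Lip {s..t} \<rho>" unfolding \<rho>_def by (intro Lip_mult lip_sub st)
    fix r assume r: "r \<in> {s..t} - N"
    then have r': "r \<in> {0..T} - N" using st by auto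
    have X: "X (y r) > 0" using Xp r by auto
    show "(\<rho> has_real_derivative \<rho>' r) (at r within {0..T})"
      unfolding \<rho>_def \<rho>'_def
      by (rule DERIV_cong[OF DERIV_mult[OF deriv_x[OF r'] DERIV_divide[OF DERIV_const DERIV_chain2[OF X_deriv deriv_y[OF r']]]]])
        (use X in \<open>auto simp: field_simps\<close>)
  qed
  have "compact (X ` {y s..y t})" using compact_continuous_image[OF continuous(1)] by blast
  then obtain \<kappa> where \<kappa>: "\<kappa> > 0" "\<And>r. r \<in> {s..t} \<Longrightarrow> \<kappa> \<le> X (y r)"
  proof -
    obtain \<eta>0 where "\<eta>0 \<in> {y s..y t}" "\<And>\<eta>. \<eta> \<in> {y s..y t} \<Longrightarrow> X \<eta>0 \<le> X \<eta>"
      using continuous_attains_inf[OF compact_Icc _ continuous(1), of "y s" "y t"] y_mono[OF st(1-3)] by auto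
    then show thesis using that[of "X \<eta>0"] Xp'[of \<eta>0] y_between[OF st] by blast
  qed
  \<comment> \<open>From \<open>w\<^sup>2 \<le> 2 v defect\<close> the inequality of means gives \<open>\<bar>w\<bar> \<le> \<delta> v + defect / (2 \<delta>)\<close>, whose
      integral is a multiple of \<open>\<delta>\<close>, as the defect has integral zero.\<close>
  have est: "\<bar>\<rho> t - \<rho> s\<bar> \<le> \<delta> * ((y t - y s) / \<kappa>)" if \<delta>: "\<delta> > 0" for \<delta>
  proof -
    define B where "B = (\<lambda>r. (\<delta> * v r + 1 / (2 * \<delta>) * defect r) * (1 / \<kappa>))"
    have Bint: "(B has_integral (\<delta> * (y t - y s) + 1 / (2 * \<delta>) * 0) * (1 / \<kappa>)) {s..t}"
      unfolding B_def by (intro has_integral_mult_left has_integral_add has_integral_mult_right vint dint)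
    have le: "\<bar>\<rho>' r\<bar> \<le> B r" if r: "r \<in> {s..t}" for r
    proof -
      define w where "w = u r - (P (y r) * F (y r) * x r / X (y r)) * v r"
      have uv: "\<bar>u r\<bar> \<le> v r" using cone r st by auto
      have d0: "0 \<le> defect r" by (rule defect_nonneg[OF st r])
      have FF: "0 < F (y r)" "F (y r) \<le> 1" using sqrt_pos F_le_1 by auto
      have "w\<^sup>2 \<le> 2 * F (y r) * v r * defect r"
        using calibration_identity(1)[OF Xp[OF r] uv, of "P (y r)" "x r"]
        unfolding defect_def cal_rate_def m_def w_def by simp
      also have "\<dots> \<le> 2 * 1 * v r * defect r"
        using FF d0 uv by (intro mult_right_mono mult_left_mono) auto
      finally have w2: "w\<^sup>2 \<le> 2 * v r * defect r" by simp
      have "\<bar>w\<bar> \<le> \<delta> * v r + 1 / (2 * \<delta>) * defect r"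
      proof (rule power2_le_imp_le)
        have "0 \<le> (\<delta> * v r - 1 / (2 * \<delta>) * defect r)\<^sup>2" by simp
        also have "\<dots> = (\<delta> * v r + 1 / (2 * \<delta>) * defect r)\<^sup>2 - 2 * v r * defect r"
          using \<delta> by (simp add: power2_eq_square field_simps)
        finally show "\<bar>w\<bar>\<^sup>2 \<le> (\<delta> * v r + 1 / (2 * \<delta>) * defect r)\<^sup>2" using w2 by simp
        show "0 \<le> \<delta> * v r + 1 / (2 * \<delta>) * defect r" using \<delta> d0 uv by simp
      qed
      moreover have "\<bar>\<rho>' r\<bar> = \<bar>w\<bar> * (1 / X (y r))"
      proof -
        have "\<rho>' r = w / X (y r)" by (simp only: \<rho>'_def w_def)
        then show ?thesis using Xp[OF r] by (simp add: abs_divide)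
      qed
      moreover have "1 / X (y r) \<le> 1 / \<kappa>" using \<kappa> r by (simp add: frac_le)
      moreover have "0 \<le> 1 / X (y r)" using Xp[OF r] by simp
      moreover have "0 \<le> \<delta> * v r + 1 / (2 * \<delta>) * defect r" using \<delta> d0 uv by simp
      ultimately show ?thesis unfolding B_def by (metis mult_mono)
    qed
    have "\<rho> t - \<rho> s \<le> (\<delta> * (y t - y s) + 1 / (2 * \<delta>) * 0) * (1 / \<kappa>)"
      by (rule has_integral_le[OF \<open>(\<rho>' has_integral _) _\<close> Bint]) (use le in force)
    moreover have "- ((\<delta> * (y t - y s) + 1 / (2 * \<delta>) * 0) * (1 / \<kappa>)) \<le> \<rho> t - \<rho> s"
      by (rule has_integral_le[OF has_integral_neg[OF Bint] \<open>(\<rho>' has_integral _) _\<close>]) (use le in force)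
    ultimately show ?thesis by (simp add: abs_le_iff)
  qed
  have "\<bar>\<rho> t - \<rho> s\<bar> \<le> 0"
  proof (rule tendsto_lowerbound)
    show "((\<lambda>\<delta>. \<delta> * ((y t - y s) / \<kappa>)) \<longlongrightarrow> 0) (at_right 0)"
      using tendsto_mult_right[OF tendsto_ident_at[of "0::real" "{0<..}"], of "(y t - y s) / \<kappa>"] by simp
    show "\<forall>\<^sub>F \<delta> in at_right 0. \<bar>\<rho> t - \<rho> s\<bar> \<le> \<delta> * ((y t - y s) / \<kappa>)"
      unfolding eventually_at_right_field using est by (intro exI[of _ 1]) auto
  qed simp
  then show ?thesis by (simp add: \<rho>_def)
qed

text \<open>Continuity extends the constant ratio to the ends, where \<open>X\<close> may vanish.\<close>
theorem proportional:
  assumes eq: "len = Tm Y + c * (Z Y - z T)"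
  obtains C where "\<And>t. 0 \<le> t \<Longrightarrow> t \<le> T \<Longrightarrow> x t = C * X (y t)"
proof -
  obtain t0 where t0: "0 \<le> t0" "t0 \<le> T" "y t0 = Y / 2" by (rule midpoint)
  define C where "C = x t0 / X (y t0)"
  have inner: "x t = C * X (y t)" if t: "0 \<le> t" "t \<le> T" "0 < y t" "y t < Y" for t
  proof -
    have "x t / X (y t) = C"
    proof (cases "t \<le> t0")
      case True
      show ?thesis unfolding C_def by (rule ratio_constant[OF eq]) (use t t0 Y_pos True in linarith)+
    next
      case False
      show ?thesis unfolding C_def by (rule ratio_constant[OF eq, symmetric]) (use t t0 Y_pos False in linarith)+
    qed
    then show ?thesis using X_pos[of "y t"] t by (auto simp: field_simps)
  qed
  have end1: "C * X Y = x T"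
  proof -
    have lim: "((\<lambda>\<epsilon>. \<epsilon> - \<bar>C * X (Y - \<epsilon>) - x T\<bar>) \<longlongrightarrow> 0 - \<bar>C * X (Y - 0) - x T\<bar>) (at_right 0)"
      by (intro tendsto_intros isCont_tendsto_compose[OF DERIV_isCont[OF X_deriv]])
    have "0 \<le> 0 - \<bar>C * X (Y - 0) - x T\<bar>"
    proof (rule tendsto_lowerbound[OF lim])
      have "0 \<le> \<epsilon> - \<bar>C * X (Y - \<epsilon>) - x T\<bar>" if \<epsilon>: "0 < \<epsilon>" "\<epsilon> < Y" for \<epsilon>
      proof -
        obtain t where t: "0 \<le> t" "t \<le> T" "y t = Y - \<epsilon>"
          by (rule y_intermediate[of 0 T "Y - \<epsilon>"]) (use start T_nonneg \<epsilon> in \<open>simp_all add: Y_def[symmetric]\<close>)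
        then have "x t = C * X (Y - \<epsilon>)" using inner[of t] \<epsilon> by simp
        then show ?thesis using x_step[of t T] t by (auto simp: Y_def)
      qed
      then show "\<forall>\<^sub>F \<epsilon> in at_right 0. 0 \<le> \<epsilon> - \<bar>C * X (Y - \<epsilon>) - x T\<bar>"
        unfolding eventually_at_right_field using Y_pos by (intro exI[of _ Y]) auto
    qed simp
    then show ?thesis by simp
  qed
  show ?thesis
  proof (rule that)
    fix t assume t: "0 \<le> t" "t \<le> T"
    consider "y t = 0" | "y t = Y" | "0 < y t" "y t < Y" using y_le_Y[OF t] by linarith
    then show "x t = C * X (y t)"
    proof cases
      case 1 then show ?thesis using x_le_y[OF t] X0 by simp
    next
      case 2 then show ?thesis using x_step[of t T] t end1 by (simp add: Y_def)
    next
      case 3 then show ?thesis using inner t by blast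
    qed
  qed
qed

end

section \<open>Extremals from an angle parameter\<close>

lemma antiderivative_einterval:
  fixes a b :: ereal and g :: "real \<Rightarrow> real"
  assumes "a < 0" "0 < b" and "\<And>r. a < ereal r \<Longrightarrow> ereal r < b \<Longrightarrow> isCont g r"
  obtains G where "G 0 = 0"
    and "\<And>r. a < ereal r \<Longrightarrow> ereal r < b \<Longrightarrow> (G has_real_derivative g r) (at r)"
proof -
  have "\<exists>G. \<forall>r. a < ereal r \<longrightarrow> ereal r < b \<longrightarrow> (G has_vector_derivative g r) (at r)"
    by (rule einterval_antiderivative) (use assms less_trans in auto)
  then obtain G where G: "\<And>r. a < ereal r \<Longrightarrow> ereal r < b \<Longrightarrow> (G has_real_derivative g r) (at r)"
    by (auto simp: has_real_derivative_iff_has_vector_derivative)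
  show ?thesis
    by (rule that[of "\<lambda>r. G r - G 0"]) (auto intro!: derivative_eq_intros G)
qed

lemma antiderivative_UNIV:
  fixes g :: "real \<Rightarrow> real"
  assumes "\<And>r. isCont g r"
  obtains G where "G 0 = 0" and "\<And>r. (G has_real_derivative g r) (at r)"
  using antiderivative_einterval[of "-\<infinity>" "\<infinity>" g] assms by auto

lemma increasing_of_deriv_pos:
  fixes G g :: "real \<Rightarrow> real"
  assumes "is_interval S" "a \<in> S" "b \<in> S" "a < b"
    and "\<And>r. r \<in> S \<Longrightarrow> (G has_real_derivative g r) (at r)" "\<And>r. r \<in> S \<Longrightarrow> 0 < g r"
  shows "G a < G b"
proof (rule DERIV_pos_imp_increasing[OF assms(4)])
  fix r assume "a \<le> r" "r \<le> b"
  then have "r \<in> S" using assms(1-3) by (meson is_interval_1)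
  then show "\<exists>d. (G has_real_derivative d) (at r) \<and> 0 < d" using assms(5,6) by blast
qed

lemma inverse_of_increasing:
  fixes G g :: "real \<Rightarrow> real"
  assumes S: "open S" "is_interval S"
    and G: "\<And>r. r \<in> S \<Longrightarrow> (G has_real_derivative g r) (at r)" "\<And>r. r \<in> S \<Longrightarrow> 0 < g r"
  obtains H where "\<And>r. r \<in> S \<Longrightarrow> H (G r) = r"
    and "\<And>r. r \<in> S \<Longrightarrow> (H has_real_derivative 1 / g r) (at (G r))"
proof -
  have mono: "G a < G b" if "a \<in> S" "b \<in> S" "a < b" for a b
    by (rule increasing_of_deriv_pos[OF S(2) that G])
  then have inj: "inj_on G S" by (metis inj_onI less_irrefl linorder_less_linear)
  define H where "H = the_inv_into S G"
  have HG: "H (G r) = r" if "r \<in> S" for r using that inj by (simp add: H_def the_inv_into_f_f)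
  have GH: "G (H y) = y" if "y \<in> G ` S" for y using that inj by (simp add: H_def f_the_inv_into_f)
  have "(H has_real_derivative 1 / g r) (at (G r))" if r: "r \<in> S" for r
  proof -
    obtain e where e: "e > 0" "cball r e \<subseteq> S" using S(1) r open_contains_cball by blast
    then have eS: "{r - e..r + e} \<subseteq> S" by (simp add: cball_eq_atLeastAtMost)
    have cont: "isCont G q" if "q \<in> S" for q using G(1)[OF that] DERIV_isCont by blast
    have Hc: "isCont H (G r)"
      by (rule isCont_inverse_function2[of "r - e" _ "r + e"]) (use e eS HG cont in auto)
    have *: "(H has_real_derivative inverse (g r)) (at (G r))"
    proof (rule DERIV_inverse_function[of G, OF _ _ _ _ _ Hc])
      show "(G has_real_derivative g r) (at (H (G r)))" using G(1)[OF r] HG[OF r] by simp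
      show "g r \<noteq> 0" using G(2)[OF r] by simp
      show "G (r - e) < G r" "G r < G (r + e)"
      proof -
        have "r - e \<in> S" "r + e \<in> S" using eS e by auto
        then show "G (r - e) < G r" "G r < G (r + e)" using mono r e by simp_all
      qed
      fix y assume y: "G (r - e) < y" "y < G (r + e)"
      have "continuous_on {r - e..r + e} G"
        using eS cont by (intro continuous_at_imp_continuous_on) auto
      then obtain q where "q \<in> {r - e..r + e}" "G q = y"
        using IVT'[of G "r - e" y "r + e"] y e by auto
      then show "G (H y) = y" using GH eS by blast
    qed
    then show ?thesis by (simp add: inverse_eq_divide)
  qed
  then show ?thesis using that HG by blast
qed

text \<open>The function \<open>G\<close> is given by its derivative only; comparing it with an elementary \<open>B\<close>, such as a
  multiple of \<open>tan\<close>, replaces an estimate of the integral.\<close>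
lemma surjective_by_comparison:
  fixes G g B \<beta> :: "real \<Rightarrow> real"
  assumes S: "is_interval S" "0 \<in> S"
    and G: "\<And>r. r \<in> S \<Longrightarrow> (G has_real_derivative g r) (at r)" "G 0 = 0"
    and B: "\<And>r. r \<in> S \<Longrightarrow> (B has_real_derivative \<beta> r) (at r)" "B 0 = 0"
    and le: "\<And>r. r \<in> S \<Longrightarrow> 0 < \<beta> r" "\<And>r. r \<in> S \<Longrightarrow> \<beta> r \<le> g r"
    and onto: "\<And>y. \<exists>r\<in>S. B r = y"
  shows "\<exists>r\<in>S. G r = y"
proof -
  have mono: "G a - B a \<le> G b - B b" if ab: "a \<in> S" "b \<in> S" "a \<le> b" for a b
  proof (rule DERIV_nonneg_imp_nondecreasing[OF ab(3)])
    fix r assume "a \<le> r" "r \<le> b"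
    then have "r \<in> S" using S(1) ab by (meson is_interval_1)
    then show "\<exists>d. ((\<lambda>r. G r - B r) has_real_derivative d) (at r) \<and> 0 \<le> d"
      using DERIV_diff[OF G(1) B(1)] le(2) by (intro exI[of _ "g r - \<beta> r"]) auto
  qed
  have Bmono: "B a < B b" if "a \<in> S" "b \<in> S" "a < b" for a b
    by (rule increasing_of_deriv_pos[OF S(1) that B(1) le(1)])
  obtain r where r: "r \<in> S" "B r = y" using onto by blast
  have cont: "continuous_on {a..b} G" if "a \<in> S" "b \<in> S" for a b
  proof (rule continuous_at_imp_continuous_on, rule ballI)
    fix q assume "q \<in> {a..b}"
    then have "q \<in> S" using S(1) that by (meson atLeastAtMost_iff is_interval_1)
    then show "isCont G q" using G(1) DERIV_isCont by blast
  qed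
  show ?thesis
  proof (cases "0 \<le> r")
    case True
    then have "0 \<le> y" "y \<le> G r" using mono[OF S(2) r(1)] Bmono[OF S(2) r(1)] r G(2) B(2)
      by (auto simp: less_eq_real_def)
    then obtain q where "0 \<le> q" "q \<le> r" "G q = y"
      using IVT'[of G 0 y r] G(2) True cont[OF S(2) r(1)] by auto
    moreover from this have "q \<in> S" using S r(1) unfolding is_interval_1 by blast
    ultimately show ?thesis by blast
  next
    case False
    then have "y \<le> 0" "G r \<le> y" using mono[OF r(1) S(2)] Bmono[OF r(1) S(2)] r G(2) B(2) by auto
    then obtain q where "r \<le> q" "q \<le> 0" "G q = y"
      using IVT'[of G r y 0] G(2) False cont[OF r(1) S(2)] by auto
    moreover from this have "q \<in> S" using S r(1) unfolding is_interval_1 by blast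
    ultimately show ?thesis by blast
  qed
qed

lemma extremalI:
  assumes "\<And>\<eta>. (X has_real_derivative P \<eta> / sqrt (1 + (P \<eta>)\<^sup>2)) (at \<eta>)"
    and "\<And>\<eta>. (P has_real_derivative - c * X \<eta>) (at \<eta>)" and "X 0 = 0"
  obtains Tm Z where "extremal c X P Tm Z"
proof -
  have cont: "isCont X r" "isCont P r" for r using assms DERIV_isCont by blast+
  have nz: "sqrt (1 + (P r)\<^sup>2) \<noteq> 0" for r by (simp add: add_nonneg_eq_0_iff)
  obtain Tm where "Tm 0 = 0" "\<And>r. (Tm has_real_derivative 1 / sqrt (1 + (P r)\<^sup>2)) (at r)"
    by (rule antiderivative_UNIV[of "\<lambda>r. 1 / sqrt (1 + (P r)\<^sup>2)"])
      (use cont nz in \<open>auto intro!: continuous_intros\<close>)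
  moreover obtain Z where "Z 0 = 0" "\<And>r. (Z has_real_derivative (X r)\<^sup>2 / 2) (at r)"
    by (rule antiderivative_UNIV[of "\<lambda>r. (X r)\<^sup>2 / 2"]) (use cont in \<open>auto intro!: continuous_intros\<close>)
  ultimately show ?thesis using assms by (intro that[of Tm Z]) (simp add: extremal_def)
qed

text \<open>A solution curve given by a parameter \<open>r\<close> that is neither \<open>y\<close> nor the time: \<open>\<tau>\<close> is the
  derivative of the time \<open>th\<close>, and \<open>onto\<close> says that the curve is never left in finite \<open>y\<close>. Inverting \<open>yh\<close>
  yields an extremal that is defined for all \<open>y\<close>.\<close>
locale angle =
  fixes c :: real and S :: "real set" and xh ph \<tau> yh th :: "real \<Rightarrow> real"
  assumes S: "open S" "is_interval S" "0 \<in> S"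
    and \<tau>_pos: "\<And>r. r \<in> S \<Longrightarrow> 0 < \<tau> r"
    and xh: "\<And>r. r \<in> S \<Longrightarrow> (xh has_real_derivative ph r * \<tau> r) (at r)"
    and ph: "\<And>r. r \<in> S \<Longrightarrow> (ph has_real_derivative - c * xh r * (sqrt (1 + (ph r)\<^sup>2) * \<tau> r)) (at r)"
    and yh: "\<And>r. r \<in> S \<Longrightarrow> (yh has_real_derivative sqrt (1 + (ph r)\<^sup>2) * \<tau> r) (at r)"
    and th: "\<And>r. r \<in> S \<Longrightarrow> (th has_real_derivative \<tau> r) (at r)"
    and init: "xh 0 = 0" "yh 0 = 0" "th 0 = 0"
    and onto: "\<And>y. \<exists>r\<in>S. yh r = y"
begin

lemma sqrt_pos: "0 < sqrt (1 + (ph r)\<^sup>2)" by (simp add: add_pos_nonneg)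

lemma yh_mono: "a \<in> S \<Longrightarrow> b \<in> S \<Longrightarrow> a < b \<Longrightarrow> yh a < yh b"
  by (rule increasing_of_deriv_pos[OF S(2) _ _ _ yh]) (use \<tau>_pos sqrt_pos in auto)

lemma extremal_by_angle:
  obtains X P Tm Z where "extremal c X P Tm Z" "P 0 = ph 0"
    "\<And>r. r \<in> S \<Longrightarrow> X (yh r) = xh r" "\<And>r. r \<in> S \<Longrightarrow> Tm (yh r) = th r"
proof -
  obtain H where H: "\<And>r. r \<in> S \<Longrightarrow> H (yh r) = r"
      "\<And>r. r \<in> S \<Longrightarrow> (H has_real_derivative 1 / (sqrt (1 + (ph r)\<^sup>2) * \<tau> r)) (at (yh r))"
  proof (rule inverse_of_increasing[OF S(1,2) yh mult_pos_pos[OF sqrt_pos \<tau>_pos]])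
    fix H
    assume 1: "\<And>r. r \<in> S \<Longrightarrow> H (yh r) = r"
      and 2: "\<And>r. r \<in> S \<Longrightarrow> (H has_real_derivative 1 / (sqrt (1 + (ph r)\<^sup>2) * \<tau> r)) (at (yh r))"
    show thesis by (rule that[OF 1 2])
  qed
  define X P where "X = (\<lambda>y. xh (H y))" and "P = (\<lambda>y. ph (H y))"
  have D: "((\<lambda>y. f (H y)) has_real_derivative f' r * (1 / (sqrt (1 + (ph r)\<^sup>2) * \<tau> r))) (at (yh r))"
    if "r \<in> S" "(f has_real_derivative f' r) (at r)" for f f' r
    by (rule DERIV_chain2[OF _ H(2)[OF that(1)]]) (simp only: H(1)[OF that(1)] that(2))
  have 1: "(X has_real_derivative P y / sqrt (1 + (P y)\<^sup>2)) (at y)"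
    and 2: "(P has_real_derivative - c * X y) (at y)" for y
  proof -
    obtain r where "r \<in> S" "yh r = y" using onto[of y] by blast
    then have r: "r \<in> S" "y = yh r" by simp_all
    have nz: "\<tau> r > 0" "sqrt (1 + (ph r)\<^sup>2) > 0" "1 + (ph r)\<^sup>2 \<noteq> 0"
      using \<tau>_pos[OF r(1)] sqrt_pos by (auto simp: add_nonneg_eq_0_iff)
    show "(X has_real_derivative P y / sqrt (1 + (P y)\<^sup>2)) (at y)"
      unfolding X_def P_def r(2)
      by (rule DERIV_cong[OF D[of r xh "\<lambda>r. ph r * \<tau> r", OF r(1) xh[OF r(1)]]]) (use nz in \<open>simp add: H(1)[OF r(1)] del: real_sqrt_gt_0_iff\<close>)
    show "(P has_real_derivative - c * X y) (at y)"
      unfolding X_def P_def r(2)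
      by (rule DERIV_cong[OF D[of r ph "\<lambda>r. - c * xh r * (sqrt (1 + (ph r)\<^sup>2) * \<tau> r)", OF r(1) ph[OF r(1)]]]) (use nz in \<open>simp add: H(1)[OF r(1)] del: real_sqrt_gt_0_iff\<close>)
  qed
  have H0: "H 0 = 0" using H(1)[OF S(3)] by (simp only: init)
  have 3: "X 0 = 0" "P 0 = ph 0" by (simp_all only: X_def P_def H0 init)
  obtain Tm Z where ext: "extremal c X P Tm Z" by (rule extremalI[OF 1 2 3(1)])
  have "Tm (yh r) - th r = Tm (yh 0) - th 0" if r: "r \<in> S" for r
  proof (rule has_derivative_zero_unique_connected[OF S(1) is_interval_connected[OF S(2)] _ r S(3),
      where f="\<lambda>r. Tm (yh r) - th r"])
    fix q assume q: "q \<in> S"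
    have "((\<lambda>q. Tm (yh q) - th q) has_real_derivative
        1 / sqrt (1 + (P (yh q))\<^sup>2) * (sqrt (1 + (ph q)\<^sup>2) * \<tau> q) - \<tau> q) (at q)"
      by (intro DERIV_diff th q DERIV_chain2[OF extremal.Tm_deriv[OF ext] yh[OF q]])
    then have "((\<lambda>q. Tm (yh q) - th q) has_real_derivative 0) (at q)"
      unfolding P_def H(1)[OF q] using sqrt_pos[of q] by simp
    then show "((\<lambda>q. Tm (yh q) - th q) has_derivative (\<lambda>h. 0)) (at q)"
      by (simp add: has_field_derivative_def lambda_zero)
  qed
  then have 4: "Tm (yh r) = th r" if "r \<in> S" for r
    using that init extremal.Tm0[OF ext] by simp
  have 5: "X (yh r) = xh r" if "r \<in> S" for r
    by (simp only: X_def H(1)[OF that])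
  show ?thesis by (rule that[OF ext 3(2) 5 4])
qed

end

section \<open>Elliptic integrals and the first zero of X\<close>

lemma ell_K_antiderivative:
  fixes k :: real
  assumes k: "0 \<le> k" "k < 1"
  obtains G where "\<And>r. (G has_real_derivative 1 / sqrt (1 - k\<^sup>2 * (sin r)\<^sup>2)) (at r)"
    and "G 0 = 0" "G (- (pi / 2)) = - ell_K k" "G (pi / 2) = ell_K k"
proof -
  define g where "g = (\<lambda>r. 1 / sqrt (1 - k\<^sup>2 * (sin r)\<^sup>2))"
  have pos: "0 < 1 - k\<^sup>2 * (sin r)\<^sup>2" for r
  proof -
    have "k\<^sup>2 * (sin r)\<^sup>2 \<le> k\<^sup>2 * 1" by (intro mult_left_mono) (auto simp: abs_square_le_1)
    moreover have "k\<^sup>2 < 1" using k by (simp add: power_less_one_iff)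
    ultimately show ?thesis by simp
  qed
  have "isCont g r" for r unfolding g_def using pos[of r] by (intro continuous_intros) auto
  then obtain G where G: "G 0 = 0" "\<And>r. (G has_real_derivative g r) (at r)"
    using antiderivative_UNIV[of g] by metis
  have "((\<lambda>r. G (- r) + G r) has_real_derivative g (- r) * - 1 + g r) (at r)" for r
    by (rule DERIV_add[OF DERIV_chain2[OF G(2) DERIV_minus[OF DERIV_ident]] G(2)])
  then have "((\<lambda>r. G (- r) + G r) has_real_derivative 0) (at r)" for r
    by (simp add: g_def)
  from DERIV_isconst_all[OF allI[OF this], of "pi / 2" 0]
  have "G (- (pi / 2)) = - G (pi / 2)" using G(1) by simp
  moreover have "(g has_integral (G (pi/2) - G 0)) {0..pi/2}"
    by (rule fundamental_theorem_of_calculus)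
      (use G(2) in \<open>auto simp: has_real_derivative_iff_has_vector_derivative[symmetric] intro: has_field_derivative_at_within\<close>)
  then have "ell_K k = G (pi/2)" using G(1) by (simp add: ell_K_def g_def[symmetric] integral_unique)
  ultimately show ?thesis by (intro that[of G] G(2)[unfolded g_def] G(1)) simp_all
qed

text \<open>The angle starts at a maximum of the cosine, so the sine in the elliptic integral is shifted
  by a quarter of a period; \<open>r = \<pi>\<close> is half a period of the extremal.\<close>
lemma shifted_ell_K_antiderivative:
  fixes k :: real
  assumes k: "0 \<le> k" "k < 1"
  obtains G where "\<And>r. (G has_real_derivative 1 / sqrt (1 - (k * cos r)\<^sup>2)) (at r)"
    and "G 0 = 0" "G (pi / 2) = ell_K k" "G pi = 2 * ell_K k"
proof -
  obtain G where G: "\<And>r. (G has_real_derivative 1 / sqrt (1 - k\<^sup>2 * (sin r)\<^sup>2)) (at r)"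
    "G 0 = 0" "G (- (pi / 2)) = - ell_K k" "G (pi / 2) = ell_K k"
  proof (rule ell_K_antiderivative[OF k])
    fix G
    assume 1: "\<And>r. (G has_real_derivative 1 / sqrt (1 - k\<^sup>2 * (sin r)\<^sup>2)) (at r)"
      and 2: "G 0 = 0" "G (- (pi / 2)) = - ell_K k" "G (pi / 2) = ell_K k"
    show thesis by (rule that[OF 1 2])
  qed
  have Gd: "((\<lambda>r. G (r - pi / 2) + ell_K k) has_real_derivative 1 / sqrt (1 - (k * cos r)\<^sup>2)) (at r)" for r
  proof -
    have "((\<lambda>r. G (r - pi / 2) + ell_K k) has_real_derivative
        1 / sqrt (1 - k\<^sup>2 * (sin (r - pi / 2))\<^sup>2) * (1 - 0) + 0) (at r)"
      by (intro DERIV_add DERIV_chain2[OF G(1)] DERIV_diff DERIV_ident DERIV_const)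
    then show ?thesis by (simp add: sin_diff power_mult_distrib)
  qed
  show ?thesis
    by (rule that[OF Gd]) (use G in auto)
qed

lemma angle_root:
  fixes k :: real
  assumes k: "0 < k" "k < 1"
  defines "\<Delta> \<equiv> \<lambda>r. sqrt (1 - (k * cos r)\<^sup>2)"
  shows "0 < \<Delta> r" "\<Delta> r \<le> 1" "(\<Delta> r)\<^sup>2 = 1 - (k * cos r)\<^sup>2"
    "(\<Delta> has_real_derivative k\<^sup>2 * cos r * sin r / \<Delta> r) (at r)"
proof -
  have "\<bar>k * cos r\<bar> < 1"
  proof -
    have "\<bar>k * cos r\<bar> \<le> k * 1" unfolding abs_mult using k by (intro mult_mono) auto
    then show ?thesis using k by simp
  qed
  then have pos: "0 < 1 - (k * cos r)\<^sup>2" by (simp add: abs_square_less_1)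
  then show "0 < \<Delta> r" "\<Delta> r \<le> 1" "(\<Delta> r)\<^sup>2 = 1 - (k * cos r)\<^sup>2" by (auto simp: \<Delta>_def)
  have "((\<lambda>r. 1 - (k * cos r)\<^sup>2) has_real_derivative 2 * k\<^sup>2 * cos r * sin r) (at r)"
    by (auto intro!: derivative_eq_intros simp: power2_eq_square)
  from DERIV_chain2[OF DERIV_real_sqrt[OF pos] this]
  show "(\<Delta> has_real_derivative k\<^sup>2 * cos r * sin r / \<Delta> r) (at r)"
    unfolding \<Delta>_def by (rule DERIV_cong) (simp add: field_simps)
qed

lemma cosh_gt_1: "\<psi> > 0 \<Longrightarrow> cosh \<psi> > (1::real)"
  using cosh_real_nonneg_less_iff[of 0 \<psi>] by simp

text \<open>With \<open>tanh (\<psi> / 2) = k cos r\<close> one has \<open>sinh \<psi> = 2 k cos r / (1 - k\<^sup>2 cos\<^sup>2 r)\<close>, the energy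
  integral makes \<open>x\<close> a multiple of \<open>sin r / \<Delta>\<close> with \<open>\<Delta>\<^sup>2 = 1 - k\<^sup>2 cos\<^sup>2 r\<close>, and \<open>dt = k' / (\<omega> \<Delta>) dr\<close>. So \<open>x\<close> is positive for
  \<open>0 < r < \<pi>\<close> and vanishes at \<open>r = \<pi>\<close>, that is at time \<open>2 k' K(k) / \<omega>\<close>.\<close>
theorem oscillating_extremal:
  assumes c: "c > 0" and \<psi>0: "\<psi>0 > 0"
  shows "\<exists>X P Tm Z Y. extremal c X P Tm Z \<and> P 0 = sinh \<psi>0 \<and> 0 < Y \<and> X Y = 0 \<and>
     (\<forall>\<eta>. 0 < \<eta> \<and> \<eta> < Y \<longrightarrow> 0 < X \<eta>) \<and> t_bound \<psi>0 c = ereal (Tm Y)"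
proof -
  define C where "C = cosh \<psi>0"
  define k where "k = sqrt ((C - 1) / (C + 1))"
  define \<omega> where "\<omega> = sqrt c"
  define k' where "k' = sqrt (1 - k\<^sup>2)"
  have C: "C > 1" using cosh_gt_1[OF \<psi>0] by (simp add: C_def)
  have k2: "k\<^sup>2 = (C - 1) / (C + 1)" using C by (simp add: k_def)
  have k: "0 < k" "k < 1" using C by (auto simp: k_def)
  have k': "k' > 0" "k'\<^sup>2 = 1 - k\<^sup>2" using C by (auto simp: k'_def k2)
  have \<omega>: "\<omega> > 0" "\<omega>\<^sup>2 = c" using c by (auto simp: \<omega>_def)
  define \<Delta> where "\<Delta> = (\<lambda>r. sqrt (1 - (k * cos r)\<^sup>2))"
  have D: "0 < \<Delta> r" "\<Delta> r \<le> 1" "(\<Delta> r)\<^sup>2 = 1 - (k * cos r)\<^sup>2"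
    "(\<Delta> has_real_derivative k\<^sup>2 * cos r * sin r / \<Delta> r) (at r)" for r
    unfolding \<Delta>_def by (rule angle_root[OF k])+
  define xh where "xh = (\<lambda>r. 2 * k / (\<omega> * k') * (sin r / \<Delta> r))"
  define ph where "ph = (\<lambda>r. 2 * (k * cos r) / (1 - (k * cos r)\<^sup>2))"
  define \<tau> where "\<tau> = (\<lambda>r. k' / \<omega> * (1 / \<Delta> r))"
  have q: "0 < 1 - (k * cos r)\<^sup>2" for r using D(1)[of r] by (simp add: \<Delta>_def)
  have W: "sqrt (1 + (ph r)\<^sup>2) = (1 + (k * cos r)\<^sup>2) / (1 - (k * cos r)\<^sup>2)" for r
  proof (rule real_sqrt_unique)
    show "((1 + (k * cos r)\<^sup>2) / (1 - (k * cos r)\<^sup>2))\<^sup>2 = 1 + (ph r)\<^sup>2"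
      using q[of r] by (simp add: ph_def power_divide add_divide_eq_iff) (simp add: power2_eq_square algebra_simps)
  qed (use q[of r] in simp)
  have contD: "isCont \<Delta> r" for r using D(4) DERIV_isCont by blast
  have cont: "isCont (\<lambda>r. sqrt (1 + (ph r)\<^sup>2) * \<tau> r) r" for r
    unfolding W \<tau>_def using q[of r] D(1)[of r] \<omega> by (intro continuous_intros contD) auto
  obtain yh where yh: "yh 0 = 0" "\<And>r. (yh has_real_derivative sqrt (1 + (ph r)\<^sup>2) * \<tau> r) (at r)"
    using antiderivative_UNIV[OF cont] by metis
  obtain G where G: "\<And>r. (G has_real_derivative 1 / \<Delta> r) (at r)" "G 0 = 0" "G pi = 2 * ell_K k"
    using shifted_ell_K_antiderivative[of k] k unfolding \<Delta>_def by (metis less_imp_le)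
  have \<tau>_ge: "k' / \<omega> \<le> \<tau> r" for r
  proof -
    have "k' / \<omega> * 1 \<le> k' / \<omega> * (1 / \<Delta> r)"
      by (rule mult_left_mono) (use D(1,2)[of r] k' \<omega> in auto)
    then show ?thesis by (simp add: \<tau>_def)
  qed
  interpret angle c UNIV xh ph \<tau> yh "\<lambda>r. k' / \<omega> * G r"
  proof
    show "0 < \<tau> r" for r using k' \<omega> D(1)[of r] by (simp add: \<tau>_def)
    show "(xh has_real_derivative ph r * \<tau> r) (at r)" for r
    proof -
      have s: "(sin r)\<^sup>2 = 1 - (cos r)\<^sup>2" by (simp add: sin_squared_eq)
      have "cos r * \<Delta> r - sin r * (k\<^sup>2 * cos r * sin r / \<Delta> r) = cos r * ((\<Delta> r)\<^sup>2 - k\<^sup>2 * (sin r)\<^sup>2) / \<Delta> r"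
        using D(1)[of r] by (simp add: field_simps power2_eq_square)
      also have "(\<Delta> r)\<^sup>2 - k\<^sup>2 * (sin r)\<^sup>2 = k'\<^sup>2" by (simp add: D(3) s k' algebra_simps power_mult_distrib)
      finally have num: "cos r * \<Delta> r - sin r * (k\<^sup>2 * cos r * sin r / \<Delta> r) = cos r * k'\<^sup>2 / \<Delta> r" .
      have "2 * k / (\<omega> * k') * ((cos r * \<Delta> r - sin r * (k\<^sup>2 * cos r * sin r / \<Delta> r)) / (\<Delta> r * \<Delta> r)) = ph r * \<tau> r"
        unfolding num ph_def \<tau>_def D(3)[symmetric]
        using D(1)[of r] k' \<omega> by (simp add: field_simps power2_eq_square)
      then show ?thesis
        unfolding xh_def
        by (intro DERIV_cong[OF DERIV_cmult[OF DERIV_divide[OF DERIV_sin D(4)]]]) (use D(1)[of r] in auto)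
    qed
    show "(ph has_real_derivative - c * xh r * (sqrt (1 + (ph r)\<^sup>2) * \<tau> r)) (at r)" for r
    proof -
      have dn: "((\<lambda>r. 2 * (k * cos r)) has_real_derivative - 2 * k * sin r) (at r)"
        by (auto intro!: derivative_eq_intros)
      have dd: "((\<lambda>r. 1 - (k * cos r)\<^sup>2) has_real_derivative 2 * k\<^sup>2 * cos r * sin r) (at r)"
        by (auto intro!: derivative_eq_intros simp: power2_eq_square)
      have "- c * xh r * (sqrt (1 + (ph r)\<^sup>2) * \<tau> r)
          = - (2 * k * sin r) * (1 + (k * cos r)\<^sup>2) / ((\<Delta> r)\<^sup>2 * (\<Delta> r)\<^sup>2)"
        unfolding W xh_def \<tau>_def D(3)[symmetric] \<omega>(2)[symmetric]
        using D(1)[of r] k'(1) \<omega>(1) by (simp add: field_simps power2_eq_square)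
      also have "\<dots> = (- 2 * k * sin r * (1 - (k * cos r)\<^sup>2) - 2 * (k * cos r) * (2 * k\<^sup>2 * cos r * sin r))
          / ((1 - (k * cos r)\<^sup>2) * (1 - (k * cos r)\<^sup>2))"
        unfolding D(3) by (simp add: algebra_simps power2_eq_square)
      finally have eq: "- c * xh r * (sqrt (1 + (ph r)\<^sup>2) * \<tau> r) = \<dots>" .
      show ?thesis
        unfolding eq unfolding ph_def
        by (rule DERIV_divide[OF dn dd]) (use q[of r] in auto)
    qed
    show "(yh has_real_derivative sqrt (1 + (ph r)\<^sup>2) * \<tau> r) (at r)" for r by (rule yh)
    show "((\<lambda>r. k' / \<omega> * G r) has_real_derivative \<tau> r) (at r)" for r
      unfolding \<tau>_def by (rule DERIV_cmult[OF G(1)])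
    show "xh 0 = 0" "yh 0 = 0" "k' / \<omega> * G 0 = 0" by (auto simp: xh_def yh G)
    show "\<exists>r\<in>UNIV. yh r = y" for y
    proof (rule surjective_by_comparison[where B="\<lambda>r. k' / \<omega> * r" and \<beta>="\<lambda>_. k' / \<omega>"])
      show "((\<lambda>r. k' / \<omega> * r) has_real_derivative k' / \<omega>) (at r)" for r
        by (rule DERIV_cmult_Id)
      show "k' / \<omega> \<le> sqrt (1 + (ph r)\<^sup>2) * \<tau> r" for r
      proof -
        have "1 \<le> sqrt (1 + (ph r)\<^sup>2)" by simp
        then have "1 * (k' / \<omega>) \<le> sqrt (1 + (ph r)\<^sup>2) * \<tau> r"
          using \<tau>_ge k'(1) \<omega>(1) by (intro mult_mono) auto
        then show ?thesis by simp
      qed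
      show "\<exists>r\<in>UNIV. k' / \<omega> * r = y" for y
        using k'(1) \<omega>(1) by (intro bexI[of _ "y * \<omega> / k'"]) auto
    qed (use k'(1) \<omega>(1) yh in auto)
  qed auto
  obtain X P Tm Z where ext: "extremal c X P Tm Z" "P 0 = ph 0"
    "\<And>r. X (yh r) = xh r" "\<And>r. Tm (yh r) = k' / \<omega> * G r"
    using extremal_by_angle by (metis UNIV_I)
  have "ph 0 = sinh \<psi>0"
  proof -
    have "0 < sinh \<psi>0" using \<psi>0 by simp
    moreover have "(sinh \<psi>0)\<^sup>2 = C\<^sup>2 - 1" by (simp add: C_def cosh_square_eq)
    moreover have "0 < ph 0" using k q[of 0] by (simp add: ph_def)
    moreover have "(ph 0)\<^sup>2 = C\<^sup>2 - 1"
    proof -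
      have "sqrt (1 + (ph 0)\<^sup>2) = C" unfolding W cos_zero mult_1_right k2 using C by (simp add: field_simps)
      then show ?thesis by (metis add_diff_cancel_left' real_sqrt_pow2 add_nonneg_nonneg zero_le_one zero_le_power2)
    qed
    ultimately show ?thesis by (metis less_imp_le power2_eq_imp_eq)
  qed
  moreover have Y: "0 < yh pi" using yh_mono[of 0 pi] init(2) by simp
  moreover have "X (yh pi) = 0" using ext(3) by (simp add: xh_def)
  moreover have "0 < X \<eta>" if "0 < \<eta>" "\<eta> < yh pi" for \<eta>
  proof -
    obtain r where r: "yh r = \<eta>" using onto by auto
    have "0 < r" using yh_mono[of r 0] init(2) r that by (metis UNIV_I less_asym linorder_neqE)
    moreover have "r < pi" using yh_mono[of pi r] r that by (metis UNIV_I less_asym linorder_neqE)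
    ultimately have "sin r > 0" by (rule sin_gt_zero)
    then show ?thesis using ext(3)[of r] r k k' \<omega> D(1)[of r] by (simp add: xh_def)
  qed
  moreover have "t_bound \<psi>0 c = ereal (Tm (yh pi))"
    using c \<psi>0 ext(4)[of pi] G(3)
    by (simp add: t_bound_def Let_def C_def[symmetric] k_def[symmetric] k'_def \<omega>_def)
  ultimately show ?thesis using ext by metis
qed

text \<open>With \<open>1 / cosh (\<psi> / 2) = k cos r\<close> one has \<open>sinh \<psi> = 2 \<Delta> / (k cos r)\<^sup>2\<close>, \<open>x\<close> is a multiple of
  \<open>tan r\<close>, and \<open>dt = k / (\<omega> \<Delta>) dr\<close>. The solution runs to infinity as \<open>r\<close> tends to \<open>\<pi> / 2\<close>, at time \<open>k K(k) / \<omega>\<close>.\<close>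
theorem monotone_extremal:
  assumes c: "c < 0" and \<psi>0: "\<psi>0 > 0"
  shows "\<exists>X P Tm Z. extremal c X P Tm Z \<and> P 0 = sinh \<psi>0 \<and>
     (\<forall>\<eta>. 0 < \<eta> \<longrightarrow> 0 < X \<eta>) \<and> (\<forall>\<eta>. ereal (Tm \<eta>) < t_bound \<psi>0 c) \<and>
     (\<forall>t. 0 \<le> t \<and> ereal t < t_bound \<psi>0 c \<longrightarrow> (\<exists>\<eta>\<ge>0. Tm \<eta> = t))"
proof -
  define C where "C = cosh \<psi>0"
  define k where "k = sqrt (2 / (1 + C))"
  define \<omega> where "\<omega> = sqrt (- c)"
  have C: "C > 1" using cosh_gt_1[OF \<psi>0] by (simp add: C_def)
  have k2: "k\<^sup>2 = 2 / (1 + C)" using C by (simp add: k_def)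
  have k: "0 < k" "k < 1" using C by (auto simp: k_def)
  have \<omega>: "\<omega> > 0" "\<omega>\<^sup>2 = - c" using c by (auto simp: \<omega>_def)
  define \<Delta> where "\<Delta> = (\<lambda>r. sqrt (1 - (k * cos r)\<^sup>2))"
  have D: "0 < \<Delta> r" "\<Delta> r \<le> 1" "(\<Delta> r)\<^sup>2 = 1 - (k * cos r)\<^sup>2"
    "(\<Delta> has_real_derivative k\<^sup>2 * cos r * sin r / \<Delta> r) (at r)" for r
    unfolding \<Delta>_def by (rule angle_root[OF k])+
  define S where "S = {- (pi / 2)<..<pi / 2}"
  have cosp: "0 < cos r" if "r \<in> S" for r using that cos_gt_zero_pi[of r] by (simp add: S_def)
  define s where "s = (\<lambda>r. k * cos r)"
  have s: "0 < s r" "(s r)\<^sup>2 \<le> 1" if "r \<in> S" for r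
  proof -
    show "0 < s r" using cosp[OF that] k by (simp add: s_def)
    have "0 < (\<Delta> r)\<^sup>2" using D(1)[of r] by simp
    then show "(s r)\<^sup>2 \<le> 1" unfolding D(3) s_def by simp
  qed
  define xh where "xh = (\<lambda>r. 2 / (\<omega> * k) * tan r)"
  define ph where "ph = (\<lambda>r. 2 * \<Delta> r / (s r)\<^sup>2)"
  define \<tau> where "\<tau> = (\<lambda>r. k / \<omega> * (1 / \<Delta> r))"
  have W: "sqrt (1 + (ph r)\<^sup>2) = 2 / (s r)\<^sup>2 - 1" and W_ge: "1 / (s r)\<^sup>2 \<le> 2 / (s r)\<^sup>2 - 1" if r: "r \<in> S" for r
  proof -
    define b where "b = 1 / (s r)\<^sup>2"
    have b: "1 \<le> b" using s[OF r] by (simp add: b_def)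
    have "(\<Delta> r)\<^sup>2 = 1 - (s r)\<^sup>2" by (simp add: D(3) s_def)
    then have "(ph r)\<^sup>2 = 4 * (1 - (s r)\<^sup>2) / ((s r)\<^sup>2)\<^sup>2" by (simp add: ph_def power_divide power_mult_distrib)
    also have "\<dots> = 4 * b * b - 4 * b" using s(1)[OF r] by (simp add: b_def field_simps power2_eq_square)
    finally have "(2 * b - 1)\<^sup>2 = 1 + (ph r)\<^sup>2" by (simp add: power2_eq_square algebra_simps)
    then have "sqrt (1 + (ph r)\<^sup>2) = 2 * b - 1" using b by (intro real_sqrt_unique) auto
    then show "sqrt (1 + (ph r)\<^sup>2) = 2 / (s r)\<^sup>2 - 1" by (simp add: b_def)
    show "1 / (s r)\<^sup>2 \<le> 2 / (s r)\<^sup>2 - 1" using b by (simp add: b_def)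
  qed
  have contD: "isCont \<Delta> r" for r using D(4) DERIV_isCont by blast
  have \<tau>_ge: "k / \<omega> \<le> \<tau> r" for r
  proof -
    have "k / \<omega> * 1 \<le> k / \<omega> * (1 / \<Delta> r)"
      by (rule mult_left_mono) (use D(1,2)[of r] k \<omega>(1) in auto)
    then show ?thesis by (simp add: \<tau>_def)
  qed
  have cont: "isCont (\<lambda>r. sqrt (1 + (ph r)\<^sup>2) * \<tau> r) r" if "r \<in> S" for r
  proof -
    have "isCont ph r" unfolding ph_def s_def
      using cosp[OF that] k by (intro continuous_intros contD) auto
    moreover have "isCont \<tau> r" unfolding \<tau>_def
      using D(1)[of r] by (intro continuous_intros contD) auto
    ultimately show ?thesis by (intro continuous_intros)
  qed
  have memS: "ereal (- (pi / 2)) < ereal r \<Longrightarrow> ereal r < ereal (pi / 2) \<Longrightarrow> r \<in> S" for r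
    by (simp add: S_def)
  have pi0: "ereal (- (pi / 2)) < 0" "0 < ereal (pi / 2)" by simp_all
  obtain yh where "yh 0 = 0" and yh': "\<And>r. ereal (- (pi / 2)) < ereal r \<Longrightarrow> ereal r < ereal (pi / 2) \<Longrightarrow>
      (yh has_real_derivative sqrt (1 + (ph r)\<^sup>2) * \<tau> r) (at r)"
    using antiderivative_einterval[OF pi0 cont[OF memS]] by metis
  then have yh: "yh 0 = 0" "\<And>r. r \<in> S \<Longrightarrow> (yh has_real_derivative sqrt (1 + (ph r)\<^sup>2) * \<tau> r) (at r)"
    by (auto simp: S_def)
  obtain G where G: "\<And>r. (G has_real_derivative 1 / \<Delta> r) (at r)" "G 0 = 0" "G (pi / 2) = ell_K k"
    using shifted_ell_K_antiderivative[of k] k unfolding \<Delta>_def by (metis less_imp_le)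
  interpret angle c S xh ph \<tau> yh "\<lambda>r. k / \<omega> * G r"
  proof
    show "open S" "is_interval S" "0 \<in> S" by (simp_all add: S_def is_interval_oo)
    fix r assume r: "r \<in> S"
    note pos = cosp[OF r] s(1)[OF r] D(1)[of r] k(1) \<omega>(1)
    show "0 < \<tau> r" using pos by (simp add: \<tau>_def)
    show "(xh has_real_derivative ph r * \<tau> r) (at r)"
      unfolding xh_def
      by (rule DERIV_cong[OF DERIV_cmult[OF DERIV_tan]])
        (use pos in \<open>simp_all add: ph_def \<tau>_def s_def field_simps power2_eq_square\<close>)
    show "(ph has_real_derivative - c * xh r * (sqrt (1 + (ph r)\<^sup>2) * \<tau> r)) (at r)"
    proof -
      have sn: "sin r = tan r * cos r" using pos by (simp add: tan_def)
      have kcs: "k\<^sup>2 * cos r * sin r = (s r)\<^sup>2 * tan r"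
        by (simp add: sn s_def power2_eq_square)
      have dn: "((\<lambda>r. 2 * \<Delta> r) has_real_derivative 2 * ((s r)\<^sup>2 * tan r / \<Delta> r)) (at r)"
        using DERIV_cmult[OF D(4)[of r], of 2] by (simp add: kcs)
      have dd: "((\<lambda>r. (s r)\<^sup>2) has_real_derivative - 2 * ((s r)\<^sup>2 * tan r)) (at r)"
        unfolding kcs[symmetric] unfolding s_def
        by (auto intro!: derivative_eq_intros simp: power2_eq_square)
      have D3: "(\<Delta> r)\<^sup>2 = 1 - (s r)\<^sup>2" by (simp add: D(3) s_def)
      have "- c * xh r * (sqrt (1 + (ph r)\<^sup>2) * \<tau> r) = 2 * tan r * (2 / (s r)\<^sup>2 - 1) / \<Delta> r"
        unfolding W[OF r] xh_def \<tau>_def \<omega>(2)[symmetric]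
        using pos by (simp add: power2_eq_square)
      also have "\<dots> = 2 * tan r / \<Delta> r * ((2 * (\<Delta> r)\<^sup>2 + (s r)\<^sup>2) / (s r)\<^sup>2)"
        unfolding D3 using pos by (simp add: diff_divide_distrib add_divide_distrib)
      also have "\<dots> = (2 * ((s r)\<^sup>2 * tan r / \<Delta> r) * (s r)\<^sup>2 - 2 * \<Delta> r * (- 2 * ((s r)\<^sup>2 * tan r))) / ((s r)\<^sup>2 * (s r)\<^sup>2)"
        using pos by (simp add: field_simps power2_eq_square)
      finally have eq: "- c * xh r * (sqrt (1 + (ph r)\<^sup>2) * \<tau> r) = \<dots>" .
      show ?thesis
        unfolding eq unfolding ph_def
        by (rule DERIV_divide[OF dn dd]) (use pos in auto)
    qed
    show "(yh has_real_derivative sqrt (1 + (ph r)\<^sup>2) * \<tau> r) (at r)" by (rule yh(2)[OF r])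
    show "((\<lambda>r. k / \<omega> * G r) has_real_derivative \<tau> r) (at r)"
      unfolding \<tau>_def by (rule DERIV_cmult[OF G(1)])
  next
    show "xh 0 = 0" "yh 0 = 0" "k / \<omega> * G 0 = 0" by (auto simp: xh_def yh G)
    show "\<exists>r\<in>S. yh r = y" for y
    proof (rule surjective_by_comparison[where B="\<lambda>r. 1 / (k * \<omega>) * tan r" and \<beta>="\<lambda>r. 1 / (k * \<omega>) * inverse ((cos r)\<^sup>2)"])
      show "is_interval S" "0 \<in> S" by (simp_all add: S_def is_interval_oo)
      show "yh 0 = 0" "1 / (k * \<omega>) * tan 0 = 0" by (auto simp: yh)
      fix r assume r: "r \<in> S"
      note pos = cosp[OF r] s(1)[OF r] D(1)[of r] k(1) \<omega>(1)
      show "(yh has_real_derivative sqrt (1 + (ph r)\<^sup>2) * \<tau> r) (at r)" by (rule yh(2)[OF r])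
      show "((\<lambda>r. 1 / (k * \<omega>) * tan r) has_real_derivative 1 / (k * \<omega>) * inverse ((cos r)\<^sup>2)) (at r)"
        by (rule DERIV_cmult[OF DERIV_tan]) (use pos in auto)
      show "0 < 1 / (k * \<omega>) * inverse ((cos r)\<^sup>2)" using pos by simp
      have "0 \<le> 1 / (s r)\<^sup>2" by simp
      then have W0: "0 \<le> 2 / (s r)\<^sup>2 - 1" using W_ge[OF r] by linarith
      have "1 / (s r)\<^sup>2 * (k / \<omega>) \<le> sqrt (1 + (ph r)\<^sup>2) * \<tau> r"
        unfolding W[OF r] by (rule mult_mono[OF W_ge[OF r] \<tau>_ge]) (use pos W0 in simp_all)
      moreover have "1 / (s r)\<^sup>2 * (k / \<omega>) = 1 / (k * \<omega>) * inverse ((cos r)\<^sup>2)"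
        using pos by (simp add: s_def field_simps power2_eq_square)
      ultimately show "1 / (k * \<omega>) * inverse ((cos r)\<^sup>2) \<le> sqrt (1 + (ph r)\<^sup>2) * \<tau> r" by simp
    next
      show "\<exists>r\<in>S. 1 / (k * \<omega>) * tan r = y" for y
      proof (rule bexI[of _ "arctan (y * (k * \<omega>))"])
        show "1 / (k * \<omega>) * tan (arctan (y * (k * \<omega>))) = y" using k \<omega>(1) by (simp add: tan_arctan)
        show "arctan (y * (k * \<omega>)) \<in> S" using arctan_bounded by (simp add: S_def)
      qed
    qed
  qed
  obtain X P Tm Z where ext: "extremal c X P Tm Z" "P 0 = ph 0"
    "\<And>r. r \<in> S \<Longrightarrow> X (yh r) = xh r" "\<And>r. r \<in> S \<Longrightarrow> Tm (yh r) = k / \<omega> * G r"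
    using extremal_by_angle by metis
  have 0: "0 \<in> S" by (simp add: S_def)
  have "ph 0 = sinh \<psi>0"
  proof -
    have "0 < sinh \<psi>0" using \<psi>0 by simp
    moreover have "(sinh \<psi>0)\<^sup>2 = C\<^sup>2 - 1" by (simp add: C_def cosh_square_eq)
    moreover have "0 < ph 0" using D(1)[of 0] s(1)[OF 0] by (simp add: ph_def)
    moreover have "(ph 0)\<^sup>2 = C\<^sup>2 - 1"
    proof -
      have "sqrt (1 + (ph 0)\<^sup>2) = C" unfolding W[OF 0] s_def cos_zero mult_1_right k2 using C by (simp add: field_simps)
      then show ?thesis by (metis add_diff_cancel_left' real_sqrt_pow2 add_nonneg_nonneg zero_le_one zero_le_power2)
    qed
    ultimately show ?thesis by (metis less_imp_le power2_eq_imp_eq)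
  qed
  moreover have "0 < X \<eta>" if \<eta>: "0 < \<eta>" for \<eta>
  proof -
    obtain r where r: "r \<in> S" "yh r = \<eta>" using onto[of \<eta>] by blast
    have "0 < r" using yh_mono[OF r(1) 0] init(2) r(2) \<eta> by (metis less_asym linorder_neqE)
    then have "tan r > 0" using r(1) by (intro tan_gt_zero) (auto simp: S_def)
    then show ?thesis using ext(3)[OF r(1)] r k(1) \<omega>(1) by (simp add: xh_def)
  qed
  moreover have tb: "t_bound \<psi>0 c = ereal (k / \<omega> * ell_K k)"
    using c \<psi>0 by (simp add: t_bound_def Let_def C_def[symmetric] k_def[symmetric] \<omega>_def)
  moreover have "Tm \<eta> < k / \<omega> * ell_K k" for \<eta>
  proof -
    obtain r where r: "r \<in> S" "yh r = \<eta>" using onto[of \<eta>] by blast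
    have "G r < G (pi / 2)"
      by (rule increasing_of_deriv_pos[OF is_interval_univ _ _ _ G(1)]) (use r D(1) in \<open>auto simp: S_def\<close>)
    then show ?thesis using ext(4)[OF r(1)] r(2) G(3) k(1) \<omega>(1) by (simp add: divide_strict_right_mono)
  qed
  moreover have "\<exists>\<eta>\<ge>0. Tm \<eta> = t" if t: "0 \<le> t" "t < k / \<omega> * ell_K k" for t
  proof -
    have "continuous_on {0..pi / 2} (\<lambda>r. k / \<omega> * G r)"
      using G(1) by (intro continuous_intros continuous_at_imp_continuous_on ballI DERIV_isCont)
    then obtain r where r: "0 \<le> r" "r \<le> pi / 2" "k / \<omega> * G r = t"
      using IVT'[of "\<lambda>r. k / \<omega> * G r" 0 t "pi / 2"] t G(2,3) by auto
    have "r \<noteq> pi / 2" using t(2) G(3) r(3) by (metis less_irrefl)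
    then have rS: "r \<in> S" using r by (auto simp: S_def)
    moreover have "0 \<le> yh r" using yh_mono[OF 0 rS] init(2) r(1) by (cases "r = 0") auto
    ultimately show ?thesis using ext(4)[OF rS] r(3) by auto
  qed
  ultimately show ?thesis using ext(1,2) by (intro exI[of _ X] exI[of _ P] exI[of _ Tm] exI[of _ Z]) auto
qed

section \<open>Comparison curves and continuous dependence\<close>


text \<open>An extremal is itself a competitor, so extremals can be compared with each other by
  calibration; its length is its time.\<close>
lemma extremal_trajectory:
  assumes "extremal c X P Tm Z" "0 \<le> Y"
  shows "trajectory X (\<lambda>t. t) Z (\<lambda>t. P t / sqrt (1 + (P t)\<^sup>2)) (\<lambda>t. 1) Y {}"
    and "trajectory.len (\<lambda>t. P t / sqrt (1 + (P t)\<^sup>2)) (\<lambda>t. 1) Y = Tm Y"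
proof -
  interpret extremal c X P Tm Z by fact
  have root: "sqrt (1\<^sup>2 - (P t / sqrt (1 + (P t)\<^sup>2))\<^sup>2) = F t" for t
  proof -
    have "1\<^sup>2 - (P t / sqrt (1 + (P t)\<^sup>2))\<^sup>2 = 1 / (1 + (P t)\<^sup>2)"
      using sqrt_pos(2,3)[of t] by (simp add: power_divide field_simps)
    then show ?thesis by (simp add: real_sqrt_divide)
  qed
  have I: "(F has_integral (Tm Y - Tm 0)) {0..Y}"
    by (rule fundamental_theorem_of_calculus[OF assms(2)])
      (use Tm_deriv in \<open>auto simp: has_real_derivative_iff_has_vector_derivative[symmetric] intro: has_field_derivative_at_within\<close>)
  have cF: "continuous_on {0..Y} (\<lambda>t. P t / sqrt (1 + (P t)\<^sup>2))"
    using sqrt_pos by (intro continuous_intros continuous) (simp add: less_imp_neq[symmetric])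
  show tr: "trajectory X (\<lambda>t. t) Z (\<lambda>t. P t / sqrt (1 + (P t)\<^sup>2)) (\<lambda>t. 1) Y {}"
  proof
    show "Lip {0..Y} X"
      by (rule Lip_compose_C1[OF Lip_id _ has_field_derivative_at_within[OF X_deriv] cF]) auto
    show "Lip {0..Y} Z"
      by (rule Lip_compose_C1[OF Lip_id _ has_field_derivative_at_within[OF Z_deriv], where p=0 and q=Y])
        (auto intro!: continuous_intros continuous)
    show "\<bar>P t / sqrt (1 + (P t)\<^sup>2)\<bar> \<le> 1" for t using slope_lt_1[of t] by simp
    show "(\<lambda>t. sqrt (1\<^sup>2 - (P t / sqrt (1 + (P t)\<^sup>2))\<^sup>2)) integrable_on {0..Y}"
      unfolding root using I by blast
  qed (use assms(2) Lip_id X0 Z0 in \<open>auto intro: has_field_derivative_at_within X_deriv DERIV_ident has_field_derivative_at_within[OF Z_deriv, THEN DERIV_cong]\<close>)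
  show "trajectory.len (\<lambda>t. P t / sqrt (1 + (P t)\<^sup>2)) (\<lambda>t. 1) Y = Tm Y"
    unfolding trajectory.len_def[OF tr] root using I Tm0 by (simp add: integral_unique)
qed

text \<open>Curves with slope \<open>a\<close> up to \<open>\<tau>\<close> and slope \<open>b\<close> afterwards. With slopes \<open>\<sigma>\<close>, \<open>- \<sigma>\<close> they attain
  the greatest \<open>z\<close>, with slopes \<open>0\<close>, \<open>\<sigma>\<close> the least (\<open>\<sigma> = \<plusminus>1\<close>).\<close>
definition broken_x :: "real \<Rightarrow> real \<Rightarrow> real \<Rightarrow> real \<Rightarrow> real" where
  "broken_x a b \<tau> t = (if t \<le> \<tau> then a * t else a * \<tau> + b * (t - \<tau>))"

definition broken_z :: "real \<Rightarrow> real \<Rightarrow> real \<Rightarrow> real \<Rightarrow> real" where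
  "broken_z a b \<tau> t = (if t \<le> \<tau> then a\<^sup>2 * t ^ 3 / 6
     else a\<^sup>2 * \<tau> ^ 3 / 6 + ((a * \<tau>)\<^sup>2 * (t - \<tau>) + a * \<tau> * b * (t - \<tau>)\<^sup>2 + b\<^sup>2 * (t - \<tau>) ^ 3 / 3) / 2)"

lemma Lip_glue:
  assumes "Lip {0..\<tau>} f" "Lip {\<tau>..Y} g" "f \<tau> = g \<tau>"
  shows "Lip {0..Y} (\<lambda>t. if t \<le> \<tau> then f t else g t)"
proof -
  obtain L where L: "L > 0" "\<And>s t. s \<in> {0..\<tau>} \<Longrightarrow> t \<in> {0..\<tau>} \<Longrightarrow> \<bar>f s - f t\<bar> \<le> L * \<bar>s - t\<bar>"
    using LipE[OF assms(1)] by metis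
  obtain M where M: "M > 0" "\<And>s t. s \<in> {\<tau>..Y} \<Longrightarrow> t \<in> {\<tau>..Y} \<Longrightarrow> \<bar>g s - g t\<bar> \<le> M * \<bar>s - t\<bar>"
    using LipE[OF assms(2)] by metis
  let ?h = "\<lambda>t. if t \<le> \<tau> then f t else g t"
  have key: "\<bar>f s - g t\<bar> \<le> (L + M) * \<bar>s - t\<bar>" if "0 \<le> s" "s \<le> \<tau>" "\<tau> \<le> t" "t \<le> Y" for s t
  proof -
    have "\<bar>f s - f \<tau>\<bar> \<le> L * \<bar>s - \<tau>\<bar>" "\<bar>g \<tau> - g t\<bar> \<le> M * \<bar>\<tau> - t\<bar>"
      using L(2)[of s \<tau>] M(2)[of \<tau> t] that by auto
    moreover have "L * \<bar>s - \<tau>\<bar> \<le> L * \<bar>s - t\<bar>" "M * \<bar>\<tau> - t\<bar> \<le> M * \<bar>s - t\<bar>"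
      using L(1) M(1) that by (auto intro!: mult_left_mono)
    moreover have "\<bar>f s - g t\<bar> \<le> \<bar>f s - f \<tau>\<bar> + \<bar>g \<tau> - g t\<bar>" using assms(3) by linarith
    ultimately show ?thesis by (simp add: distrib_right)
  qed
  have "L * \<bar>s - t\<bar> \<le> (L + M) * \<bar>s - t\<bar>" "M * \<bar>s - t\<bar> \<le> (L + M) * \<bar>s - t\<bar>" for s t :: real
    using L(1) M(1) by (auto intro!: mult_right_mono)
  note w = order_trans[OF L(2) this(1)] order_trans[OF M(2) this(2)]
  show ?thesis
  proof (rule LipI[where L="L + M"])
    fix s t assume st: "s \<in> {0..Y}" "t \<in> {0..Y}"
    show "\<bar>?h s - ?h t\<bar> \<le> (L + M) * \<bar>s - t\<bar>"
      using w(1)[of s t] w(2)[of s t] key[of s t] key[of t s] st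
      by (cases "s \<le> \<tau>"; cases "t \<le> \<tau>") (simp_all add: abs_minus_commute)
  qed
qed

lemma broken_trajectory:
  assumes ab: "\<bar>a\<bar> \<le> 1" "\<bar>b\<bar> \<le> 1" and \<tau>: "0 \<le> \<tau>" and Y: "0 \<le> Y"
  shows "trajectory (broken_x a b \<tau>) (\<lambda>t. t) (broken_z a b \<tau>) (\<lambda>t. if t \<le> \<tau> then a else b) (\<lambda>t. 1) Y {\<tau>}"
proof
  have X: "broken_x a b \<tau> = (\<lambda>t. if t \<le> \<tau> then a * t else a * \<tau> + b * (t - \<tau>))"
    by (rule ext) (simp add: broken_x_def)
  have Z: "broken_z a b \<tau> = (\<lambda>t. if t \<le> \<tau> then 1 / 6 * a\<^sup>2 * (t * (t * t))
     else a\<^sup>2 * \<tau> ^ 3 / 6 + ((a * \<tau>)\<^sup>2 / 2 * (t - \<tau>) + a * \<tau> * b / 2 * ((t - \<tau>) * (t - \<tau>)) + b\<^sup>2 / 6 * ((t - \<tau>) * ((t - \<tau>) * (t - \<tau>)))))"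
    by (rule ext) (simp add: broken_z_def power2_eq_square power3_eq_cube add_divide_distrib)
  show "Lip {0..Y} (broken_x a b \<tau>)"
    unfolding X by (rule Lip_glue) (intro Lip_mult Lip_add Lip_diff Lip_const Lip_id | simp)+
  show "Lip {0..Y} (broken_z a b \<tau>)"
    unfolding Z by (rule Lip_glue) (intro Lip_mult Lip_add Lip_diff Lip_const Lip_id | simp add: power3_eq_cube)+
  show "Lip {0..Y} (\<lambda>t. t)" by (rule Lip_id)
  show "\<bar>if t \<le> \<tau> then a else b\<bar> \<le> 1" for t using ab by simp
  fix t assume t: "t \<in> {0..Y} - {\<tau>}"
  show "((\<lambda>t. t) has_real_derivative 1) (at t within {0..Y})" by (rule DERIV_ident)
  have "(broken_x a b \<tau> has_real_derivative (if t \<le> \<tau> then a else b)) (at t) \<and>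
     (broken_z a b \<tau> has_real_derivative (broken_x a b \<tau> t)\<^sup>2 / 2 * 1) (at t)"
  proof (cases "t < \<tau>")
    case True
    have 1: "((\<lambda>t. a * t) has_real_derivative a) (at t)" by (rule DERIV_cmult_Id)
    have 2: "((\<lambda>t. a\<^sup>2 * t ^ 3 / 6) has_real_derivative (a * t)\<^sup>2 / 2) (at t)"
      by (auto intro!: derivative_eq_intros simp: power2_eq_square)
    have "eventually (\<lambda>s. s < \<tau>) (nhds t)" by (rule eventually_nhds_in_open[of "{..<\<tau>}", simplified]) (use True in auto)
    then have e: "\<forall>\<^sub>F s in nhds t. broken_x a b \<tau> s = a * s" "\<forall>\<^sub>F s in nhds t. broken_z a b \<tau> s = a\<^sup>2 * s ^ 3 / 6"
      by (auto elim!: eventually_mono simp: broken_x_def broken_z_def)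
    show ?thesis
      using DERIV_cong_ev[OF refl e(1) refl, THEN iffD2, OF 1] DERIV_cong_ev[OF refl e(2) refl, THEN iffD2, OF 2] True
      by (simp add: broken_x_def[of a b \<tau> t])
  next
    case False
    then have gt: "\<tau> < t" using t by auto
    have 1: "((\<lambda>t. a * \<tau> + b * (t - \<tau>)) has_real_derivative b) (at t)"
      by (auto intro!: derivative_eq_intros)
    have 2: "((\<lambda>t. a\<^sup>2 * \<tau> ^ 3 / 6 + ((a * \<tau>)\<^sup>2 * (t - \<tau>) + a * \<tau> * b * (t - \<tau>)\<^sup>2 + b\<^sup>2 * (t - \<tau>) ^ 3 / 3) / 2)
        has_real_derivative (a * \<tau> + b * (t - \<tau>))\<^sup>2 / 2) (at t)"
      by (auto intro!: derivative_eq_intros simp: power2_eq_square) (simp add: field_simps)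
    have "eventually (\<lambda>s. \<tau> < s) (nhds t)" by (rule eventually_nhds_in_open[of "{\<tau><..}", simplified]) (use gt in auto)
    then have e: "\<forall>\<^sub>F s in nhds t. broken_x a b \<tau> s = a * \<tau> + b * (s - \<tau>)"
       "\<forall>\<^sub>F s in nhds t. broken_z a b \<tau> s = a\<^sup>2 * \<tau> ^ 3 / 6 + ((a * \<tau>)\<^sup>2 * (s - \<tau>) + a * \<tau> * b * (s - \<tau>)\<^sup>2 + b\<^sup>2 * (s - \<tau>) ^ 3 / 3) / 2"
      by (auto elim!: eventually_mono simp: broken_x_def broken_z_def)
    show ?thesis
      using DERIV_cong_ev[OF refl e(1) refl, THEN iffD2, OF 1] DERIV_cong_ev[OF refl e(2) refl, THEN iffD2, OF 2] gt
      by (simp add: broken_x_def[of a b \<tau> t])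
  qed
  then show "(broken_x a b \<tau> has_real_derivative (if t \<le> \<tau> then a else b)) (at t within {0..Y})"
     "(broken_z a b \<tau> has_real_derivative (broken_x a b \<tau> t)\<^sup>2 / 2 * 1) (at t within {0..Y})"
    using has_field_derivative_at_within by blast+
next
  have "(\<lambda>t. sqrt (1\<^sup>2 - a\<^sup>2)) integrable_on {0..min \<tau> Y}" "(\<lambda>t. sqrt (1\<^sup>2 - b\<^sup>2)) integrable_on {min \<tau> Y..Y}"
    by (rule integrable_const_ivl)+
  then have "(\<lambda>t. sqrt (1\<^sup>2 - (if t \<le> \<tau> then a else b)\<^sup>2)) integrable_on {0..min \<tau> Y}"
    "(\<lambda>t. sqrt (1\<^sup>2 - (if t \<le> \<tau> then a else b)\<^sup>2)) integrable_on {min \<tau> Y..Y}"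
    by (auto elim!: integrable_spike[of _ _ "{min \<tau> Y}"] split: if_splits)
  then show "(\<lambda>t. sqrt (1\<^sup>2 - (if t \<le> \<tau> then a else b)\<^sup>2)) integrable_on {0..Y}"
    using \<tau> Y by (intro Henstock_Kurzweil_Integration.integrable_combine[of 0 "min \<tau> Y" Y]) simp_all
qed (use Y \<tau> in \<open>auto simp: broken_x_def broken_z_def\<close>)


text \<open>The map is \<open>tanh \<circ> arsinh\<close>. Its derivative lies between \<open>0\<close> and \<open>1\<close>, so it is increasing and
  1-Lipschitz.\<close>
lemma slope_deriv: "((\<lambda>p. p / sqrt (1 + p\<^sup>2)) has_real_derivative 1 / (sqrt (1 + p\<^sup>2) * (1 + p\<^sup>2))) (at (p::real))"
proof -
  have q: "1 + p\<^sup>2 > 0" by (simp add: add_pos_nonneg)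
  have "((\<lambda>p. 1 + p\<^sup>2) has_real_derivative 2 * p) (at p)" by (auto intro!: derivative_eq_intros)
  note d = DERIV_divide[OF DERIV_ident DERIV_chain2[OF DERIV_real_sqrt[OF q] this]]
  have sq: "sqrt (1 + p\<^sup>2) * sqrt (1 + p\<^sup>2) = 1 + p\<^sup>2" using q by simp
  have nz: "sqrt (1 + p\<^sup>2) \<noteq> 0" using q by simp
  have "(1 * sqrt (1 + p\<^sup>2) - p * (inverse (sqrt (1 + p\<^sup>2)) / 2 * (2 * p))) = (sqrt (1 + p\<^sup>2) * sqrt (1 + p\<^sup>2) - p\<^sup>2) / sqrt (1 + p\<^sup>2)"
    using nz by (simp add: field_simps power2_eq_square del: real_sqrt_mult_self)
  also have "\<dots> = 1 / sqrt (1 + p\<^sup>2)" unfolding sq by simp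
  finally show ?thesis
    using d nz by (simp add: sq divide_divide_eq_left del: real_sqrt_eq_zero_cancel_iff real_sqrt_mult_self)
qed

lemma slope_strict_mono: "p < q \<Longrightarrow> p / sqrt (1 + p\<^sup>2) < q / sqrt (1 + (q::real)\<^sup>2)"
  by (rule DERIV_pos_imp_increasing) (use slope_deriv in \<open>fastforce simp: add_pos_nonneg\<close>)+

lemma slope_lipschitz: "\<bar>p / sqrt (1 + p\<^sup>2) - q / sqrt (1 + (q::real)\<^sup>2)\<bar> \<le> \<bar>p - q\<bar>"
proof -
  have "1-lipschitz_on UNIV (\<lambda>p::real. p / sqrt (1 + p\<^sup>2))"
  proof (rule bounded_derivative_imp_lipschitz)
    fix r :: real
    show "((\<lambda>p. p / sqrt (1 + p\<^sup>2)) has_derivative (*) (1 / (sqrt (1 + r\<^sup>2) * (1 + r\<^sup>2)))) (at r within UNIV)"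
      using slope_deriv[of r] by (simp add: has_field_derivative_def)
    have "1 * 1 \<le> sqrt (1 + r\<^sup>2) * (1 + r\<^sup>2)" by (intro mult_mono) auto
    then have "1 / (sqrt (1 + r\<^sup>2) * (1 + r\<^sup>2)) \<le> 1" by simp
    moreover have "0 \<le> 1 / (sqrt (1 + r\<^sup>2) * (1 + r\<^sup>2))" by (simp add: add_nonneg_nonneg)
    ultimately show "onorm ((*) (1 / (sqrt (1 + r\<^sup>2) * (1 + r\<^sup>2)))) \<le> 1"
      by (intro onorm_le) (metis abs_of_nonneg mult_right_mono norm_ge_zero norm_mult real_norm_def)
  qed auto
  from lipschitz_onD[OF this, of p q] show ?thesis by (simp add: dist_real_def)
qed

text \<open>Gronwall's inequality for the squared distance, possible because the field is globally
  Lipschitz in \<open>(X, P)\<close> and \<open>\<bar>X' \<eta>\<bar> \<le> Y\<close> bounds the effect of changing \<open>c\<close>.\<close>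
lemma extremal_dependence:
  assumes e: "extremal c X P Tm Z" and e': "extremal c' X' P' Tm' Z'" and \<eta>: "0 \<le> \<eta>" "\<eta> \<le> Y"
  shows "(X \<eta> - X' \<eta>)\<^sup>2 + (P \<eta> - P' \<eta>)\<^sup>2 \<le> exp ((2 + \<bar>c\<bar>) * Y) * ((P 0 - P' 0)\<^sup>2 + (c - c')\<^sup>2 * Y ^ 3)"
proof -
  interpret e: extremal c X P Tm Z by fact
  interpret e': extremal c' X' P' Tm' Z' by fact
  define K where "K = 2 + \<bar>c\<bar>"
  have Y0: "0 \<le> Y" using \<eta> by simp
  define D where "D = (\<lambda>r. (X r - X' r)\<^sup>2 + (P r - P' r)\<^sup>2)"
  define d where "d = (\<lambda>r. 2 * (X r - X' r) * (P r / sqrt (1 + (P r)\<^sup>2) - P' r / sqrt (1 + (P' r)\<^sup>2))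
     + 2 * (P r - P' r) * (- c * X r - (- c' * X' r)))"
  have D: "(D has_real_derivative d r) (at r)" for r
    unfolding D_def d_def
    by (rule DERIV_cong[OF DERIV_add[OF DERIV_power[OF DERIV_diff[OF e.X_deriv e'.X_deriv]]
            DERIV_power[OF DERIV_diff[OF e.P_deriv e'.P_deriv]]]]) (simp add: algebra_simps diff_divide_distrib)
  have d_le: "d r \<le> K * D r + (c - c')\<^sup>2 * Y\<^sup>2" if r: "0 \<le> r" "r \<le> Y" for r
  proof -
    define x p g where "x = X r - X' r" and "p = P r - P' r"
      and "g = P r / sqrt (1 + (P r)\<^sup>2) - P' r / sqrt (1 + (P' r)\<^sup>2)"
    have g: "g\<^sup>2 \<le> p\<^sup>2" using slope_lipschitz[of "P r" "P' r"] by (simp add: g_def p_def abs_le_square_iff)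
    have "\<bar>X' r\<bar> \<le> Y" using e'.X_lipschitz[of r 0] e'.X0 r by simp
    then have X': "(X' r)\<^sup>2 \<le> Y\<^sup>2" using Y0 by (simp add: abs_le_square_iff[symmetric])
    have t1: "2 * x * g \<le> x\<^sup>2 + p\<^sup>2" using g zero_le_power2[of "x - g"] by (simp add: power2_eq_square algebra_simps)
    have t2: "- 2 * c * x * p \<le> \<bar>c\<bar> * (x\<^sup>2 + p\<^sup>2)"
    proof -
      have "\<bar>2 * x * p\<bar> \<le> x\<^sup>2 + p\<^sup>2"
        using zero_le_power2[of "x - p"] zero_le_power2[of "x + p"] by (simp add: power2_eq_square abs_le_iff algebra_simps)
      then have "\<bar>c\<bar> * \<bar>2 * x * p\<bar> \<le> \<bar>c\<bar> * (x\<^sup>2 + p\<^sup>2)" by (rule mult_left_mono) simp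
      then have le: "\<bar>c * (2 * x * p)\<bar> \<le> \<bar>c\<bar> * (x\<^sup>2 + p\<^sup>2)" by (simp only: abs_mult[of c])
      have "- 2 * c * x * p = - (c * (2 * x * p))" by simp
      also have "\<dots> \<le> \<bar>c * (2 * x * p)\<bar>" by (rule abs_ge_minus_self)
      finally show ?thesis using le by linarith
    qed
    have t3: "2 * p * ((c' - c) * X' r) \<le> p\<^sup>2 + (c - c')\<^sup>2 * Y\<^sup>2"
    proof -
      have "2 * p * ((c' - c) * X' r) \<le> p\<^sup>2 + ((c' - c) * X' r)\<^sup>2"
        using zero_le_power2[of "p - (c' - c) * X' r"] by (simp add: power2_diff)
      also have "((c' - c) * X' r)\<^sup>2 \<le> (c - c')\<^sup>2 * Y\<^sup>2"
        unfolding power_mult_distrib using X' by (simp add: power2_commute mult_left_mono)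
      finally show ?thesis by simp
    qed
    have d_eq: "d r = 2 * x * g + (- 2 * c * x * p) + 2 * p * ((c' - c) * X' r)"
      by (simp add: d_def x_def p_def g_def algebra_simps)
    have Dr: "D r = x\<^sup>2 + p\<^sup>2" by (simp add: D_def x_def p_def)
    from add_mono[OF add_mono[OF t1 t2] t3]
    have "d r \<le> x\<^sup>2 + p\<^sup>2 + \<bar>c\<bar> * (x\<^sup>2 + p\<^sup>2) + (p\<^sup>2 + (c - c')\<^sup>2 * Y\<^sup>2)" unfolding d_eq .
    also have "\<dots> \<le> K * D r + (c - c')\<^sup>2 * Y\<^sup>2" unfolding Dr K_def by (simp add: distrib_right)
    finally show ?thesis .
  qed
  define E where "E = (\<lambda>r. exp (- K * r) * D r - (c - c')\<^sup>2 * Y\<^sup>2 * r)"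
  have "E \<eta> \<le> E 0"
  proof (rule DERIV_nonpos_imp_nonincreasing[OF \<eta>(1)])
    fix r assume r: "0 \<le> r" "r \<le> \<eta>"
    have "(E has_real_derivative exp (- K * r) * (d r - K * D r) - (c - c')\<^sup>2 * Y\<^sup>2) (at r)"
      unfolding E_def by (auto intro!: derivative_eq_intros D simp: algebra_simps)
    moreover have "exp (- K * r) * (d r - K * D r) \<le> (c - c')\<^sup>2 * Y\<^sup>2"
    proof -
      have "exp (- K * r) * (d r - K * D r) \<le> exp (- K * r) * ((c - c')\<^sup>2 * Y\<^sup>2)"
        using d_le[of r] r \<eta> by (intro mult_left_mono) auto
      also have "\<dots> \<le> 1 * ((c - c')\<^sup>2 * Y\<^sup>2)"
      proof (rule mult_right_mono)
        have "0 \<le> K * r" using r by (simp add: K_def)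
        then show "exp (- K * r) \<le> 1" by simp
      qed simp
      finally show ?thesis by simp
    qed
    ultimately show "\<exists>y. (E has_real_derivative y) (at r) \<and> y \<le> 0" by force
  qed
  then have "exp (- K * \<eta>) * D \<eta> \<le> D 0 + (c - c')\<^sup>2 * Y\<^sup>2 * \<eta>" by (simp add: E_def)
  also have "\<dots> \<le> D 0 + (c - c')\<^sup>2 * Y ^ 3"
  proof -
    have "(c - c')\<^sup>2 * Y\<^sup>2 * \<eta> \<le> (c - c')\<^sup>2 * Y\<^sup>2 * Y" using \<eta> by (intro mult_left_mono) auto
    then show ?thesis by (simp add: power3_eq_cube power2_eq_square mult.assoc)
  qed
  finally have "exp (K * \<eta>) * (exp (- K * \<eta>) * D \<eta>) \<le> exp (K * \<eta>) * (D 0 + (c - c')\<^sup>2 * Y ^ 3)"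
    by (rule mult_left_mono) simp
  then have "D \<eta> \<le> exp (K * \<eta>) * (D 0 + (c - c')\<^sup>2 * Y ^ 3)"
    by (simp add: mult.assoc[symmetric] exp_minus_inverse exp_minus)
  also have "\<dots> \<le> exp (K * Y) * (D 0 + (c - c')\<^sup>2 * Y ^ 3)"
  proof (rule mult_right_mono)
    have "K * \<eta> \<le> K * Y" using \<eta> by (intro mult_left_mono) (auto simp: K_def)
    then show "exp (K * \<eta>) \<le> exp (K * Y)" by simp
    show "0 \<le> D 0 + (c - c')\<^sup>2 * Y ^ 3" using Y0 by (simp add: D_def)
  qed
  finally show ?thesis by (simp add: D_def K_def e.X0 e'.X0)
qed

section \<open>Bounds and uniqueness for extremals\<close>

text \<open>The form of the optimality statement that the sequel uses. Leaving the final \<open>z\<close> of the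
  competitor free makes it useful beyond optimality: for bounds, for uniqueness and for comparing different \<open>c\<close>.\<close>
theorem calibration:
  assumes tr: "trajectory x y z u v T N" and ext: "extremal c X P Tm Z"
    and Y: "y T = Y" "0 < Y" and P0: "0 < P 0"
    and pos: "\<And>\<eta>. 0 < \<eta> \<Longrightarrow> \<eta> < Y \<Longrightarrow> 0 < X \<eta>" and "x T = X Y"
  shows "trajectory.len u v T \<le> Tm Y + c * (Z Y - z T)"
    and "trajectory.len u v T = Tm Y + c * (Z Y - z T) \<Longrightarrow> \<exists>C. \<forall>t\<in>{0..T}. x t = C * X (y t)"
proof -
  interpret trajectory x y z u v T N by fact
  interpret extremal c X P Tm Z by fact
  interpret calibrated x y z u v T N c X P Tm Z "y T"
    by unfold_locales (use assms(3-) in auto)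
  show "len \<le> Tm Y + c * (Z Y - z T)" using len_le Y(1) by simp
  show "\<exists>C. \<forall>t\<in>{0..T}. x t = C * X (y t)" if "len = Tm Y + c * (Z Y - z T)"
  proof -
    have "len = Tm (y T) + c * (Z (y T) - z T)" using that Y(1) by simp
    then show ?thesis
    proof (rule proportional)
      fix C assume "\<And>t. 0 \<le> t \<Longrightarrow> t \<le> T \<Longrightarrow> x t = C * X (y t)"
      then show ?thesis by (intro exI[of _ C]) auto
    qed
  qed
qed

text \<open>Apply \<open>calibration\<close> to the broken curves that realise the greatest and the least \<open>z\<close>:
  their length is nonnegative while that of the extremal is at most \<open>Y\<close>. So for large \<open>\<bar>c\<bar>\<close> the final \<open>z\<close> of the extremal is
  close to an extreme value.\<close>
lemma calibration_bound:
  assumes ext: "extremal c X P Tm Z" and Y: "0 < Y" and P0: "0 < P 0"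
    and pos: "\<And>\<eta>. 0 < \<eta> \<Longrightarrow> \<eta> < Y \<Longrightarrow> 0 < X \<eta>" and X: "0 \<le> X Y"
  shows "c * (zig 0 (X Y) Y - Z Y) \<le> Y" "c * (X Y ^ 3 / 6 - Z Y) \<le> Y"
proof -
  interpret extremal c X P Tm Z by fact
  have XY: "X Y \<le> Y" using X_lipschitz[of Y 0] X0 Y by simp
  have b: "c * (broken_z a b \<tau> Y - Z Y) \<le> Y"
    if "\<bar>a\<bar> \<le> 1" "\<bar>b\<bar> \<le> 1" "0 \<le> \<tau>" "broken_x a b \<tau> Y = X Y" for a b \<tau>
  proof -
    have tr: "trajectory (broken_x a b \<tau>) (\<lambda>t. t) (broken_z a b \<tau>) (\<lambda>t. if t \<le> \<tau> then a else b) (\<lambda>t. 1) Y {\<tau>}"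
      using broken_trajectory[OF that(1-3)] Y by simp
    have "0 \<le> Tm Y + c * (Z Y - broken_z a b \<tau> Y)"
      using trajectory.len_nonneg[OF tr] calibration(1)[OF tr ext refl Y P0 pos that(4)] by linarith
    moreover have "Tm Y \<le> Y" using Tm_le Y by simp
    ultimately show ?thesis by (simp add: right_diff_distrib)
  qed
  have "broken_x 1 (- 1) ((X Y + Y) / 2) Y = X Y"
    using XY by (auto simp: broken_x_def field_simps)
  moreover have "broken_z 1 (- 1) ((X Y + Y) / 2) Y = zig 0 (X Y) Y"
    using XY by (auto simp: broken_z_def zig_def field_simps power2_eq_square power3_eq_cube)
  ultimately show "c * (zig 0 (X Y) Y - Z Y) \<le> Y"
    using b[of 1 "- 1" "(X Y + Y) / 2"] X Y by simp
  have bx: "broken_x 0 1 (Y - X Y) Y = X Y" and bz: "broken_z 0 1 (Y - X Y) Y = X Y ^ 3 / 6"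
    using X by (auto simp: broken_x_def broken_z_def)
  show "c * (X Y ^ 3 / 6 - Z Y) \<le> Y"
    unfolding bz[symmetric] by (rule b) (use bx XY in auto)
qed

lemma extremal_zero:
  assumes "extremal c X P Tm Z" "P 0 = 0" "0 \<le> \<eta>"
  shows "X \<eta> = 0"
proof -
  have "extremal c (\<lambda>_. 0) (\<lambda>_. 0) (\<lambda>\<eta>. \<eta>) (\<lambda>_. 0)" by unfold_locales auto
  from extremal_dependence[OF assms(1) this assms(3) order_refl] assms(2)
  have "(X \<eta>)\<^sup>2 + (P \<eta>)\<^sup>2 \<le> 0" by simp
  then show ?thesis by (simp add: sum_power2_le_zero_iff)
qed

lemma slope_le_iff: "p / sqrt (1 + p\<^sup>2) \<le> q / sqrt (1 + (q::real)\<^sup>2) \<longleftrightarrow> p \<le> q"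
proof
  assume "p \<le> q"
  then show "p / sqrt (1 + p\<^sup>2) \<le> q / sqrt (1 + q\<^sup>2)"
    using slope_strict_mono[of p q] by (cases "p = q") simp_all
next
  assume "p / sqrt (1 + p\<^sup>2) \<le> q / sqrt (1 + q\<^sup>2)"
  then show "p \<le> q" using slope_strict_mono[of q p] by (meson not_le)
qed

lemma slope_inj: "p / sqrt (1 + p\<^sup>2) = q / sqrt (1 + (q::real)\<^sup>2) \<Longrightarrow> p = q"
  using slope_le_iff[of p q] slope_le_iff[of q p] by linarith

lemma extremal_momentum_unique:
  assumes e: "extremal c X P Tm Z" and e': "extremal c' X' P' Tm' Z'"
    and Y: "0 < Y" and eq: "\<And>\<eta>. \<eta> \<in> {0..Y} \<Longrightarrow> X' \<eta> = X \<eta>"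
  shows "\<And>\<eta>. \<eta> \<in> {0..Y} \<Longrightarrow> P' \<eta> = P \<eta>"
proof -
  fix \<eta> assume \<eta>: "\<eta> \<in> {0..Y}"
  have "(X has_vector_derivative P \<eta> / sqrt (1 + (P \<eta>)\<^sup>2)) (at \<eta> within {0..Y})"
    using has_field_derivative_at_within[OF extremal.X_deriv[OF e]] by (simp add: has_real_derivative_iff_has_vector_derivative)
  moreover have "(X has_real_derivative P' \<eta> / sqrt (1 + (P' \<eta>)\<^sup>2)) (at \<eta> within {0..Y})"
    by (rule has_field_derivative_transform_within[OF has_field_derivative_at_within[OF extremal.X_deriv[OF e']] zero_less_one \<eta>])
      (simp add: eq)
  then have "(X has_vector_derivative P' \<eta> / sqrt (1 + (P' \<eta>)\<^sup>2)) (at \<eta> within {0..Y})"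
    by (simp add: has_real_derivative_iff_has_vector_derivative)
  ultimately have "P \<eta> / sqrt (1 + (P \<eta>)\<^sup>2) = P' \<eta> / sqrt (1 + (P' \<eta>)\<^sup>2)"
    by (rule vector_derivative_unique_within_closed_interval[of 0 Y \<eta> X, unfolded box_real(2), OF Y \<eta>])
  then show "P' \<eta> = P \<eta>" by (rule slope_inj[symmetric])
qed

lemma extremal_parameter_unique:
  assumes e: "extremal c X P Tm Z" and e': "extremal c' X' P' Tm' Z'"
    and Y: "0 < Y" and eq: "\<And>\<eta>. \<eta> \<in> {0..Y} \<Longrightarrow> X' \<eta> = X \<eta>" and \<eta>: "0 < \<eta>" "\<eta> < Y" "X \<eta> \<noteq> 0"
  shows "c' = c"
proof -
  have Peq: "\<And>\<eta>. \<eta> \<in> {0..Y} \<Longrightarrow> P' \<eta> = P \<eta>" by (rule extremal_momentum_unique[OF e e' Y eq])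
  have "(P' has_real_derivative - c' * X' \<eta>) (at \<eta>)" by (rule extremal.P_deriv[OF e'])
  moreover have "eventually (\<lambda>r. r \<in> {0<..<Y}) (nhds \<eta>)" by (rule eventually_nhds_in_open) (use \<eta> in auto)
  then have "\<forall>\<^sub>F r in nhds \<eta>. P r = P' r" by (rule eventually_mono) (use Peq in auto)
  then have "(P' has_real_derivative - c * X \<eta>) (at \<eta>)"
    using DERIV_cong_ev[OF refl _ refl, THEN iffD1, OF _ extremal.P_deriv[OF e]] by blast
  ultimately have "- c' * X' \<eta> = - c * X \<eta>" by (rule DERIV_unique)
  then show ?thesis using eq[of \<eta>] \<eta> by simp
qed

lemma extremal_agree:
  assumes e: "extremal c X P Tm Z" and e': "extremal c X' P' Tm' Z'" and P: "P' 0 = P 0" and \<eta>: "0 \<le> \<eta>"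
  shows "X' \<eta> = X \<eta>" "P' \<eta> = P \<eta>" "Tm' \<eta> = Tm \<eta>" "Z' \<eta> = Z \<eta>"
proof -
  have XP: "X' r = X r \<and> P' r = P r" if "0 \<le> r" for r
  proof -
    have "(X r - X' r)\<^sup>2 + (P r - P' r)\<^sup>2 \<le> 0"
      using extremal_dependence[OF e e' that order_refl] P by simp
    then show ?thesis by (simp add: sum_power2_le_zero_iff)
  qed
  then show "X' \<eta> = X \<eta>" "P' \<eta> = P \<eta>" using \<eta> by auto
  have *: "f \<eta> = g \<eta>"
    if d: "\<And>r. 0 \<le> r \<Longrightarrow> (f has_real_derivative h r) (at r)" "\<And>r. 0 \<le> r \<Longrightarrow> (g has_real_derivative h r) (at r)"
      and 0: "f 0 = g 0" for f g h :: "real \<Rightarrow> real"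
  proof -
    have dd: "((\<lambda>r. f r - g r) has_real_derivative 0) (at r)" if "0 \<le> r" for r
      using DERIV_diff[OF d(1)[OF that] d(2)[OF that]] by simp
    have "f \<eta> - g \<eta> = f 0 - g 0"
    proof (cases "\<eta> = 0")
      case False
      then have "0 < \<eta>" using \<eta> by simp
      then show ?thesis
        by (rule DERIV_isconst2[of 0 \<eta> "\<lambda>r. f r - g r"])
          (use dd \<eta> in \<open>auto intro!: continuous_at_imp_continuous_on DERIV_isCont\<close>)
    qed simp
    then show ?thesis using 0 by simp
  qed
  show "Tm' \<eta> = Tm \<eta>"
  proof (rule *)
    show "(Tm has_real_derivative 1 / sqrt (1 + (P r)\<^sup>2)) (at r)" for r by (rule extremal.Tm_deriv[OF e])
    show "(Tm' has_real_derivative 1 / sqrt (1 + (P r)\<^sup>2)) (at r)" if "0 \<le> r" for r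
      using extremal.Tm_deriv[OF e', of r] XP[OF that] by simp
  qed (simp add: extremal.Tm0[OF e] extremal.Tm0[OF e'])
  show "Z' \<eta> = Z \<eta>"
  proof (rule *)
    show "(Z has_real_derivative (X r)\<^sup>2 / 2) (at r)" for r by (rule extremal.Z_deriv[OF e])
    show "(Z' has_real_derivative (X r)\<^sup>2 / 2) (at r)" if "0 \<le> r" for r
      using extremal.Z_deriv[OF e', of r] XP[OF that] by simp
  qed (simp add: extremal.Z0[OF e] extremal.Z0[OF e'])
qed

text \<open>The slope of \<open>X\<close> cannot drop much if the initial momentum is large compared with \<open>c\<close>; this
  bounds the momentum of an extremal with a prescribed endpoint.\<close>
lemma extremal_slope_bounds:
  assumes e: "extremal c X P Tm Z" and \<eta>: "0 \<le> \<eta>" "\<eta> \<le> Y"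
  shows "P 0 - \<bar>c\<bar> * Y * Y \<le> P \<eta>"
    and "\<eta> * ((P 0 - \<bar>c\<bar> * Y * Y) / sqrt (1 + (P 0 - \<bar>c\<bar> * Y * Y)\<^sup>2)) \<le> X \<eta>"
proof -
  interpret extremal c X P Tm Z by fact
  have Pl: "P 0 - \<bar>c\<bar> * Y * Y \<le> P r" if r: "0 \<le> r" "r \<le> Y" for r
  proof -
    have "P 0 + \<bar>c\<bar> * Y * 0 \<le> P r + \<bar>c\<bar> * Y * r"
    proof (rule DERIV_nonneg_imp_nondecreasing[OF r(1)])
      fix q assume q: "0 \<le> q" "q \<le> r"
      have "((\<lambda>q. P q + \<bar>c\<bar> * Y * q) has_real_derivative - c * X q + \<bar>c\<bar> * Y) (at q)"
        by (intro DERIV_add P_deriv DERIV_cmult_Id)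
      moreover have "\<bar>X q\<bar> \<le> Y" using X_lipschitz[of q 0] X0 q r by simp
      then have "\<bar>c\<bar> * \<bar>X q\<bar> \<le> \<bar>c\<bar> * Y" by (rule mult_left_mono) simp
      then have "\<bar>c * X q\<bar> \<le> \<bar>c\<bar> * Y" by (simp only: abs_mult)
      then have "0 \<le> - c * X q + \<bar>c\<bar> * Y" by (simp add: abs_le_iff)
      ultimately show "\<exists>d. ((\<lambda>q. P q + \<bar>c\<bar> * Y * q) has_real_derivative d) (at q) \<and> 0 \<le> d" by blast
    qed
    moreover have "\<bar>c\<bar> * Y * r \<le> \<bar>c\<bar> * Y * Y" using r by (intro mult_left_mono) auto
    ultimately show ?thesis by simp
  qed
  then show "P 0 - \<bar>c\<bar> * Y * Y \<le> P \<eta>" using \<eta> by blast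
  define g where "g = (P 0 - \<bar>c\<bar> * Y * Y) / sqrt (1 + (P 0 - \<bar>c\<bar> * Y * Y)\<^sup>2)"
  have "X 0 - g * 0 \<le> X \<eta> - g * \<eta>"
  proof (rule DERIV_nonneg_imp_nondecreasing[OF \<eta>(1)])
    fix q assume q: "0 \<le> q" "q \<le> \<eta>"
    have "((\<lambda>q. X q - g * q) has_real_derivative P q / sqrt (1 + (P q)\<^sup>2) - g) (at q)"
      by (intro DERIV_diff X_deriv DERIV_cmult_Id)
    moreover have "g \<le> P q / sqrt (1 + (P q)\<^sup>2)"
      unfolding g_def using Pl[of q] q \<eta> slope_strict_mono[of "P 0 - \<bar>c\<bar> * Y * Y" "P q"]
      by (cases "P 0 - \<bar>c\<bar> * Y * Y = P q") auto
    ultimately show "\<exists>d. ((\<lambda>q. X q - g * q) has_real_derivative d) (at q) \<and> 0 \<le> d" by force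
  qed
  then show "\<eta> * ((P 0 - \<bar>c\<bar> * Y * Y) / sqrt (1 + (P 0 - \<bar>c\<bar> * Y * Y)\<^sup>2)) \<le> X \<eta>"
    unfolding g_def[symmetric] by (simp add: X0 mult.commute)
qed

lemma slope_pos_iff: "0 < p / sqrt (1 + p\<^sup>2) \<longleftrightarrow> 0 < (p::real)"
proof -
  have "0 < 1 + p\<^sup>2" by (simp add: add_pos_nonneg)
  then show ?thesis by (simp add: zero_less_divide_iff)
qed

lemma extremal_initially_positive:
  assumes e: "extremal c X P Tm Z" and "\<bar>c\<bar> * \<delta> * \<delta> < P 0" "0 < \<eta>" "\<eta> \<le> \<delta>"
  shows "0 < X \<eta>"
proof -
  define g where "g = (P 0 - \<bar>c\<bar> * \<delta> * \<delta>) / sqrt (1 + (P 0 - \<bar>c\<bar> * \<delta> * \<delta>)\<^sup>2)"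
  have "0 < g" unfolding g_def slope_pos_iff using assms(2) by simp
  then have "0 < \<eta> * g" using assms(3) by simp
  also have "\<eta> * g \<le> X \<eta>" unfolding g_def
    by (rule extremal_slope_bounds(2)[OF e]) (use assms in auto)
  finally show ?thesis .
qed

text \<open>An inner zero of a nonnegative \<open>X\<close> would be a double zero, but by the energy \<open>\<bar>P\<bar> = P 0 > 0\<close> at
  every zero of \<open>X\<close>. Hence strict positivity survives limits.\<close>
lemma extremal_no_inner_zero:
  assumes e: "extremal c X P Tm Z" and P0: "0 < P 0"
    and nonneg: "\<And>r. r \<in> {a..b} \<Longrightarrow> 0 \<le> X r" and \<eta>: "a < \<eta>" "\<eta> < b"
  shows "0 < X \<eta>"
proof (rule ccontr)
  assume "\<not> 0 < X \<eta>"
  then have X: "X \<eta> = 0" using nonneg[of \<eta>] \<eta> by auto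
  have "P \<eta> / sqrt (1 + (P \<eta>)\<^sup>2) = 0"
  proof (rule DERIV_local_min[OF extremal.X_deriv[OF e]])
    show "0 < min (\<eta> - a) (b - \<eta>)" using \<eta> by simp
    show "\<forall>r. \<bar>\<eta> - r\<bar> < min (\<eta> - a) (b - \<eta>) \<longrightarrow> X \<eta> \<le> X r"
    proof (intro allI impI)
      fix r assume "\<bar>\<eta> - r\<bar> < min (\<eta> - a) (b - \<eta>)"
      then have "r \<in> {a..b}" by (auto simp: abs_less_iff)
      then show "X \<eta> \<le> X r" using nonneg X by simp
    qed
  qed
  then have "P \<eta> = 0" using extremal.sqrt_pos[OF e, of \<eta>] by simp
  then show False using extremal.P_at_zero[OF e X] P0 by simp
qed

section \<open>Every endpoint is reached by an extremal\<close>

lemma slope_surj: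
  fixes w :: real
  assumes "0 \<le> w" "w < 1"
  obtains b where "0 \<le> b" "b / sqrt (1 + b\<^sup>2) = w"
proof
  have w2: "w\<^sup>2 < 1" using assms by (simp add: power_less_one_iff)
  define b where "b = w / sqrt (1 - w\<^sup>2)"
  have "1 + b\<^sup>2 = 1 / (1 - w\<^sup>2)" using w2 by (simp add: b_def power_divide field_simps)
  then have "sqrt (1 + b\<^sup>2) = 1 / sqrt (1 - w\<^sup>2)" by (simp add: real_sqrt_divide)
  then show "b / sqrt (1 + b\<^sup>2) = w" using w2 by (simp add: b_def)
  show "0 \<le> b" using assms w2 by (simp add: b_def)
qed

text \<open>The shooting problem: \<open>c\<close> and the initial momentum \<open>p\<close> vary, the final \<open>y\<close> is fixed.\<close>
locale extremal_family =
  fixes X P Tm Z :: "real \<Rightarrow> real \<Rightarrow> real \<Rightarrow> real" and Y :: real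
  assumes ext: "\<And>c p. 0 \<le> p \<Longrightarrow> extremal c (X c p) (P c p) (Tm c p) (Z c p)"
    and init: "\<And>c p. 0 \<le> p \<Longrightarrow> P c p 0 = p"
    and Y_pos: "0 < Y"
begin

text \<open>The square root of the bound in \<open>extremal_dependence\<close>.\<close>
definition gap :: "real \<times> real \<Rightarrow> real \<times> real \<Rightarrow> real" where
  "gap a b = sqrt (exp ((2 + \<bar>fst a\<bar>) * Y) * ((snd a - snd b)\<^sup>2 + (fst a - fst b)\<^sup>2 * Y ^ 3))"

lemma gap_tendsto: "((\<lambda>b. gap a b) \<longlongrightarrow> 0) (at a within S)"
proof -
  have "((\<lambda>b. gap a b) \<longlongrightarrow> gap a a) (at a within S)"
    unfolding gap_def by (intro tendsto_intros)
  then show ?thesis by (simp add: gap_def)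
qed

lemma X_gap:
  assumes "0 \<le> p" "0 \<le> p'" "\<eta> \<in> {0..Y}"
  shows "\<bar>X c p \<eta> - X c' p' \<eta>\<bar> \<le> gap (c, p) (c', p')"
proof -
  have "(X c p \<eta> - X c' p' \<eta>)\<^sup>2 + (P c p \<eta> - P c' p' \<eta>)\<^sup>2
      \<le> exp ((2 + \<bar>c\<bar>) * Y) * ((p - p')\<^sup>2 + (c - c')\<^sup>2 * Y ^ 3)"
    using extremal_dependence[OF ext[OF assms(1)] ext[OF assms(2)], of \<eta> Y c c'] init assms by simp
  then have "(X c p \<eta> - X c' p' \<eta>)\<^sup>2 \<le> exp ((2 + \<bar>c\<bar>) * Y) * ((p - p')\<^sup>2 + (c - c')\<^sup>2 * Y ^ 3)"
    using zero_le_power2[of "P c p \<eta> - P c' p' \<eta>"] by linarith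
  then show ?thesis unfolding gap_def fst_conv snd_conv by (rule real_le_rsqrt[of "\<bar>_\<bar>", unfolded power2_abs])
qed

lemma X_le: "0 \<le> p \<Longrightarrow> \<eta> \<in> {0..Y} \<Longrightarrow> \<bar>X c p \<eta>\<bar> \<le> Y"
  using extremal.X_lipschitz[OF ext, of p c \<eta> 0] extremal.X0[OF ext, of p c] by auto

lemma Z_gap:
  assumes p: "0 \<le> p" "0 \<le> p'"
  shows "\<bar>Z c p Y - Z c' p' Y\<bar> \<le> Y * Y * gap (c, p) (c', p')"
proof -
  let ?g = "gap (c, p) (c', p')"
  have rate: "\<bar>(X c p r)\<^sup>2 / 2 - (X c' p' r)\<^sup>2 / 2\<bar> \<le> Y * ?g" if r: "r \<in> {0..Y}" for r
  proof -
    have "\<bar>X c p r + X c' p' r\<bar> \<le> 2 * Y" using X_le[OF p(1) r, of c] X_le[OF p(2) r, of c'] by linarith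
    then have "\<bar>X c p r - X c' p' r\<bar> * \<bar>X c p r + X c' p' r\<bar> \<le> ?g * (2 * Y)"
      by (intro mult_mono X_gap[OF p r]) (auto simp: gap_def Y_pos less_imp_le)
    moreover have "(X c p r)\<^sup>2 - (X c' p' r)\<^sup>2 = (X c p r - X c' p' r) * (X c p r + X c' p' r)"
      by (simp add: power2_eq_square algebra_simps)
    ultimately have "\<bar>(X c p r)\<^sup>2 - (X c' p' r)\<^sup>2\<bar> \<le> 2 * (Y * ?g)" by (simp add: abs_mult mult_ac)
    then show ?thesis by linarith
  qed
  have d: "((\<lambda>r. s * (Z c p r - Z c' p' r) + Y * ?g * r) has_real_derivative
      s * ((X c p r)\<^sup>2 / 2 - (X c' p' r)\<^sup>2 / 2) + Y * ?g) (at r)" for s r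
    by (intro DERIV_add DERIV_cmult DERIV_diff extremal.Z_deriv[OF ext] p DERIV_cmult_Id)
  have "s * (Z c p 0 - Z c' p' 0) + Y * ?g * 0 \<le> s * (Z c p Y - Z c' p' Y) + Y * ?g * Y"
    if "s = 1 \<or> s = - 1" for s
  proof (rule DERIV_nonneg_imp_nondecreasing[of 0 Y])
    fix r assume "0 \<le> r" "r \<le> Y"
    then have "0 \<le> s * ((X c p r)\<^sup>2 / 2 - (X c' p' r)\<^sup>2 / 2) + Y * ?g"
      using rate[of r] that by (auto simp: abs_le_iff)
    then show "\<exists>d'. ((\<lambda>r. s * (Z c p r - Z c' p' r) + Y * ?g * r) has_real_derivative d') (at r) \<and> 0 \<le> d'"
      using d by blast
  qed (use Y_pos in simp)
  from this[of 1] this[of "- 1"] show ?thesis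
    using extremal.Z0[OF ext[OF p(1)]] extremal.Z0[OF ext[OF p(2)]] by (simp add: abs_le_iff mult_ac)
qed

lemma continuous_family:
  assumes "\<eta> \<in> {0..Y}"
  shows "continuous_on (UNIV \<times> {0..}) (\<lambda>q. X (fst q) (snd q) \<eta>)"
    and "continuous_on (UNIV \<times> {0..}) (\<lambda>q. Z (fst q) (snd q) Y)"
proof -
  have *: "continuous_on (UNIV \<times> {0..}) f"
    if f: "\<And>a b. a \<in> UNIV \<times> {0..} \<Longrightarrow> b \<in> UNIV \<times> {0..} \<Longrightarrow> \<bar>f a - f b\<bar> \<le> K * gap a b"
    for f :: "real \<times> real \<Rightarrow> real" and K
    unfolding continuous_on_def
  proof
    fix a :: "real \<times> real" assume a: "a \<in> UNIV \<times> {0..}"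
    have "((\<lambda>b. f b - f a) \<longlongrightarrow> 0) (at a within UNIV \<times> {0..})"
    proof (rule Lim_null_comparison)
      show "((\<lambda>b. K * gap a b) \<longlongrightarrow> 0) (at a within UNIV \<times> {0..})"
        using tendsto_mult_left[OF gap_tendsto, of K] by simp
      show "\<forall>\<^sub>F b in at a within UNIV \<times> {0..}. norm (f b - f a) \<le> K * gap a b"
        unfolding eventually_at_filter by (rule always_eventually) (use f[OF a] in \<open>auto simp: abs_minus_commute\<close>)
    qed
    then show "(f \<longlongrightarrow> f a) (at a within UNIV \<times> {0..})" by (rule LIM_zero_cancel)
  qed
  show "continuous_on (UNIV \<times> {0..}) (\<lambda>q. X (fst q) (snd q) \<eta>)"
    by (rule *[of _ 1]) (use X_gap assms in auto)
  show "continuous_on (UNIV \<times> {0..}) (\<lambda>q. Z (fst q) (snd q) Y)"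
    by (rule *[of _ "Y * Y"]) (use Z_gap in auto)
qed

definition hits :: "real \<Rightarrow> real \<Rightarrow> real \<Rightarrow> bool" where
  "hits c p \<xi> \<longleftrightarrow> 0 < p \<and> X c p Y = \<xi> \<and> (\<forall>\<eta>. 0 < \<eta> \<and> \<eta> < Y \<longrightarrow> 0 < X c p \<eta>)"

lemma hits_of_nonneg:
  assumes "0 \<le> p" and nonneg: "\<And>\<eta>. \<eta> \<in> {0..Y} \<Longrightarrow> 0 \<le> X c p \<eta>" and nz: "X c p \<eta>0 \<noteq> 0" "0 \<le> \<eta>0"
  shows "hits c p (X c p Y)"
proof -
  have "p \<noteq> 0"
    using extremal_zero[OF ext[OF assms(1)] _ nz(2)] init[OF assms(1)] nz(1) by auto
  then have "0 < p" using assms(1) by simp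
  then show ?thesis unfolding hits_def
    using extremal_no_inner_zero[OF ext[OF assms(1)] _ nonneg] init[OF assms(1)] by auto
qed

lemma parameter_bound:
  assumes "0 \<le> p" "0 \<le> b" "X c p Y \<le> Y * (b / sqrt (1 + b\<^sup>2))"
  shows "p \<le> b + \<bar>c\<bar> * Y * Y"
proof -
  have "Y * ((p - \<bar>c\<bar> * Y * Y) / sqrt (1 + (p - \<bar>c\<bar> * Y * Y)\<^sup>2)) \<le> Y * (b / sqrt (1 + b\<^sup>2))"
    using extremal_slope_bounds(2)[OF ext[OF assms(1)], of Y Y c] init[OF assms(1)] assms(3) Y_pos by simp
  then have "p - \<bar>c\<bar> * Y * Y \<le> b"
    unfolding mult_le_cancel_left_pos[OF Y_pos] slope_le_iff .
  then show ?thesis by simp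
qed

text \<open>As long as the endpoint stays positive, positivity of the whole extremal is open and closed in
  \<open>p\<close>: near \<open>0\<close> it is automatic, at \<open>Y\<close> it is assumed, and in between a nonnegative extremal has no zero.\<close>
lemma positivity_persists:
  assumes p: "0 < p1" "p1 \<le> p2"
    and end_pos: "\<And>p. p \<in> {p1..p2} \<Longrightarrow> 0 < X c p Y"
    and start: "\<And>\<eta>. \<eta> \<in> {0<..Y} \<Longrightarrow> 0 < X c p2 \<eta>"
  shows "\<eta> \<in> {0<..Y} \<Longrightarrow> 0 < X c p1 \<eta>"
proof -
  define \<delta> where "\<delta> = min Y (p1 / (\<bar>c\<bar> * Y + 1))"
  have pos1: "0 < \<bar>c\<bar> * Y + 1" using Y_pos by (simp add: add_nonneg_pos)
  have \<delta>: "0 < \<delta>" "\<delta> \<le> Y" using p pos1 Y_pos by (auto simp: \<delta>_def)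
  have \<delta>p: "\<bar>c\<bar> * \<delta> * \<delta> < p1"
  proof -
    have "\<bar>c\<bar> * \<delta> * \<delta> \<le> \<bar>c\<bar> * Y * \<delta>" using \<delta> by (intro mult_right_mono mult_left_mono) auto
    also have "\<dots> < (\<bar>c\<bar> * Y + 1) * \<delta>" using \<delta>(1) by (simp add: distrib_right)
    also have "\<dots> \<le> (\<bar>c\<bar> * Y + 1) * (p1 / (\<bar>c\<bar> * Y + 1))"
      using pos1 by (intro mult_left_mono) (auto simp: \<delta>_def)
    finally show ?thesis using pos1 by simp
  qed
  have initially: "0 < X c p r" if "p \<in> {p1..p2}" "0 < r" "r \<le> \<delta>" for p r
    using extremal_initially_positive[OF ext, of p c \<delta> r] init[of p c] that p \<delta>p by auto
  define pos where "pos = (\<lambda>p. \<forall>r\<in>{\<delta>..Y}. 0 < X c p r)"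
  have locally_const: "\<forall>\<^sub>F q in at p within {p1..p2}. pos p = pos q" if p': "p \<in> {p1..p2}" for p
  proof -
    have near: "\<forall>\<^sub>F q in at p within {p1..p2}. gap (c, p) (c, q) < e" if "0 < e" for e
    proof (rule order_tendstoD(2)[OF _ that])
      have "((\<lambda>q. gap (c, p) (c, q)) \<longlongrightarrow> gap (c, p) (c, p)) (at p within {p1..p2})"
        unfolding gap_def fst_conv snd_conv by (intro tendsto_intros)
      then show "((\<lambda>q. gap (c, p) (c, q)) \<longlongrightarrow> 0) (at p within {p1..p2})" by (simp add: gap_def)
    qed
    have dom: "\<forall>\<^sub>F q in at p within {p1..p2}. q \<in> {p1..p2}" by (simp add: eventually_at_filter)
    have p0: "0 \<le> p" using p' p by simp
    show ?thesis
    proof (cases "pos p")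
      case True
      have ne: "{\<delta>..Y} \<noteq> {}" using \<delta> by simp
      obtain r0 where r0: "r0 \<in> {\<delta>..Y}" "\<forall>r\<in>{\<delta>..Y}. X c p r0 \<le> X c p r"
        using continuous_attains_inf[OF compact_Icc ne extremal.continuous(1)[OF ext[OF p0, of c]]] by blast
      have "0 < X c p r0" using True r0(1) by (simp add: pos_def)
      from near[OF this] dom show ?thesis
      proof eventually_elim
        case (elim q)
        have "0 < X c q r" if "r \<in> {\<delta>..Y}" for r
          using X_gap[OF p0, of q r c c] bspec[OF r0(2) that] elim that \<delta> p by auto
        then show ?case using True by (simp add: pos_def)
      qed
    next
      case False
      have "\<exists>r\<in>{\<delta>..Y}. X c p r < 0"
      proof (rule ccontr)
        assume "\<not> ?thesis"
        then have nn: "0 \<le> X c p r" if r: "r \<in> {0..Y}" for r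
        proof -
          have "r = 0 \<or> 0 < r \<and> r \<le> \<delta> \<or> r \<in> {\<delta>..Y}" using r by auto
          then consider "r = 0" | "0 < r" "r \<le> \<delta>" | "r \<in> {\<delta>..Y}" by blast
          then show ?thesis
          proof cases
            case 1 then show ?thesis using extremal.X0[OF ext[OF p0], of c] by simp
          next
            case 2 then show ?thesis using initially[OF p'] by (simp add: less_imp_le)
          next
            case 3 then show ?thesis using \<open>\<not> (\<exists>r\<in>{\<delta>..Y}. X c p r < 0)\<close> by (meson not_less)
          qed
        qed
        have "0 < X c p r" if "r \<in> {\<delta>..Y}" for r
        proof (cases "r = Y")
          case True then show ?thesis using end_pos[OF p'] by simp
        next
          case False
          show ?thesis
            by (rule extremal_no_inner_zero[OF ext[OF p0] _ nn]) (use False that \<delta> init[OF p0] p' p in auto)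
        qed
        then show False using \<open>\<not> pos p\<close> by (simp add: pos_def)
      qed
      then obtain r where r: "r \<in> {\<delta>..Y}" "X c p r < 0" by blast
      then have "0 < - X c p r" by simp
      from near[OF this] dom show ?thesis
      proof eventually_elim
        case (elim q)
        have "X c q r < 0" using X_gap[OF p0, of q r c c] r elim \<delta> p by auto
        then show ?case using False r(1) by (force simp: pos_def)
      qed
    qed
  qed
  have "pos p1 = pos p2"
    by (rule connected_local_const[of "{p1..p2}"]) (use p locally_const in auto)
  moreover have "pos p2" unfolding pos_def using start \<delta> by auto
  ultimately have "pos p1" by simp
  then show "\<eta> \<in> {0<..Y} \<Longrightarrow> 0 < X c p1 \<eta>"
    using initially[of p1 \<eta>] p by (cases "\<eta> \<le> \<delta>") (auto simp: pos_def)
qed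

text \<open>For a large momentum \<open>B\<close> the extremal is positive and ends beyond \<open>\<xi>\<close>; for \<open>p = 0\<close> it ends at \<open>0\<close>.
  Take the largest \<open>p \<le> B\<close> that ends at \<open>\<xi>\<close>: from there up to \<open>B\<close> the endpoint stays positive, and
  positivity persists down to \<open>p\<close>.\<close>
lemma hits_ex:
  assumes \<xi>: "0 < \<xi>" "\<xi> < Y"
  shows "\<exists>p. hits c p \<xi>"
proof -
  obtain b where b: "0 \<le> b" "b / sqrt (1 + b\<^sup>2) = \<xi> / Y" by (rule slope_surj[of "\<xi> / Y"]) (use \<xi> in auto)
  have b0: "0 < b" using slope_pos_iff[of b] b \<xi> by simp
  define B where "B = b + \<bar>c\<bar> * Y * Y"
  have B: "0 < B" using b0 Y_pos by (simp add: B_def add_pos_nonneg)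
  have XB: "\<eta> * (\<xi> / Y) \<le> X c B \<eta>" if "\<eta> \<in> {0..Y}" for \<eta>
  proof -
    have "P c B 0 - \<bar>c\<bar> * Y * Y = b" using init[of B c] B by (simp add: B_def)
    then show ?thesis
      using extremal_slope_bounds(2)[OF ext[of B c], of \<eta> Y] B that b(2) by (simp only: atLeastAtMost_iff less_imp_le)
  qed
  have cont: "continuous_on {0..B} (\<lambda>p. X c p Y)"
  proof -
    have "continuous_on {0..B} (\<lambda>p. (c, p))" by (intro continuous_intros)
    moreover have "(\<lambda>p. (c, p)) ` {0..B} \<subseteq> UNIV \<times> {0..}" by auto
    ultimately show ?thesis
      using continuous_on_compose2[OF continuous_family(1)[of Y], of "{0..B}" "\<lambda>p. (c, p)"] Y_pos by simp
  qed
  define R where "R = {p \<in> {0..B}. X c p Y = \<xi>}"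
  have X0: "X c 0 Y = 0" by (rule extremal_zero[OF ext]) (use init Y_pos in auto)
  have BY: "\<xi> \<le> X c B Y" using XB[of Y] Y_pos by simp
  have "R \<noteq> {}"
    using IVT'[of "\<lambda>p. X c p Y" 0 \<xi> B] X0 BY \<xi> B cont unfolding R_def by force
  moreover have "compact R"
  proof -
    have "closed R" unfolding R_def by (rule continuous_closed_preimage_constant[OF cont closed_atLeastAtMost])
    moreover have "bounded R" by (rule bounded_subset[OF bounded_closed_interval[of 0 B]]) (auto simp: R_def)
    ultimately show ?thesis by (simp add: compact_eq_bounded_closed)
  qed
  ultimately obtain p where p: "p \<in> R" "\<And>q. q \<in> R \<Longrightarrow> q \<le> p"
    using compact_attains_sup[of R] by auto
  have pB: "0 \<le> p" "p \<le> B" "X c p Y = \<xi>" using p(1) by (auto simp: R_def)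
  have "p \<noteq> 0" using pB(3) X0 \<xi> by auto
  then have p0: "0 < p" using pB(1) by simp
  have above: "0 < X c q Y" if q: "q \<in> {p..B}" for q
  proof (rule ccontr)
    assume "\<not> 0 < X c q Y"
    then obtain q' where "q \<le> q'" "q' \<le> B" "X c q' Y = \<xi>"
      using IVT'[of "\<lambda>p. X c p Y" q \<xi> B] BY \<xi> q pB continuous_on_subset[OF cont, of "{q..B}"] by force
    then have "q' \<in> R" using q p0 by (auto simp: R_def)
    then have "q = p" using p(2)[of q'] \<open>q \<le> q'\<close> q by auto
    then show False using \<open>\<not> 0 < X c q Y\<close> pB(3) \<xi> by simp
  qed
  have "0 < X c p \<eta>" if "\<eta> \<in> {0<..Y}" for \<eta>
  proof (rule positivity_persists[OF p0 pB(2) above _ that])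
    fix r assume "r \<in> {0<..Y}"
    then have "0 < r * (\<xi> / Y)" "r * (\<xi> / Y) \<le> X c B r" using \<xi> XB[of r] by auto
    then show "0 < X c B r" by linarith
  qed
  then show ?thesis unfolding hits_def using p0 pB(3) by (intro exI[of _ p]) auto
qed

text \<open>Two positive extremals with the same \<open>c\<close> and the same \<open>(x, y)\<close>-endpoint calibrate each other; the
  two inequalities are opposite, so both are equalities and the extremals are proportional.\<close>
lemma hits_unique:
  assumes \<xi>: "0 < \<xi>" and h: "hits c p \<xi>" "hits c p' \<xi>"
  shows "p' = p"
proof -
  have pp: "0 < p" "0 < p'" using h by (auto simp: hits_def)
  then have e: "extremal c (X c p) (P c p) (Tm c p) (Z c p)" and e': "extremal c (X c p') (P c p') (Tm c p') (Z c p')"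
    using ext by auto
  have XY: "X c p' Y = X c p Y" using h by (simp add: hits_def)
  note t = extremal_trajectory[OF e, of Y] and t' = extremal_trajectory[OF e', of Y]
  have "Tm c p' Y \<le> Tm c p Y + c * (Z c p Y - Z c p' Y)"
    using calibration(1)[OF t'(1) e refl Y_pos] t'(2) h Y_pos pp init[of p c] XY by (simp add: hits_def)
  moreover have "Tm c p Y \<le> Tm c p' Y + c * (Z c p' Y - Z c p Y)"
    using calibration(1)[OF t(1) e' refl Y_pos] t(2) h Y_pos pp init[of p' c] XY by (simp add: hits_def)
  ultimately have "Tm c p' Y = Tm c p Y + c * (Z c p Y - Z c p' Y)"
    by (simp add: right_diff_distrib)
  then have "\<exists>C. \<forall>t\<in>{0..Y}. X c p' t = C * X c p t"
    using calibration(2)[OF t'(1) e refl Y_pos] t'(2) h Y_pos pp init[of p c] XY by (simp add: hits_def)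
  then obtain C where C: "\<forall>t\<in>{0..Y}. X c p' t = C * X c p t" by blast
  have "X c p' Y = C * X c p Y" using C Y_pos by simp
  then have "C = 1" using XY h \<xi> by (simp add: hits_def)
  then have "P c p' 0 = P c p 0"
    using extremal_momentum_unique[OF e e' Y_pos, of 0] C Y_pos by auto
  then show ?thesis using init pp by simp
qed

lemma hits_bounds:
  assumes "hits c p \<xi>" "0 \<le> \<xi>"
  shows "c * (zig 0 \<xi> Y - Z c p Y) \<le> Y" "c * (\<xi> ^ 3 / 6 - Z c p Y) \<le> Y"
  using calibration_bound[OF ext, of p Y c] init[of p c] assms Y_pos by (auto simp: hits_def)

text \<open>The final \<open>z\<close> of the unique positive extremal ending at \<open>\<xi>\<close> is a continuous function of \<open>c\<close> that
  passes \<open>\<zeta>\<close> between \<open>- M\<close> and \<open>M\<close> by \<open>hits_bounds\<close>.\<close>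
theorem hits_all_positive:
  assumes \<xi>: "0 < \<xi>" "\<xi> < Y" and \<zeta>: "\<xi> ^ 3 / 6 < \<zeta>" "\<zeta> < zig 0 \<xi> Y"
  shows "\<exists>c p. hits c p \<xi> \<and> Z c p Y = \<zeta>"
proof -
  obtain b where b: "0 \<le> b" "b / sqrt (1 + b\<^sup>2) = \<xi> / Y" by (rule slope_surj[of "\<xi> / Y"]) (use \<xi> in auto)
  define M where "M = max (Y / (zig 0 \<xi> Y - \<zeta>)) (Y / (\<zeta> - \<xi> ^ 3 / 6))"
  have M: "Y \<le> M * (zig 0 \<xi> Y - \<zeta>)" "Y \<le> M * (\<zeta> - \<xi> ^ 3 / 6)"
  proof -
    have "Y / (zig 0 \<xi> Y - \<zeta>) * (zig 0 \<xi> Y - \<zeta>) \<le> M * (zig 0 \<xi> Y - \<zeta>)"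
      using \<zeta> by (intro mult_right_mono) (auto simp: M_def)
    then show "Y \<le> M * (zig 0 \<xi> Y - \<zeta>)" using \<zeta> by simp
    have "Y / (\<zeta> - \<xi> ^ 3 / 6) * (\<zeta> - \<xi> ^ 3 / 6) \<le> M * (\<zeta> - \<xi> ^ 3 / 6)"
      using \<zeta> by (intro mult_right_mono) (auto simp: M_def)
    then show "Y \<le> M * (\<zeta> - \<xi> ^ 3 / 6)" using \<zeta> by simp
  qed
  have M0: "0 < M" using \<zeta> Y_pos by (simp add: M_def less_max_iff_disj)
  define B where "B = b + M * Y * Y"
  \<comment> \<open>The graph of \<open>\<pi>\<close> over \<open>[- M, M]\<close>. It is closed since positivity can be relaxed to nonnegativity,
      and bounded since \<open>B\<close> bounds the momentum; a compact graph means that \<open>\<pi>\<close> is continuous.\<close>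
  define K where "K = {q \<in> {- M..M} \<times> {0..B}. X (fst q) (snd q) Y = \<xi> \<and> (\<forall>\<eta>\<in>{0..Y}. 0 \<le> X (fst q) (snd q) \<eta>)}"
  have Khits: "hits (fst q) (snd q) \<xi>" if "q \<in> K" for q
    using hits_of_nonneg[of "snd q" "fst q" Y] that \<xi> Y_pos by (auto simp: K_def)
  define \<pi> where "\<pi> = (\<lambda>c. SOME p. hits c p \<xi>)"
  have \<pi>: "hits c (\<pi> c) \<xi>" for c unfolding \<pi>_def by (rule someI_ex[OF hits_ex[OF \<xi>]])
  have \<pi>K: "(c, \<pi> c) \<in> K" if "c \<in> {- M..M}" for c
  proof -
    have h: "0 < \<pi> c" "X c (\<pi> c) Y = \<xi>" "\<And>\<eta>. 0 < \<eta> \<Longrightarrow> \<eta> < Y \<Longrightarrow> 0 < X c (\<pi> c) \<eta>"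
      using \<pi>[of c] by (auto simp: hits_def)
    have "\<pi> c \<le> b + \<bar>c\<bar> * Y * Y" by (rule parameter_bound) (use h b Y_pos in auto)
    also have "\<dots> \<le> B" unfolding B_def using that Y_pos by (auto intro!: mult_right_mono)
    finally have "\<pi> c \<le> B" .
    moreover have "0 \<le> X c (\<pi> c) \<eta>" if "\<eta> \<in> {0..Y}" for \<eta>
      using h(3)[of \<eta>] h(2) \<xi> that extremal.X0[OF ext, of "\<pi> c" c] h(1)
      by (cases "\<eta> = 0"; cases "\<eta> = Y") auto
    ultimately show ?thesis using that h by (auto simp: K_def)
  qed
  have K_graph: "q = (fst q, \<pi> (fst q))" if "q \<in> K" for q
    using hits_unique[OF \<xi>(1) \<pi> Khits[OF that]] by (metis prod.collapse)
  have "compact K"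
  proof -
    let ?box = "{- M..M} \<times> {0..B}"
    have cont: "continuous_on ?box (\<lambda>q. X (fst q) (snd q) \<eta>)" if "\<eta> \<in> {0..Y}" for \<eta>
      by (rule continuous_on_subset[OF continuous_family(1)[OF that]]) auto
    have box: "compact ?box" by (intro compact_Times compact_Icc)
    have "closed {q \<in> ?box. X (fst q) (snd q) Y = \<xi>}"
      by (rule continuous_closed_preimage_constant[OF cont compact_imp_closed[OF box]]) (use Y_pos in auto)
    moreover have "closed {q \<in> ?box. 0 \<le> X (fst q) (snd q) \<eta>}" if "\<eta> \<in> {0..Y}" for \<eta>
      using continuous_closed_preimage[OF cont[OF that] compact_imp_closed[OF box] closed_atLeast[of 0]]
      by (simp add: vimage_def Int_def)
    ultimately have "closed ({q \<in> ?box. X (fst q) (snd q) Y = \<xi>} \<inter> (\<Inter>\<eta>\<in>{0..Y}. {q \<in> ?box. 0 \<le> X (fst q) (snd q) \<eta>}))"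
      by (intro closed_Int closed_INT) auto
    moreover have "K = ?box \<inter> ({q \<in> ?box. X (fst q) (snd q) Y = \<xi>} \<inter> (\<Inter>\<eta>\<in>{0..Y}. {q \<in> ?box. 0 \<le> X (fst q) (snd q) \<eta>}))"
      unfolding K_def by auto
    ultimately show ?thesis using compact_Int_closed[OF box] by simp
  qed
  then have "continuous_on (fst ` K) (\<lambda>c. (c, \<pi> c))"
  proof (rule continuous_on_inv[rotated])
    show "continuous_on K fst" by (intro continuous_intros)
    show "\<forall>q\<in>K. (fst q, \<pi> (fst q)) = q" using K_graph by metis
  qed
  moreover have "fst ` K = {- M..M}"
  proof
    show "fst ` K \<subseteq> {- M..M}" by (auto simp: K_def)
    show "{- M..M} \<subseteq> fst ` K" using imageI[OF \<pi>K, of _ fst] by (simp add: subset_iff)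
  qed
  ultimately have graph: "continuous_on {- M..M} (\<lambda>c. (c, \<pi> c))" by simp
  have \<pi>_nonneg: "0 \<le> \<pi> c" for c using \<pi>[of c] by (simp add: hits_def less_imp_le)
  have cz: "continuous_on {- M..M} (\<lambda>c. Z c (\<pi> c) Y)"
  proof -
    have "(\<lambda>c. (c, \<pi> c)) ` {- M..M} \<subseteq> UNIV \<times> {0..}" using \<pi>_nonneg by auto
    then show ?thesis using continuous_on_compose2[OF continuous_family(2)[of 0] graph] Y_pos by simp
  qed
  have "\<zeta> \<le> Z M (\<pi> M) Y"
  proof -
    have "M * (zig 0 \<xi> Y - Z M (\<pi> M) Y) \<le> M * (zig 0 \<xi> Y - \<zeta>)"
      using hits_bounds(1)[OF \<pi>[of M]] \<xi> M(1) by linarith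
    then show ?thesis using M0 by simp
  qed
  moreover have "Z (- M) (\<pi> (- M)) Y \<le> \<zeta>"
  proof -
    have "M * (Z (- M) (\<pi> (- M)) Y - \<xi> ^ 3 / 6) \<le> Y"
      using hits_bounds(2)[OF \<pi>[of "- M"]] \<xi> by (simp add: algebra_simps)
    then have "M * (Z (- M) (\<pi> (- M)) Y - \<xi> ^ 3 / 6) \<le> M * (\<zeta> - \<xi> ^ 3 / 6)" using M(2) by linarith
    then show ?thesis using M0 by simp
  qed
  ultimately obtain c where "Z c (\<pi> c) Y = \<zeta>"
    using IVT'[of "\<lambda>c. Z c (\<pi> c) Y" "- M" \<zeta> M] cz M0 by auto
  then show ?thesis using \<pi> by blast
qed

text \<open>For \<open>c \<le> 0\<close> an extremal with \<open>p > 0\<close> never returns to \<open>0\<close>, so \<open>c\<close> cannot vary freely as it does for positive \<open>\<xi>\<close>.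
  Instead let positive \<open>\<xi>\<close> tend to \<open>0\<close> with the same \<open>\<zeta>\<close>: \<open>c\<close> and \<open>p\<close> stay bounded, and a limit point is
  nontrivial as its \<open>z\<close> is \<open>\<zeta> > 0\<close>.\<close>
theorem hits_all_zero:
  assumes \<zeta>: "0 < \<zeta>" "\<zeta> < Y ^ 3 / 24"
  shows "\<exists>c>0. \<exists>p. hits c p 0 \<and> Z c p Y = \<zeta>"
proof -
  \<comment> \<open>small enough that \<open>\<xi>\<^sup>3 / 6 \<le> \<zeta> / 2\<close> and \<open>\<xi> < Y\<close> for all \<open>\<xi> \<le> \<theta>\<close>\<close>
  define \<theta> where "\<theta> = min (min (Y / 2) 1) (3 * \<zeta>)"
  have \<theta>: "0 < \<theta>" "\<theta> \<le> Y / 2" "\<theta> \<le> 1" "\<theta> \<le> 3 * \<zeta>" using Y_pos \<zeta> by (auto simp: \<theta>_def)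
  define \<xi> where "\<xi> = (\<lambda>n. \<theta> * inverse (real (Suc n)))"
  have \<xi>: "0 < \<xi> n" "\<xi> n \<le> \<theta>" for n
  proof -
    have "\<theta> * inverse (real (Suc n)) \<le> \<theta> * 1" using \<theta>(1) by (intro mult_left_mono) (auto simp: field_simps)
    then show "\<xi> n \<le> \<theta>" by (simp add: \<xi>_def)
  qed (use \<theta> in \<open>simp add: \<xi>_def\<close>)
  have \<xi>_lim: "\<xi> \<longlonglongrightarrow> 0" unfolding \<xi>_def using tendsto_mult_left[OF LIMSEQ_inverse_real_of_nat, of \<theta>] by simp
  have cube: "\<xi> n ^ 3 / 6 \<le> \<zeta> / 2" for n
  proof -
    have "\<xi> n ^ 3 \<le> \<theta> ^ 3" using \<xi>[of n] by (intro power_mono) auto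
    also have "\<theta> ^ 3 \<le> \<theta>" using \<theta>(1,3) power_decreasing[of 1 3 \<theta>] by simp
    finally show ?thesis using \<theta>(4) by simp
  qed
  have zig_ge: "Y ^ 3 / 24 \<le> zig 0 (\<xi> n) Y" for n
  proof -
    define e where "e = \<xi> n"
    have e: "0 < e" "e \<le> Y" using \<xi>[of n] \<theta> Y_pos by (auto simp: e_def)
    have "zig 0 e Y - Y ^ 3 / 24 = e * (Y * Y + Y * e - e * e) / 8"
      by (simp add: zig_def field_simps power3_eq_cube)
    moreover have "e * e \<le> Y * e" using e by (intro mult_right_mono) auto
    then have "0 \<le> Y * Y + Y * e - e * e" using zero_le_square[of Y] by linarith
    then have "0 \<le> e * (Y * Y + Y * e - e * e) / 8" using e by simp
    ultimately show ?thesis by (simp add: e_def)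
  qed
  have "\<exists>c p. hits c p (\<xi> n) \<and> Z c p Y = \<zeta>" for n
    by (rule hits_all_positive) (use \<xi>[of n] \<theta> \<zeta> cube[of n] zig_ge[of n] Y_pos in linarith)+
  then obtain cs ps where cp: "\<And>n. hits (cs n) (ps n) (\<xi> n)" "\<And>n. Z (cs n) (ps n) Y = \<zeta>" by metis
  define M where "M = max (Y / (Y ^ 3 / 24 - \<zeta>)) (Y / (\<zeta> / 2))"
  have c_bound: "\<bar>cs n\<bar> \<le> M" for n
  proof (cases "0 \<le> cs n")
    case True
    have "cs n * (Y ^ 3 / 24 - \<zeta>) \<le> cs n * (zig 0 (\<xi> n) Y - \<zeta>)" using True zig_ge by (intro mult_left_mono) auto
    also have "\<dots> \<le> Y" using hits_bounds(1)[OF cp(1)[of n]] \<xi>[of n] cp(2)[of n] by simp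
    finally have "cs n \<le> Y / (Y ^ 3 / 24 - \<zeta>)" using \<zeta> by (simp add: pos_le_divide_eq)
    then show ?thesis using True by (simp add: M_def)
  next
    case False
    have "- cs n * (\<zeta> / 2) \<le> - cs n * (\<zeta> - \<xi> n ^ 3 / 6)" using False cube[of n] by (intro mult_left_mono) auto
    also have "\<dots> \<le> Y" using hits_bounds(2)[OF cp(1)[of n]] \<xi>[of n] cp(2)[of n] by (simp add: algebra_simps)
    finally have "- cs n \<le> Y / (\<zeta> / 2)" using \<zeta> by (simp add: pos_le_divide_eq)
    then show ?thesis using False by (simp add: M_def)
  qed
  obtain b where b: "0 \<le> b" "b / sqrt (1 + b\<^sup>2) = 1 / 2" by (rule slope_surj[of "1/2"]) auto
  have pp: "0 < ps n" for n using cp(1) by (simp add: hits_def)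
  have p_bound: "ps n \<le> b + M * Y * Y" for n
  proof -
    have "ps n \<le> b + \<bar>cs n\<bar> * Y * Y"
      by (rule parameter_bound) (use pp[of n] b cp(1)[of n] \<xi>[of n] \<theta> in \<open>auto simp: hits_def\<close>)
    also have "\<dots> \<le> b + M * Y * Y" using c_bound[of n] Y_pos by (auto intro!: mult_right_mono)
    finally show ?thesis .
  qed
  have "compact ({- M..M} \<times> {0..b + M * Y * Y})" by (intro compact_Times compact_Icc)
  then have "seq_compact ({- M..M} \<times> {0..b + M * Y * Y})" by (rule compact_imp_seq_compact)
  moreover have "(cs n, ps n) \<in> {- M..M} \<times> {0..b + M * Y * Y}" for n
  proof -
    have "- M \<le> cs n" "cs n \<le> M" using c_bound[of n] by linarith+
    then show ?thesis using p_bound[of n] pp[of n] by simp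
  qed
  ultimately have "\<exists>q\<in>{- M..M} \<times> {0..b + M * Y * Y}. \<exists>r. strict_mono r \<and> ((\<lambda>n. (cs n, ps n)) \<circ> r) \<longlonglongrightarrow> q"
    unfolding seq_compact_def by simp
  then obtain q r where q: "q \<in> {- M..M} \<times> {0..b + M * Y * Y}" "strict_mono r" "((\<lambda>n. (cs n, ps n)) \<circ> r) \<longlonglongrightarrow> q"
    by blast
  obtain c p where cpq: "q = (c, p)" by (cases q)
  have p0: "0 \<le> p" using q(1) cpq by simp
  have lim: "(\<lambda>n. f (cs (r n), ps (r n))) \<longlonglongrightarrow> f (c, p)" if "continuous_on (UNIV \<times> {0..}) f" for f :: "real \<times> real \<Rightarrow> real"
  proof -
    have "(\<lambda>n. f (((\<lambda>n. (cs n, ps n)) \<circ> r) n)) \<longlonglongrightarrow> f q"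
    proof (rule continuous_on_tendsto_compose[OF that q(3)])
      show "q \<in> UNIV \<times> {0..}" using p0 cpq by simp
      show "\<forall>\<^sub>F n in sequentially. ((\<lambda>n. (cs n, ps n)) \<circ> r) n \<in> UNIV \<times> {0..}"
        using pp by (intro always_eventually allI) (simp add: less_imp_le)
    qed
    then show ?thesis by (simp add: cpq)
  qed
  have limX: "(\<lambda>n. X (cs (r n)) (ps (r n)) \<eta>) \<longlonglongrightarrow> X c p \<eta>" if "\<eta> \<in> {0..Y}" for \<eta>
    using lim[OF continuous_family(1)[OF that]] by simp
  have "(\<lambda>n. Z (cs (r n)) (ps (r n)) Y) \<longlonglongrightarrow> Z c p Y"
    using lim[OF continuous_family(2)[of 0]] Y_pos by simp
  then have ZY: "Z c p Y = \<zeta>" using LIMSEQ_unique[OF _ tendsto_const] by (simp add: cp(2))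
  have "(\<lambda>n. X (cs (r n)) (ps (r n)) Y) \<longlonglongrightarrow> 0"
    using LIMSEQ_subseq_LIMSEQ[OF \<xi>_lim q(2)] cp(1) by (simp add: hits_def o_def)
  then have XY: "X c p Y = 0" using LIMSEQ_unique limX[of Y] Y_pos by auto
  have nonneg: "0 \<le> X c p \<eta>" if "\<eta> \<in> {0..Y}" for \<eta>
  proof (rule LIMSEQ_le_const[OF limX[OF that]])
    have "0 \<le> X (cs n) (ps n) \<eta>" for n
      using cp(1)[of n] that \<xi>[of n] extremal.X0[OF ext, of "ps n" "cs n"] pp[of n]
      by (cases "\<eta> = 0"; cases "\<eta> = Y") (auto simp: hits_def less_imp_le)
    then show "\<exists>N. \<forall>n\<ge>N. 0 \<le> X (cs (r n)) (ps (r n)) \<eta>" by blast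
  qed
  have "\<exists>\<eta>\<in>{0..Y}. X c p \<eta> \<noteq> 0"
  proof (rule ccontr)
    assume *: "\<not> ?thesis"
    have "Z c p Y = Z c p 0"
    proof (rule DERIV_isconst2[OF Y_pos])
      show "continuous_on {0..Y} (Z c p)" by (rule extremal.continuous[OF ext[OF p0]])
      show "(Z c p has_real_derivative 0) (at \<eta>)" if "0 < \<eta>" "\<eta> < Y" for \<eta>
        using extremal.Z_deriv[OF ext[OF p0], of c \<eta>] * that by simp
    qed (use Y_pos in auto)
    then show False using ZY \<zeta> extremal.Z0[OF ext[OF p0]] by simp
  qed
  then obtain \<eta>0 where "\<eta>0 \<in> {0..Y}" "X c p \<eta>0 \<noteq> 0" by blast
  then have h: "hits c p 0" using hits_of_nonneg[OF p0 nonneg] XY by auto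
  have "0 < c"
  proof (rule ccontr)
    assume c: "\<not> 0 < c"
    interpret extremal c "X c p" "P c p" "Tm c p" "Z c p" by (rule ext[OF p0])
    have P_ge: "p \<le> P c p \<eta>" if "0 \<le> \<eta>" "\<eta> \<le> Y" for \<eta>
    proof -
      have "P c p 0 \<le> P c p \<eta>"
      proof (rule DERIV_nonneg_imp_nondecreasing[OF that(1)])
        fix q assume q': "0 \<le> q" "q \<le> \<eta>"
        have "0 \<le> - c * X c p q" using nonneg[of q] c q' that by (intro mult_nonneg_nonneg) auto
        then show "\<exists>d. (P c p has_real_derivative d) (at q) \<and> 0 \<le> d" using P_deriv by blast
      qed
      then show ?thesis using init[OF p0] by simp
    qed
    have "X c p 0 < X c p Y"
    proof (rule DERIV_pos_imp_increasing[OF Y_pos])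
      fix \<eta> assume "0 \<le> \<eta>" "\<eta> \<le> Y"
      then have "0 < P c p \<eta>" using P_ge[of \<eta>] h by (simp add: hits_def)
      then have "0 < P c p \<eta> / sqrt (1 + (P c p \<eta>)\<^sup>2)" by (simp only: slope_pos_iff)
      then show "\<exists>d. (X c p has_real_derivative d) (at \<eta>) \<and> 0 < d" using X_deriv by blast
    qed
    then show False using X0 XY by simp
  qed
  then show ?thesis using h ZY by blast
qed

end

section \<open>The time bound, injectivity and flows\<close>


lemma straight_extremal:
  fixes p :: real
  defines "w \<equiv> sqrt (1 + p\<^sup>2)"
  shows "extremal 0 (\<lambda>\<eta>. p / w * \<eta>) (\<lambda>_. p) (\<lambda>\<eta>. 1 / w * \<eta>) (\<lambda>\<eta>. (p / w)\<^sup>2 * \<eta> ^ 3 / 6)"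
proof
  show "((\<lambda>\<eta>. p / w * \<eta>) has_real_derivative p / sqrt (1 + p\<^sup>2)) (at \<eta>)" for \<eta>
    unfolding w_def by (rule DERIV_cmult_Id)
  show "((\<lambda>\<eta>. 1 / w * \<eta>) has_real_derivative 1 / sqrt (1 + p\<^sup>2)) (at \<eta>)" for \<eta>
    unfolding w_def by (rule DERIV_cmult_Id)
  show "((\<lambda>\<eta>. (p / w)\<^sup>2 * \<eta> ^ 3 / 6) has_real_derivative (p / w * \<eta>)\<^sup>2 / 2) (at \<eta>)" for \<eta>
    by (rule DERIV_cong[OF DERIV_cdivide[OF DERIV_cmult[OF DERIV_pow]]]) (simp add: power_mult_distrib power_divide power2_eq_square mult_ac)
qed auto

lemma extremal_ex_pos:
  assumes "0 < p"
  shows "\<exists>X P Tm Z. extremal c X P Tm Z \<and> P 0 = p"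
proof -
  have \<psi>: "0 < arsinh p" "sinh (arsinh p) = p" using assms by simp_all
  consider "0 < c" | "c < 0" | "c = 0" by linarith
  then show ?thesis
  proof cases
    case 1 then show ?thesis using oscillating_extremal[OF 1 \<psi>(1)] \<psi>(2) by metis
  next
    case 2 then show ?thesis using monotone_extremal[OF 2 \<psi>(1)] \<psi>(2) by metis
  next
    case 3 then show ?thesis using straight_extremal[of p] by blast
  qed
qed

lemma extremal_ex:
  assumes "0 \<le> p"
  shows "\<exists>X P Tm Z. extremal c X P Tm Z \<and> P 0 = p"
proof (cases "p = 0")
  case True
  have "extremal c (\<lambda>_. 0) (\<lambda>_. 0) (\<lambda>\<eta>. \<eta>) (\<lambda>_. 0)" by unfold_locales auto
  then show ?thesis using True by blast
next
  case False
  then show ?thesis using assms extremal_ex_pos by simp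
qed

text \<open>Translates the time bound into positivity of \<open>X\<close>, the hypothesis of the calibration. By uniqueness of extremals the
  explicit solutions above decide the question for any extremal.\<close>
lemma t_bound_positivity:
  assumes e: "extremal c X P Tm Z" and P0: "P 0 = sinh \<psi>0" and \<psi>0: "0 < \<psi>0"
  shows "\<And>t. 0 < t \<Longrightarrow> ereal t < t_bound \<psi>0 c \<Longrightarrow> \<exists>Y>0. Tm Y = t \<and> (\<forall>\<eta>\<in>{0<..Y}. 0 < X \<eta>)"
    and "\<And>Y. 0 < Y \<Longrightarrow> (\<And>\<eta>. \<eta> \<in> {0<..Y} \<Longrightarrow> 0 < X \<eta>) \<Longrightarrow> ereal (Tm Y) < t_bound \<psi>0 c"
    and "0 < c \<Longrightarrow> \<exists>Y>0. ereal (Tm Y) = t_bound \<psi>0 c \<and> X Y = 0 \<and> (\<forall>\<eta>\<in>{0<..<Y}. 0 < X \<eta>)"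
proof -
  interpret extremal c X P Tm Z by fact
  have X_pos_of: "0 < Y" if "0 < Tm Y" for Y
    using Tm_strict_mono[of Y 0] that Tm0 by (cases "Y = 0"; cases "0 < Y") auto
  have osc: "\<exists>Y>0. ereal (Tm Y) = t_bound \<psi>0 c \<and> X Y = 0 \<and> (\<forall>\<eta>\<in>{0<..<Y}. 0 < X \<eta>)" if c: "0 < c"
  proof -
    obtain X' P' Tm' Z' Y where o: "extremal c X' P' Tm' Z'" "P' 0 = sinh \<psi>0" "0 < Y" "X' Y = 0"
      "\<forall>\<eta>. 0 < \<eta> \<and> \<eta> < Y \<longrightarrow> 0 < X' \<eta>" "t_bound \<psi>0 c = ereal (Tm' Y)"
      using oscillating_extremal[OF c \<psi>0] by metis
    have "P 0 = P' 0" using o(2) P0 by simp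
    note ag = extremal_agree[OF o(1) e this]
    show ?thesis using o(3-6) ag(1,3) by (intro exI[of _ Y]) auto
  qed
  have nonosc: "(\<forall>\<eta>>0. 0 < X \<eta>) \<and> (\<forall>\<eta>>0. ereal (Tm \<eta>) < t_bound \<psi>0 c) \<and>
     (\<forall>t>0. ereal t < t_bound \<psi>0 c \<longrightarrow> (\<exists>\<eta>. Tm \<eta> = t))" if c: "c \<le> 0"
  proof (cases "c = 0")
    case True
    define p where "p = sinh \<psi>0"
    define w where "w = sqrt (1 + p\<^sup>2)"
    have p: "0 < p" using \<psi>0 by (simp add: p_def)
    have w: "0 < w" by (simp add: w_def add_pos_nonneg)
    have "P 0 = (\<lambda>_. p) (0::real)" using P0 by (simp add: p_def)
    note ag = extremal_agree[OF straight_extremal[of p, folded w_def, folded True] e this]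
    have "\<exists>\<eta>. Tm \<eta> = t" if "0 < t" for t
      using ag(3)[of "t * w"] that w by (intro exI[of _ "t * w"]) simp
    then show ?thesis using ag(1) p w True by (auto simp: t_bound_def)
  next
    case False
    then have c': "c < 0" using c by simp
    obtain X' P' Tm' Z' where o: "extremal c X' P' Tm' Z'" "P' 0 = sinh \<psi>0"
      "\<forall>\<eta>. 0 < \<eta> \<longrightarrow> 0 < X' \<eta>" "\<forall>\<eta>. ereal (Tm' \<eta>) < t_bound \<psi>0 c"
      "\<forall>t. 0 \<le> t \<and> ereal t < t_bound \<psi>0 c \<longrightarrow> (\<exists>\<eta>\<ge>0. Tm' \<eta> = t)"
      using monotone_extremal[OF c' \<psi>0] by metis
    have "P 0 = P' 0" using o(2) P0 by simp
    note ag = extremal_agree[OF o(1) e this]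
    show ?thesis
    proof (intro conjI allI impI)
      fix t :: real assume "0 < t" "ereal t < t_bound \<psi>0 c"
      then obtain \<eta> where "0 \<le> \<eta>" "Tm' \<eta> = t" using o(5) by (meson less_imp_le)
      then show "\<exists>\<eta>. Tm \<eta> = t" using ag(3) by metis
    qed (use o ag(1,3) in \<open>auto simp: less_imp_le\<close>)
  qed
  show "\<exists>Y>0. Tm Y = t \<and> (\<forall>\<eta>\<in>{0<..Y}. 0 < X \<eta>)" if t: "0 < t" "ereal t < t_bound \<psi>0 c" for t
  proof (cases "0 < c")
    case True
    obtain Y where Y: "0 < Y" "ereal (Tm Y) = t_bound \<psi>0 c" "\<forall>\<eta>\<in>{0<..<Y}. 0 < X \<eta>" using osc[OF True] by blast
    have "t < Tm Y" using t(2) Y(2) by (metis ereal_less_eq(3) not_less)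
    then obtain y where y: "0 \<le> y" "y \<le> Y" "Tm y = t"
      using IVT'[of Tm 0 t Y] t Tm0 Y(1) continuous(3) by (metis less_imp_le)
    have "y \<noteq> Y" "y \<noteq> 0" using y \<open>t < Tm Y\<close> t Tm0 by auto
    then show ?thesis using y Y(3) by (intro exI[of _ y]) auto
  next
    case False
    then obtain y where "Tm y = t" using nonosc t by force
    then show ?thesis using X_pos_of[of y] t nonosc False by (intro exI[of _ y]) auto
  qed
  show "ereal (Tm Y) < t_bound \<psi>0 c" if Y: "0 < Y" "\<And>\<eta>. \<eta> \<in> {0<..Y} \<Longrightarrow> 0 < X \<eta>" for Y
  proof (cases "0 < c")
    case True
    obtain Y' where Y': "0 < Y'" "ereal (Tm Y') = t_bound \<psi>0 c" "X Y' = 0" using osc[OF True] by blast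
    have "Y < Y'" using Y(2)[of Y'] Y' by fastforce
    then show ?thesis using Tm_strict_mono[of Y Y'] Y'(2) by (metis ereal_less(2) less_ereal.simps(1))
  next
    case False then show ?thesis using nonosc Y by simp
  qed
  show "0 < c \<Longrightarrow> \<exists>Y>0. ereal (Tm Y) = t_bound \<psi>0 c \<and> X Y = 0 \<and> (\<forall>\<eta>\<in>{0<..<Y}. 0 < X \<eta>)" by (rule osc)
qed

text \<open>Injectivity of the exponential mapping on positive extremals for all \<open>c\<close> at once: mutual
  calibration gives equal length, so \<open>X' = C X\<close>; then \<open>Z' = C\<^sup>2 Z\<close> forces \<open>C = 1\<close>, and \<open>c\<close> can be read
  off from the differential equation.\<close>
lemma extremal_pair_unique:
  assumes e: "extremal c X P Tm Z" and e': "extremal c' X' P' Tm' Z'"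
    and P0: "0 < P 0" "0 < P' 0" and Y: "0 < Y"
    and pos: "\<And>\<eta>. 0 < \<eta> \<Longrightarrow> \<eta> < Y \<Longrightarrow> 0 < X \<eta>" "\<And>\<eta>. 0 < \<eta> \<Longrightarrow> \<eta> < Y \<Longrightarrow> 0 < X' \<eta>"
    and eq: "X' Y = X Y" "Z' Y = Z Y"
  shows "c' = c" "P' 0 = P 0"
proof -
  note t = extremal_trajectory[OF e, of Y] and t' = extremal_trajectory[OF e', of Y]
  have "Tm' Y \<le> Tm Y + c * (Z Y - Z' Y)"
    using calibration(1)[OF t'(1) e refl Y P0(1) pos(1) eq(1)] t'(2) Y by simp
  moreover have "Tm Y \<le> Tm' Y + c' * (Z' Y - Z Y)"
    using calibration(1)[OF t(1) e' refl Y P0(2) pos(2) eq(1)[symmetric]] t(2) Y by simp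
  ultimately have "Tm' Y = Tm Y + c * (Z Y - Z' Y)" using eq by simp
  then have "\<exists>C. \<forall>t\<in>{0..Y}. X' t = C * X t"
    using calibration(2)[OF t'(1) e refl Y P0(1) pos(1) eq(1)] t'(2) Y by simp
  then obtain C where C: "\<And>t. t \<in> {0..Y} \<Longrightarrow> X' t = C * X t" by blast
  have half: "0 < X (Y / 2)" "0 < X' (Y / 2)" "X' (Y / 2) = C * X (Y / 2)" using pos Y C by auto
  then have "0 < C" by (simp add: zero_less_mult_iff)
  have "Z' Y - C\<^sup>2 * Z Y = Z' 0 - C\<^sup>2 * Z 0"
  proof (rule DERIV_isconst2[OF Y])
    show "continuous_on {0..Y} (\<lambda>\<eta>. Z' \<eta> - C\<^sup>2 * Z \<eta>)"
      by (intro continuous_intros extremal.continuous[OF e] extremal.continuous[OF e'])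
    fix \<eta> assume "0 < \<eta>" "\<eta> < Y"
    then show "((\<lambda>\<eta>. Z' \<eta> - C\<^sup>2 * Z \<eta>) has_real_derivative 0) (at \<eta>)"
      using DERIV_diff[OF extremal.Z_deriv[OF e'] DERIV_cmult[OF extremal.Z_deriv[OF e], of "C\<^sup>2"], of \<eta>] C[of \<eta>]
      by (simp add: power_mult_distrib)
  qed (use Y in auto)
  then have ZC: "Z Y = C\<^sup>2 * Z Y" using eq extremal.Z0[OF e] extremal.Z0[OF e'] by simp
  have "Z 0 < Z Y"
  proof (rule DERIV_pos_imp_increasing_open[OF Y])
    show "\<exists>d. (Z has_real_derivative d) (at \<eta>) \<and> 0 < d" if "0 < \<eta>" "\<eta> < Y" for \<eta>
      using extremal.Z_deriv[OF e, of \<eta>] pos(1)[OF that] by (intro exI[of _ "(X \<eta>)\<^sup>2 / 2"]) auto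
    show "continuous_on {0..Y} Z" by (rule extremal.continuous[OF e])
  qed
  then have "C\<^sup>2 = 1" using ZC extremal.Z0[OF e] by simp
  then have "C = 1" using \<open>0 < C\<close> by (simp add: power2_eq_1_iff)
  then have X': "X' t = X t" if "t \<in> {0..Y}" for t using C that by simp
  show "c' = c" by (rule extremal_parameter_unique[OF e e' Y X', of "Y / 2"]) (use half Y in auto)
  show "P' 0 = P 0" by (rule extremal_momentum_unique[OF e e' Y X']) (use Y in auto)
qed


lemma decreasing_within:
  fixes f f' :: "real \<Rightarrow> real"
  assumes "a \<le> b" and d: "\<And>s. s \<in> {a..b} \<Longrightarrow> (f has_real_derivative f' s) (at s within {a..b})"
    and "\<And>s. s \<in> {a..b} \<Longrightarrow> f' s \<le> 0"
  shows "f b \<le> f a"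
proof (cases "a < b")
  case True
  obtain s where s: "s \<in> {a<..<b}" "f b - f a = f' s * (b - a)"
    using mvt_simple[OF True, of f "\<lambda>s. (*) (f' s)"] d by (auto simp: has_field_derivative_def)
  have "f' s * (b - a) \<le> 0" using assms(3)[of s] s(1) by (intro mult_nonpos_nonneg) auto
  then show ?thesis using s(2) by simp
qed (use assms in simp)

lemma equal_within:
  fixes f g h :: "real \<Rightarrow> real"
  assumes f: "\<And>s. s \<in> {0..t} \<Longrightarrow> (f has_real_derivative h s) (at s within {0..t})"
    and g: "\<And>s. s \<in> {0..t} \<Longrightarrow> (g has_real_derivative h s) (at s within {0..t})"
    and "f 0 = g 0" and s: "s \<in> {0..t}"
  shows "f s = g s"
proof -
  have sub: "{0..s} \<subseteq> {0..t}" and s0: "0 \<le> s" using s by auto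
  have "((\<lambda>r. f r - g r) has_real_derivative 0) (at r within {0..s})" if "r \<in> {0..s}" for r
  proof -
    have r: "r \<in> {0..t}" using that sub by blast
    show ?thesis using DERIV_subset[OF DERIV_diff[OF f[OF r] g[OF r]] sub] by simp
  qed
  note d = this
  have "f s - g s \<le> f 0 - g 0" by (rule decreasing_within[OF s0 d]) auto
  moreover have "- (f s - g s) \<le> - (f 0 - g 0)"
    by (rule decreasing_within[OF s0, where f="\<lambda>r. - (f r - g r)" and f'="\<lambda>r. - 0"]) (use DERIV_minus[OF d] in auto)
  ultimately show ?thesis using assms(3) by simp
qed

text \<open>The flow is a definite description, so besides a solution its uniqueness has to be provided.\<close>
lemma flow_eqI:
  assumes t: "0 \<le> t" and \<gamma>: "\<gamma> 0 = p"
    and sol: "\<And>s. s \<in> {0..t} \<Longrightarrow> (\<gamma> has_vector_derivative V (\<gamma> s)) (at s within {0..t})"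
    and uniq: "\<And>\<delta>. \<delta> 0 = p \<Longrightarrow> (\<And>s. s \<in> {0..t} \<Longrightarrow> (\<delta> has_vector_derivative V (\<delta> s)) (at s within {0..t})) \<Longrightarrow> \<delta> t = \<gamma> t"
  shows "flow V t p = \<gamma> t"
proof -
  have seg: "closed_segment 0 t = {0..t}" using t by (simp add: closed_segment_eq_real_ivl)
  show ?thesis
    unfolding flow_def seg
  proof (rule the_equality)
    show "\<exists>\<gamma>'. \<gamma>' 0 = p \<and> \<gamma>' t = \<gamma> t \<and> (\<forall>s\<in>{0..t}. (\<gamma>' has_vector_derivative V (\<gamma>' s)) (at s within {0..t}))"
      using \<gamma> sol by blast
    fix r assume "\<exists>\<delta>. \<delta> 0 = p \<and> \<delta> t = r \<and> (\<forall>s\<in>{0..t}. (\<delta> has_vector_derivative V (\<delta> s)) (at s within {0..t}))"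
    then show "r = \<gamma> t" using uniq by blast
  qed
qed

lemma has_vector_derivative_pair_iff:
  fixes f :: "real \<Rightarrow> 'a::real_normed_vector \<times> 'b::real_normed_vector"
  shows "(f has_vector_derivative d) (at t within S) \<longleftrightarrow>
    ((\<lambda>s. fst (f s)) has_vector_derivative fst d) (at t within S) \<and> ((\<lambda>s. snd (f s)) has_vector_derivative snd d) (at t within S)"
proof
  assume "(f has_vector_derivative d) (at t within S)"
  then show "((\<lambda>s. fst (f s)) has_vector_derivative fst d) (at t within S) \<and> ((\<lambda>s. snd (f s)) has_vector_derivative snd d) (at t within S)"
    unfolding has_vector_derivative_def by (auto intro!: derivative_eq_intros)
next
  assume *: "((\<lambda>s. fst (f s)) has_vector_derivative fst d) (at t within S) \<and> ((\<lambda>s. snd (f s)) has_vector_derivative snd d) (at t within S)"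
  have "((\<lambda>s. (fst (f s), snd (f s))) has_derivative (\<lambda>h. (h *\<^sub>R fst d, h *\<^sub>R snd d))) (at t within S)"
    by (rule has_derivative_Pair) (use * in \<open>simp_all add: has_vector_derivative_def\<close>)
  then show "(f has_vector_derivative d) (at t within S)"
    unfolding has_vector_derivative_def by (simp add: scaleR_prod_def)
qed

lemma flow_X_comb:
  assumes t: "0 \<le> t"
  shows "flow (X_comb a 1) t (x, y, z) = (x + a * t, y + t, z + (x\<^sup>2 * t + x * a * t\<^sup>2 + a\<^sup>2 * t ^ 3 / 3) / 2)"
proof -
  define \<gamma> where "\<gamma> = (\<lambda>t. (x + a * t, y + t, z + (x\<^sup>2 * t + x * a * t\<^sup>2 + a\<^sup>2 * t ^ 3 / 3) / 2))"
  have field: "X_comb a 1 q = (a, 1, (fst q)\<^sup>2 / 2)" for q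
    by (cases q) (simp add: X_comb_def X1_def X2_def)
  have d1: "((\<lambda>s. x + a * s) has_real_derivative a) (at s within S)" for s S
    by (auto intro!: derivative_eq_intros)
  have d2: "((\<lambda>s. y + s) has_real_derivative 1) (at s within S)" for s S
    by (auto intro!: derivative_eq_intros)
  have d3: "((\<lambda>s. z + (x\<^sup>2 * s + x * a * s\<^sup>2 + a\<^sup>2 * s ^ 3 / 3) / 2) has_real_derivative (x + a * s)\<^sup>2 / 2) (at s within S)" for s S
    by (auto intro!: derivative_eq_intros simp: power2_eq_square) (simp add: field_simps)
  have "flow (X_comb a 1) t (x, y, z) = \<gamma> t"
  proof (rule flow_eqI[OF t])
    show "\<gamma> 0 = (x, y, z)" by (simp add: \<gamma>_def)
    show "(\<gamma> has_vector_derivative X_comb a 1 (\<gamma> s)) (at s within {0..t})" for s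
      unfolding field \<gamma>_def has_vector_derivative_pair_iff
      using d1 d2 d3 by (simp add: has_real_derivative_iff_has_vector_derivative)
    fix \<delta> :: "real \<Rightarrow> R3"
    assume 0: "\<delta> 0 = (x, y, z)"
      and \<delta>: "\<And>s. s \<in> {0..t} \<Longrightarrow> (\<delta> has_vector_derivative X_comb a 1 (\<delta> s)) (at s within {0..t})"
    have e: "((\<lambda>s. fst (\<delta> s)) has_real_derivative a) (at s within {0..t})"
      "((\<lambda>s. fst (snd (\<delta> s))) has_real_derivative 1) (at s within {0..t})"
      "((\<lambda>s. snd (snd (\<delta> s))) has_real_derivative (fst (\<delta> s))\<^sup>2 / 2) (at s within {0..t})" if "s \<in> {0..t}" for s
      using \<delta>[OF that] unfolding field has_vector_derivative_pair_iff
      by (auto simp: has_real_derivative_iff_has_vector_derivative)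
    have 1: "fst (\<delta> s) = x + a * s" if "s \<in> {0..t}" for s
      by (rule equal_within[OF e(1) d1 _ that]) (auto simp: 0)
    have 2: "fst (snd (\<delta> s)) = y + s" if "s \<in> {0..t}" for s
      by (rule equal_within[OF e(2) d2 _ that]) (auto simp: 0)
    have 3: "snd (snd (\<delta> s)) = z + (x\<^sup>2 * s + x * a * s\<^sup>2 + a\<^sup>2 * s ^ 3 / 3) / 2" if "s \<in> {0..t}" for s
    proof (rule equal_within[OF _ d3 _ that])
      show "((\<lambda>s. snd (snd (\<delta> s))) has_real_derivative (x + a * r)\<^sup>2 / 2) (at r within {0..t})" if "r \<in> {0..t}" for r
        using e(3)[OF that] 1[OF that] by simp
    qed (auto simp: 0)
    show "\<delta> t = \<gamma> t" using 1[of t] 2[of t] 3[of t] t by (simp add: \<gamma>_def prod_eq_iff)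
  qed
  then show ?thesis by (simp add: \<gamma>_def)
qed

lemma X2_eq: "X2 = X_comb 0 1" by (rule ext) (simp add: X_comb_def)

lemma two_arcs_broken:
  assumes "0 \<le> \<tau>" "0 \<le> t"
  shows "two_arcs (X_comb a 1) \<tau> (X_comb b 1) t = (broken_x a b \<tau> t, t, broken_z a b \<tau> t)"
  using assms by (auto simp: two_arcs_def q0_def flow_X_comb broken_x_def broken_z_def power_mult_distrib)

lemma flow_X_comb_q0: "0 \<le> t \<Longrightarrow> flow (X_comb a 1) t q0 = (a * t, t, a\<^sup>2 * t ^ 3 / 6)"
  by (simp add: q0_def flow_X_comb)

section \<open>The exponential mapping and admissible curves\<close>

text \<open>The inverse of the clock is \<open>y\<close> as a function of time.\<close>
lemma (in extremal) clock:
  obtains H where "\<And>r. H (Tm r) = r"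
    and "\<And>r. (H has_real_derivative sqrt (1 + (P r)\<^sup>2)) (at (Tm r))"
proof (rule inverse_of_increasing[of UNIV Tm F])
  show "(Tm has_real_derivative F r) (at r)" for r by (rule Tm_deriv)
  show "0 < F r" for r using sqrt_pos[of r] by simp
  fix H
  assume 1: "\<And>r. r \<in> UNIV \<Longrightarrow> H (Tm r) = r"
    and 2: "\<And>r. r \<in> UNIV \<Longrightarrow> (H has_real_derivative 1 / F r) (at (Tm r))"
  show thesis
  proof (rule that)
    show "H (Tm r) = r" for r by (rule 1) simp
    show "(H has_real_derivative sqrt (1 + (P r)\<^sup>2)) (at (Tm r))" for r using 2[of r] by simp
  qed
qed auto

lemma extremal_uminus:
  assumes "extremal c X P Tm Z"
  shows "extremal c (\<lambda>\<eta>. - X \<eta>) (\<lambda>\<eta>. - P \<eta>) Tm Z"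
proof -
  interpret extremal c X P Tm Z by fact
  show ?thesis
  proof
    show "((\<lambda>\<eta>. - X \<eta>) has_real_derivative - P \<eta> / sqrt (1 + (- P \<eta>)\<^sup>2)) (at \<eta>)" for \<eta>
      using DERIV_minus[OF X_deriv[of \<eta>]] by simp
    show "((\<lambda>\<eta>. - P \<eta>) has_real_derivative - c * - X \<eta>) (at \<eta>)" for \<eta>
      using DERIV_minus[OF P_deriv[of \<eta>]] by simp
  qed (use X0 Tm0 Z0 Tm_deriv Z_deriv in simp_all)
qed

text \<open>On a compact time interval \<open>\<psi>\<close> is bounded and \<open>sinh\<close> is Lipschitz there, so the squared
  distance of two solutions satisfies a linear differential inequality.\<close>
lemma extremal_field_unique:
  fixes \<psi> \<psi>' x x' :: "real \<Rightarrow> real"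
  assumes \<psi>: "\<And>s. s \<in> {0..t} \<Longrightarrow> (\<psi> has_real_derivative - c * x s) (at s within {0..t})"
    and x: "\<And>s. s \<in> {0..t} \<Longrightarrow> (x has_real_derivative sinh (\<psi> s)) (at s within {0..t})"
    and \<psi>': "\<And>s. s \<in> {0..t} \<Longrightarrow> (\<psi>' has_real_derivative - c * x' s) (at s within {0..t})"
    and x': "\<And>s. s \<in> {0..t} \<Longrightarrow> (x' has_real_derivative sinh (\<psi>' s)) (at s within {0..t})"
    and init: "\<psi> 0 = \<psi>' 0" "x 0 = x' 0" and s: "s \<in> {0..t}"
  shows "\<psi> s = \<psi>' s" "x s = x' s"
proof -
  have cont: "continuous_on {0..t} \<psi>" "continuous_on {0..t} \<psi>'"
    by (rule DERIV_continuous_on[OF \<psi>], assumption) (rule DERIV_continuous_on[OF \<psi>'])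
  have "bounded (\<psi> ` {0..t} \<union> \<psi>' ` {0..t})"
    using compact_continuous_image[OF cont(1)] compact_continuous_image[OF cont(2)]
    by (auto intro: compact_imp_bounded)
  then obtain M where bound: "\<forall>p\<in>\<psi> ` {0..t} \<union> \<psi>' ` {0..t}. norm p \<le> M"
    unfolding bounded_iff by blast
  have M: "\<bar>\<psi> r\<bar> \<le> M" "\<bar>\<psi>' r\<bar> \<le> M" if "r \<in> {0..t}" for r
    using bspec[OF bound, of "\<psi> r"] bspec[OF bound, of "\<psi>' r"] that by simp_all
  have "Lip {- M..M} (\<lambda>r. sinh r)"
  proof (rule Lip_compose_C1[OF Lip_id])
    show "(sinh has_real_derivative cosh r) (at r within {- M..M})" for r by (auto intro!: derivative_eq_intros)
    show "continuous_on {- M..M} (cosh :: real \<Rightarrow> real)" by (intro continuous_intros)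
  qed auto
  then obtain L where L: "0 < L" "\<And>a b. a \<in> {- M..M} \<Longrightarrow> b \<in> {- M..M} \<Longrightarrow> \<bar>sinh a - sinh b\<bar> \<le> L * \<bar>a - b\<bar>"
    using LipE by metis
  define D where "D = (\<lambda>r. (\<psi> r - \<psi>' r)\<^sup>2 + (x r - x' r)\<^sup>2)"
  define K where "K = \<bar>c\<bar> + L"
  define d where "d = (\<lambda>r. 2 * (\<psi> r - \<psi>' r) * (- c * (x r - x' r)) + 2 * (x r - x' r) * (sinh (\<psi> r) - sinh (\<psi>' r)))"
  have sub: "{0..s} \<subseteq> {0..t}" using s by auto
  have dD: "(D has_real_derivative d r) (at r within {0..s})" if "r \<in> {0..s}" for r
  proof -
    have r: "r \<in> {0..t}" using that sub by blast
    have "(D has_real_derivative d r) (at r within {0..t})"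
      unfolding D_def d_def
      by (rule DERIV_cong[OF DERIV_add[OF DERIV_power[OF DERIV_diff[OF \<psi>[OF r] \<psi>'[OF r]]]
              DERIV_power[OF DERIV_diff[OF x[OF r] x'[OF r]]]]]) (simp add: algebra_simps)
    then show ?thesis by (rule DERIV_subset[OF _ sub])
  qed
  have d_le: "d r \<le> K * D r" if "r \<in> {0..s}" for r
  proof -
    have r: "r \<in> {0..t}" using that sub by blast
    define a b g where "a = \<psi> r - \<psi>' r" and "b = x r - x' r" and "g = sinh (\<psi> r) - sinh (\<psi>' r)"
    have ab: "2 * \<bar>a\<bar> * \<bar>b\<bar> \<le> a\<^sup>2 + b\<^sup>2"
      using zero_le_power2[of "\<bar>a\<bar> - \<bar>b\<bar>"] by (simp add: power2_diff)
    have "\<bar>g\<bar> \<le> L * \<bar>a\<bar>" unfolding g_def a_def using M[OF r] by (intro L(2)) (auto simp: abs_le_iff)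
    then have "2 * \<bar>b\<bar> * \<bar>g\<bar> \<le> 2 * \<bar>b\<bar> * (L * \<bar>a\<bar>)" by (intro mult_left_mono) auto
    also have "\<dots> = L * (2 * \<bar>a\<bar> * \<bar>b\<bar>)" by simp
    also have "\<dots> \<le> L * (a\<^sup>2 + b\<^sup>2)" using L(1) ab by (intro mult_left_mono) auto
    finally have "2 * \<bar>b\<bar> * \<bar>g\<bar> \<le> L * (a\<^sup>2 + b\<^sup>2)" .
    moreover have "\<bar>2 * b * g\<bar> = 2 * \<bar>b\<bar> * \<bar>g\<bar>" by (simp add: abs_mult)
    ultimately have 1: "2 * b * g \<le> L * (a\<^sup>2 + b\<^sup>2)"
      using abs_ge_self[of "2 * b * g"] by linarith
    have "\<bar>c\<bar> * (2 * \<bar>a\<bar> * \<bar>b\<bar>) \<le> \<bar>c\<bar> * (a\<^sup>2 + b\<^sup>2)" using ab by (intro mult_left_mono) auto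
    moreover have "\<bar>2 * a * (- c * b)\<bar> = \<bar>c\<bar> * (2 * \<bar>a\<bar> * \<bar>b\<bar>)" by (simp add: abs_mult)
    ultimately have 2: "2 * a * (- c * b) \<le> \<bar>c\<bar> * (a\<^sup>2 + b\<^sup>2)"
      using abs_ge_self[of "2 * a * (- c * b)"] by linarith
    from add_mono[OF 2 1] show ?thesis
      unfolding d_def D_def K_def a_def b_def g_def by (simp add: distrib_right)
  qed
  have s0: "0 \<le> s" using s by simp
  have "exp (- K * s) * D s \<le> exp (- K * 0) * D 0"
  proof (rule decreasing_within[OF s0])
    fix r assume r: "r \<in> {0..s}"
    show "((\<lambda>r. exp (- K * r) * D r) has_real_derivative exp (- K * r) * (d r - K * D r)) (at r within {0..s})"
      by (auto intro!: derivative_eq_intros dD r simp: algebra_simps)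
    show "exp (- K * r) * (d r - K * D r) \<le> 0" using d_le[OF r] by (intro mult_nonneg_nonpos) auto
  qed
  then have "exp (- K * s) * D s \<le> 0" using init by (simp add: D_def)
  then have "D s \<le> 0" by (simp add: mult_le_0_iff)
  then show "\<psi> s = \<psi>' s" "x s = x' s" by (simp_all add: D_def sum_power2_le_zero_iff)
qed

text \<open>Changing the parameter of an extremal from \<open>y\<close> to the time \<open>Tm\<close> gives the solution that defines
  the exponential mapping.\<close>
lemma Exp_extremal:
  assumes e: "extremal c X P Tm Z" and P0: "P 0 = sinh \<psi>0" and \<eta>: "0 \<le> \<eta>"
  shows "Exp (\<psi>0, c) (Tm \<eta>) = (X \<eta>, \<eta>, Z \<eta>)"
proof -
  interpret extremal c X P Tm Z by fact
  obtain H where H: "\<And>r. H (Tm r) = r" "\<And>r. (H has_real_derivative sqrt (1 + (P r)\<^sup>2)) (at (Tm r))"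
    using clock by metis
  define t where "t = Tm \<eta>"
  have t: "0 \<le> t" using Tm_strict_mono[of 0 \<eta>] Tm0 \<eta> by (cases "\<eta> = 0") (auto simp: t_def)
  have range: "\<exists>r. s = Tm r" if "s \<in> {0..t}" for s
    using IVT'[of Tm 0 s \<eta>] that Tm0 \<eta> continuous(3) by (auto simp: t_def)
  have chain: "((\<lambda>s. f (H s)) has_real_derivative f' r * sqrt (1 + (P r)\<^sup>2)) (at s within {0..t})"
    if "s = Tm r" "\<And>r. (f has_real_derivative f' r) (at r)" for f f' r s
  proof -
    have "(f has_real_derivative f' r) (at (H (Tm r)))" unfolding H(1) by (rule that(2))
    from DERIV_chain2[OF this H(2)] show ?thesis unfolding that(1) by (rule has_field_derivative_at_within)
  qed
  define \<psi> where "\<psi> = (\<lambda>s. arsinh (P (H s)))"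
  have cosh_\<psi>: "cosh (\<psi> s) = sqrt (1 + (P (H s))\<^sup>2)" for s by (simp add: \<psi>_def cosh_arsinh_real add.commute)
  have sinh_\<psi>: "sinh (\<psi> s) = P (H s)" for s by (simp add: \<psi>_def)
  define \<gamma> where "\<gamma> = (\<lambda>s. (\<psi> s, X (H s), H s, Z (H s)))"
  have dr: "((\<lambda>r. arsinh (P r)) has_real_derivative (- c * X r) / sqrt (1 + (P r)\<^sup>2)) (at r)" for r
    using DERIV_chain2[OF arsinh_real_has_field_derivative P_deriv, of r] by (simp add: add.commute)
  have S: "(\<psi> has_real_derivative - c * X (H s)) (at s within {0..t})"
    "((\<lambda>s. X (H s)) has_real_derivative sinh (\<psi> s)) (at s within {0..t})"
    "(H has_real_derivative cosh (\<psi> s)) (at s within {0..t})"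
    "((\<lambda>s. Z (H s)) has_real_derivative (X (H s))\<^sup>2 / 2 * cosh (\<psi> s)) (at s within {0..t})"
    if s: "s \<in> {0..t}" for s
  proof -
    obtain r where r: "s = Tm r" using range[OF s] by blast
    have Hs: "H s = r" unfolding r by (rule H(1))
    have nz: "sqrt (1 + (P r)\<^sup>2) \<noteq> 0" using sqrt_pos[of r] by linarith
    show "(\<psi> has_real_derivative - c * X (H s)) (at s within {0..t})"
      unfolding \<psi>_def by (rule DERIV_cong[OF chain[OF r dr]]) (use nz in \<open>simp add: Hs\<close>)
    show "((\<lambda>s. X (H s)) has_real_derivative sinh (\<psi> s)) (at s within {0..t})"
      by (rule DERIV_cong[OF chain[OF r X_deriv]]) (use nz in \<open>simp add: Hs sinh_\<psi>\<close>)
    show "(H has_real_derivative cosh (\<psi> s)) (at s within {0..t})"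
      unfolding cosh_\<psi> Hs unfolding r by (rule has_field_derivative_at_within[OF H(2)])
    show "((\<lambda>s. Z (H s)) has_real_derivative (X (H s))\<^sup>2 / 2 * cosh (\<psi> s)) (at s within {0..t})"
      by (rule DERIV_cong[OF chain[OF r Z_deriv]]) (simp add: Hs cosh_\<psi>)
  qed
  have H0: "H 0 = 0" using H(1)[of 0] by (simp add: Tm0)
  have field: "extremal_field c q = (- c * fst (snd q), sinh (fst q), cosh (fst q), (fst (snd q))\<^sup>2 / 2 * cosh (fst q))" for q
    by (cases q) (simp add: extremal_field_def)
  have "flow (extremal_field c) t (\<psi>0, 0, 0, 0) = \<gamma> t"
  proof (rule flow_eqI[OF t])
    show "\<gamma> 0 = (\<psi>0, 0, 0, 0)"
      using P0 X0 Z0 by (simp add: \<gamma>_def H0 \<psi>_def arsinh_sinh_real)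
    show "(\<gamma> has_vector_derivative extremal_field c (\<gamma> s)) (at s within {0..t})" if "s \<in> {0..t}" for s
      unfolding field \<gamma>_def has_vector_derivative_pair_iff
      using S[OF that] by (simp add: has_real_derivative_iff_has_vector_derivative)
    fix \<delta> :: "real \<Rightarrow> real \<times> R3"
    assume 0: "\<delta> 0 = (\<psi>0, 0, 0, 0)"
      and \<delta>: "\<And>s. s \<in> {0..t} \<Longrightarrow> (\<delta> has_vector_derivative extremal_field c (\<delta> s)) (at s within {0..t})"
    have E: "((\<lambda>s. fst (\<delta> s)) has_real_derivative - c * fst (snd (\<delta> s))) (at s within {0..t})"
      "((\<lambda>s. fst (snd (\<delta> s))) has_real_derivative sinh (fst (\<delta> s))) (at s within {0..t})"
      "((\<lambda>s. fst (snd (snd (\<delta> s)))) has_real_derivative cosh (fst (\<delta> s))) (at s within {0..t})"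
      "((\<lambda>s. snd (snd (snd (\<delta> s)))) has_real_derivative (fst (snd (\<delta> s)))\<^sup>2 / 2 * cosh (fst (\<delta> s))) (at s within {0..t})"
      if "s \<in> {0..t}" for s
      using \<delta>[OF that] unfolding field has_vector_derivative_pair_iff
      by (simp_all add: has_real_derivative_iff_has_vector_derivative)
    have i: "fst (\<delta> 0) = \<psi> 0" "fst (snd (\<delta> 0)) = X (H 0)"
      using 0 P0 X0 by (simp_all add: \<psi>_def H0 arsinh_sinh_real)
    have u1: "fst (\<delta> s) = \<psi> s" if "s \<in> {0..t}" for s
      by (rule extremal_field_unique(1)[OF E(1) E(2) S(1) S(2) i that])
    have u2: "fst (snd (\<delta> s)) = X (H s)" if "s \<in> {0..t}" for s
      by (rule extremal_field_unique(2)[OF E(1) E(2) S(1) S(2) i that])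
    note u = u1 u2
    have y: "fst (snd (snd (\<delta> s))) = H s" if "s \<in> {0..t}" for s
    proof (rule equal_within[OF _ S(3) _ that])
      show "((\<lambda>s. fst (snd (snd (\<delta> s)))) has_real_derivative cosh (\<psi> r)) (at r within {0..t})" if "r \<in> {0..t}" for r
        using E(3)[OF that] u(1)[OF that] by simp
    qed (simp_all add: 0 H0)
    have z: "snd (snd (snd (\<delta> s))) = Z (H s)" if "s \<in> {0..t}" for s
    proof (rule equal_within[OF _ S(4) _ that])
      show "((\<lambda>s. snd (snd (snd (\<delta> s)))) has_real_derivative (X (H r))\<^sup>2 / 2 * cosh (\<psi> r)) (at r within {0..t})" if "r \<in> {0..t}" for r
        using E(4)[OF that] u[OF that] by simp
    qed (simp_all add: 0 H0 Z0)
    show "\<delta> t = \<gamma> t" using u[of t] y[of t] z[of t] t by (simp add: \<gamma>_def prod_eq_iff)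
  qed
  then show ?thesis by (simp add: Exp_def t_def[symmetric] \<gamma>_def) (simp add: t_def H(1))
qed


lemma sq_speed_bound: "\<bar>u\<bar> \<le> v \<Longrightarrow> \<bar>sqrt (v\<^sup>2 - u\<^sup>2)\<bar> \<le> (v::real)"
proof -
  assume a: "\<bar>u\<bar> \<le> v"
  then have "0 \<le> v\<^sup>2 - u\<^sup>2" by (simp add: abs_le_square_iff[symmetric])
  then show ?thesis using a by (simp add: real_le_lsqrt)
qed

lemma bounded_control_integrable:
  assumes m: "w \<in> borel_measurable (lebesgue_on {0..T})" and b: "bounded (w ` {0..T})"
    and U: "\<And>t. t \<in> {0..T} \<Longrightarrow> \<bar>fst (w t)\<bar> \<le> snd (w t)"
  shows "(\<lambda>t. sqrt ((snd (w t))\<^sup>2 - (fst (w t))\<^sup>2)) integrable_on {0..T}"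
    and "traj_length w T = integral {0..T} (\<lambda>t. sqrt ((snd (w t))\<^sup>2 - (fst (w t))\<^sup>2))"
proof -
  obtain B where "\<forall>p\<in>w ` {0..T}. norm p \<le> B" using b unfolding bounded_iff by blast
  then have B: "norm (w t) \<le> B" if "t \<in> {0..T}" for t using that by simp
  have m2: "(\<lambda>t. sqrt ((snd (w t))\<^sup>2 - (fst (w t))\<^sup>2)) \<in> borel_measurable (lebesgue_on {0..T})"
  proof -
    have [measurable]: "(\<lambda>t. fst (w t)) \<in> borel_measurable (lebesgue_on {0..T})"
      "(\<lambda>t. snd (w t)) \<in> borel_measurable (lebesgue_on {0..T})"
      by (rule measurable_compose[OF m], rule borel_measurable_continuous_onI, intro continuous_intros)+
    show ?thesis by measurable
  qed
  have abs: "(\<lambda>t. sqrt ((snd (w t))\<^sup>2 - (fst (w t))\<^sup>2)) absolutely_integrable_on {0..T}"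
  proof (rule measurable_bounded_by_integrable_imp_absolutely_integrable[OF m2])
    show "(\<lambda>_. B) integrable_on {0..T}" by (rule integrable_const_ivl)
    fix t assume t: "t \<in> {0..T}"
    have "snd (w t) \<le> norm (w t)" using norm_snd_le[of "snd (w t)" "fst (w t)"] by simp
    then show "norm (sqrt ((snd (w t))\<^sup>2 - (fst (w t))\<^sup>2)) \<le> B"
      using sq_speed_bound[OF U[OF t]] B[OF t] by simp
  qed simp
  then show "(\<lambda>t. sqrt ((snd (w t))\<^sup>2 - (fst (w t))\<^sup>2)) integrable_on {0..T}"
    by (simp add: absolutely_integrable_on_def)
  show "traj_length w T = integral {0..T} (\<lambda>t. sqrt ((snd (w t))\<^sup>2 - (fst (w t))\<^sup>2))"
    unfolding traj_length_def
    by (rule lebesgue_integral_eq_integral[OF absolutely_integrable_imp_integrable[OF abs]]) simp_all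
qed

lemma X_comb_eq: "X_comb a b q = (a, b, (fst q)\<^sup>2 / 2 * b)"
  by (cases q) (simp add: X_comb_def X1_def X2_def)

text \<open>Passage from admissible curves to the setting of the estimates; \<open>N\<close> collects the times where the
  differential equation fails.\<close>
lemma admissible_trajectory:
  assumes a: "admissible q w T" and q0: "q 0 = q0"
  obtains N where "trajectory (\<lambda>t. fst (q t)) (\<lambda>t. fst (snd (q t))) (\<lambda>t. snd (snd (q t))) (\<lambda>t. fst (w t)) (\<lambda>t. snd (w t)) T N"
    and "trajectory.len (\<lambda>t. fst (w t)) (\<lambda>t. snd (w t)) T = traj_length w T"
proof -
  have T: "0 \<le> T" and m: "w \<in> borel_measurable (lebesgue_on {0..T})" and b: "bounded (w ` {0..T})"
    and U: "\<And>t. t \<in> {0..T} \<Longrightarrow> w t \<in> U1"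
    and ae: "AE t in lebesgue_on {0..T}. (q has_vector_derivative X_comb (fst (w t)) (snd (w t)) (q t)) (at t within {0..T})"
    using a by (auto simp: admissible_def)
  obtain L where L: "L-lipschitz_on {0..T} q" using a by (auto simp: admissible_def)
  have cone: "\<bar>fst (w t)\<bar> \<le> snd (w t)" if "t \<in> {0..T}" for t using U[OF that] by (auto simp: U1_def)
  have "AE t in lebesgue. t \<in> {0..T} \<longrightarrow> (q has_vector_derivative X_comb (fst (w t)) (snd (w t)) (q t)) (at t within {0..T})"
    using ae by (subst (asm) AE_restrict_space_iff) auto
  then obtain N where N: "{t \<in> space lebesgue. \<not> (t \<in> {0..T} \<longrightarrow> (q has_vector_derivative X_comb (fst (w t)) (snd (w t)) (q t)) (at t within {0..T}))} \<subseteq> N"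
     "emeasure lebesgue N = 0" "N \<in> sets lebesgue"
    by (rule AE_E)
  have neg: "negligible N" using N(2,3) by (simp add: negligible_iff_null_sets null_sets_def)
  have d: "((\<lambda>t. fst (q t)) has_real_derivative fst (w t)) (at t within {0..T})"
    "((\<lambda>t. fst (snd (q t))) has_real_derivative snd (w t)) (at t within {0..T})"
    "((\<lambda>t. snd (snd (q t))) has_real_derivative (fst (q t))\<^sup>2 / 2 * snd (w t)) (at t within {0..T})"
    if t: "t \<in> {0..T} - N" for t
  proof -
    have "(q has_vector_derivative X_comb (fst (w t)) (snd (w t)) (q t)) (at t within {0..T})"
      using t N(1) by auto
    then show "((\<lambda>t. fst (q t)) has_real_derivative fst (w t)) (at t within {0..T})"
      "((\<lambda>t. fst (snd (q t))) has_real_derivative snd (w t)) (at t within {0..T})"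
      "((\<lambda>t. snd (snd (q t))) has_real_derivative (fst (q t))\<^sup>2 / 2 * snd (w t)) (at t within {0..T})"
      unfolding X_comb_eq has_vector_derivative_pair_iff
      by (simp_all add: has_real_derivative_iff_has_vector_derivative)
  qed
  have dq: "dist (q s) (q t) \<le> L * dist s t" if "s \<in> {0..T}" "t \<in> {0..T}" for s t
    by (rule lipschitz_onD[OF L that])
  have lips: "Lip {0..T} (\<lambda>t. fst (q t))" "Lip {0..T} (\<lambda>t. fst (snd (q t)))" "Lip {0..T} (\<lambda>t. snd (snd (q t)))"
  proof -
    have *: "\<bar>fst (q s) - fst (q t)\<bar> \<le> dist (q s) (q t)" "\<bar>fst (snd (q s)) - fst (snd (q t))\<bar> \<le> dist (q s) (q t)"
      "\<bar>snd (snd (q s)) - snd (snd (q t))\<bar> \<le> dist (q s) (q t)" for s t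
      using dist_fst_le[of "q s" "q t"] dist_snd_le[of "q s" "q t"]
        dist_fst_le[of "snd (q s)" "snd (q t)"] dist_snd_le[of "snd (q s)" "snd (q t)"]
      by (auto simp: dist_real_def)
    show "Lip {0..T} (\<lambda>t. fst (q t))" "Lip {0..T} (\<lambda>t. fst (snd (q t)))" "Lip {0..T} (\<lambda>t. snd (snd (q t)))"
      by (rule LipI[where L=L], use order_trans[OF *(1) dq] order_trans[OF *(2) dq] order_trans[OF *(3) dq] in \<open>simp add: dist_real_def\<close>)+
  qed
  have tr: "trajectory (\<lambda>t. fst (q t)) (\<lambda>t. fst (snd (q t))) (\<lambda>t. snd (snd (q t))) (\<lambda>t. fst (w t)) (\<lambda>t. snd (w t)) T N"
    by unfold_locales (use T neg lips cone d q0 bounded_control_integrable(1)[OF m b cone] in \<open>auto simp: q0_def\<close>)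
  show ?thesis
    by (rule that[OF tr], unfold trajectory.len_def[OF tr])
      (rule bounded_control_integrable(2)[OF m b cone, symmetric])
qed

lemma trajectory_admissible:
  assumes tr: "trajectory x y z u v T N"
    and m: "u \<in> borel_measurable (lebesgue_on {0..T})" "v \<in> borel_measurable (lebesgue_on {0..T})"
    and b: "\<And>t. t \<in> {0..T} \<Longrightarrow> v t \<le> B"
    and q: "\<And>t. t \<in> {0..T} \<Longrightarrow> q t = (x t, y t, z t)"
  shows "admissible q (\<lambda>t. (u t, v t)) T" "traj_length (\<lambda>t. (u t, v t)) T = trajectory.len u v T"
proof -
  interpret trajectory x y z u v T N by fact
  have bd: "bounded ((\<lambda>t. (u t, v t)) ` {0..T})"
    unfolding bounded_iff
  proof (intro exI ballI)
    fix p assume "p \<in> (\<lambda>t. (u t, v t)) ` {0..T}"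
    then obtain t where t: "t \<in> {0..T}" "p = (u t, v t)" by blast
    have "norm p \<le> norm (u t) + norm (v t)" unfolding t(2) by (rule norm_Pair_le)
    then show "norm p \<le> B + B" using cone[OF t(1)] b[OF t(1)] by simp
  qed
  have mm: "(\<lambda>t. (u t, v t)) \<in> borel_measurable (lebesgue_on {0..T})" using m by measurable
  have lipq: "\<exists>L. L-lipschitz_on {0..T} q"
  proof -
    obtain L1 L2 L3 where L: "L1-lipschitz_on {0..T} x" "L2-lipschitz_on {0..T} y" "L3-lipschitz_on {0..T} z"
      using lip by (auto simp: Lip_def)
    have "(sqrt (L1\<^sup>2 + (sqrt (L2\<^sup>2 + L3\<^sup>2))\<^sup>2))-lipschitz_on {0..T} (\<lambda>t. (x t, y t, z t))"
      by (intro lipschitz_on_Pair L)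
    then have "(sqrt (L1\<^sup>2 + (sqrt (L2\<^sup>2 + L3\<^sup>2))\<^sup>2))-lipschitz_on {0..T} q"
      by (rule lipschitz_on_transform) (simp add: q)
    then show ?thesis by blast
  qed
  have ae: "AE t in lebesgue_on {0..T}. (q has_vector_derivative X_comb (u t) (v t) (q t)) (at t within {0..T})"
  proof -
    have "AE t in lebesgue. t \<in> {0..T} \<longrightarrow> (q has_vector_derivative X_comb (u t) (v t) (q t)) (at t within {0..T})"
    proof (rule AE_I'[of N])
      show "N \<in> null_sets lebesgue" using negligible by (simp add: negligible_iff_null_sets)
      have "(q has_vector_derivative X_comb (u t) (v t) (q t)) (at t within {0..T})" if t: "t \<in> {0..T} - N" for t
      proof -
        have "((\<lambda>t. (x t, y t, z t)) has_vector_derivative X_comb (u t) (v t) (q t)) (at t within {0..T})"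
          unfolding X_comb_eq has_vector_derivative_pair_iff
          using deriv_x[OF t] deriv_y[OF t] deriv_z[OF t] t
          by (simp add: has_real_derivative_iff_has_vector_derivative q)
        then show ?thesis
          by (rule has_vector_derivative_transform[rotated 2]) (use t q in auto)
      qed
      then show "{t \<in> space lebesgue. \<not> (t \<in> {0..T} \<longrightarrow> (q has_vector_derivative X_comb (u t) (v t) (q t)) (at t within {0..T}))} \<subseteq> N"
        by auto
    qed
    then show ?thesis by (subst AE_restrict_space_iff) auto
  qed
  show "admissible q (\<lambda>t. (u t, v t)) T"
    unfolding admissible_def using T_nonneg lipq mm bd ae cone by (auto simp: U1_def)
  show "traj_length (\<lambda>t. (u t, v t)) T = len"
    using bounded_control_integrable(2)[OF mm bd] cone by (simp add: len_def)
qed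

lemma Exp_admissible:
  assumes e: "extremal c X P Tm Z" and P0: "P 0 = sinh \<psi>0" and Y: "0 \<le> Y"
  shows "\<exists>w. admissible (Exp (\<psi>0, c)) w (Tm Y) \<and> traj_length w (Tm Y) = Tm Y"
proof -
  interpret extremal c X P Tm Z by fact
  obtain H where H: "\<And>r. H (Tm r) = r" "\<And>r. (H has_real_derivative sqrt (1 + (P r)\<^sup>2)) (at (Tm r))"
    using clock by metis
  define T where "T = Tm Y"
  have T: "0 \<le> T" using Tm_strict_mono[of 0 Y] Tm0 Y by (cases "Y = 0") (auto simp: T_def)
  have range: "\<exists>r. 0 \<le> r \<and> r \<le> Y \<and> s = Tm r" if "s \<in> {0..T}" for s
    using IVT'[of Tm 0 s Y] that Tm0 Y continuous(3) by (auto simp: T_def)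
  have HY: "H s \<in> {0..Y}" if "s \<in> {0..T}" for s using range[OF that] H(1) by auto
  have H0: "H 0 = 0" using H(1)[of 0] by (simp add: Tm0)
  define v where "v = (\<lambda>s. sqrt (1 + (P (H s))\<^sup>2))"
  have dH: "(H has_real_derivative v s) (at s within {0..T})" if s: "s \<in> {0..T}" for s
  proof -
    obtain r where r: "s = Tm r" using range[OF s] by blast
    show ?thesis unfolding v_def r H(1) by (rule has_field_derivative_at_within[OF H(2)])
  qed
  have cH: "continuous_on {0..T} H" by (rule DERIV_continuous_on[OF dH])
  have cP: "continuous_on {0..T} (\<lambda>s. P (H s))"
    by (rule continuous_on_compose2[OF continuous(2)[of UNIV] cH]) simp
  have cv: "continuous_on {0..T} v" unfolding v_def by (intro continuous_intros cP)
  have LH: "Lip {0..T} H" by (rule Lip_compose_C1[OF Lip_id _ dH cv]) simp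
  have v2: "(v s)\<^sup>2 - (P (H s))\<^sup>2 = 1" for s by (simp add: v_def)
  have tr: "trajectory (\<lambda>s. X (H s)) H (\<lambda>s. Z (H s)) (\<lambda>s. P (H s)) v T {}"
  proof
    show "Lip {0..T} (\<lambda>s. X (H s))"
    proof (rule Lip_compose_C1[OF LH HY has_field_derivative_at_within[OF X_deriv]])
      show "continuous_on {0..Y} (\<lambda>\<eta>. P \<eta> / sqrt (1 + (P \<eta>)\<^sup>2))"
        using sqrt_pos by (intro continuous_intros continuous) (simp add: less_imp_neq[symmetric])
    qed
    show "Lip {0..T} (\<lambda>s. Z (H s))"
      by (rule Lip_compose_C1[OF LH HY has_field_derivative_at_within[OF Z_deriv]])
        (auto intro!: continuous_intros continuous)
    show "\<bar>P (H s)\<bar> \<le> v s" for s unfolding v_def by (rule real_le_rsqrt) simp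
    fix s assume s: "s \<in> {0..T} - {}"
    have vn: "v s \<noteq> 0" unfolding v_def using sqrt_pos(1)[of "H s"] by linarith
    show "((\<lambda>s. X (H s)) has_real_derivative P (H s)) (at s within {0..T})"
      by (rule DERIV_cong[OF DERIV_chain2[OF X_deriv dH]]) (use s vn in \<open>auto simp: v_def\<close>)
    show "((\<lambda>s. Z (H s)) has_real_derivative (X (H s))\<^sup>2 / 2 * v s) (at s within {0..T})"
      by (rule DERIV_chain2[OF Z_deriv dH]) (use s in auto)
  qed (use T LH dH X0 Z0 H0 v2 in auto)
  have "bounded (v ` {0..T})" using compact_continuous_image[OF cv] by (simp add: compact_imp_bounded)
  then obtain B where "\<forall>p\<in>v ` {0..T}. norm p \<le> B" unfolding bounded_iff by blast
  then have "norm (v s) \<le> B" if "s \<in> {0..T}" for s using that by simp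
  then have B: "v s \<le> B" if "s \<in> {0..T}" for s using that by (metis abs_ge_self order_trans real_norm_def)
  have q: "Exp (\<psi>0, c) s = (X (H s), H s, Z (H s))" if s: "s \<in> {0..T}" for s
  proof -
    obtain r where r: "0 \<le> r" "s = Tm r" using range[OF s] by blast
    show ?thesis using Exp_extremal[OF e P0 r(1)] by (simp add: r(2) H(1))
  qed
  have m: "f \<in> borel_measurable (lebesgue_on {0..T})" if "continuous_on {0..T} f" for f :: "real \<Rightarrow> real"
    by (rule continuous_imp_measurable_on_sets_lebesgue[OF that]) simp
  note adm = trajectory_admissible[OF tr m[OF cP] m[OF cv] B q]
  have "trajectory.len (\<lambda>s. P (H s)) v T = T"
    unfolding trajectory.len_def[OF tr] v2 using T by simp
  then show ?thesis using adm unfolding T_def by (intro exI[of _ "\<lambda>s. (P (H s), v s)"]) simp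
qed

section \<open>Criteria for uniqueness up to a change of time\<close>

context trajectory
begin

lemma upper_rigid_z:
  assumes eq: "z T = zig 0 \<bar>x T\<bar> (y T)" and t: "0 \<le> t" "t \<le> T"
  shows "z t = zig 0 \<bar>x t\<bar> (y t)"
proof -
  have "\<bar>x t\<bar> = y t \<or> \<bar>x t\<bar> = \<bar>x T\<bar> + (y T - y t)"
    using upper_rigid[OF eq t] by (simp add: min_def split: if_splits)
  then have "zig 0 \<bar>x t\<bar> (y t) + zig \<bar>x t\<bar> \<bar>x T\<bar> (y T - y t) = zig 0 \<bar>x T\<bar> (y t + (y T - y t))"
    by (rule zig_additive)
  then have "zig 0 \<bar>x t\<bar> (y t) + zig \<bar>x t\<bar> \<bar>x T\<bar> (y T - y t) = z T" using eq by simp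
  moreover have "z t \<le> zig 0 \<bar>x t\<bar> (y t)" by (rule z_le_zig[OF t])
  moreover have "z T - z t \<le> zig \<bar>x t\<bar> \<bar>x T\<bar> (y T - y t)" by (rule z_upper) (use t in auto)
  ultimately show ?thesis by linarith
qed

lemma lower_rigid_z:
  assumes eq: "z T = \<bar>x T\<bar> ^ 3 / 6" and t: "0 \<le> t" "t \<le> T"
  shows "z t = \<bar>x t\<bar> ^ 3 / 6"
proof -
  have "\<bar>x t\<bar> = max 0 (\<bar>x T\<bar> - (y T - y t))"
    using lower_rigid[OF eq t] by (simp add: algebra_simps)
  then have "(\<bar>x T\<bar> ^ 3 - \<bar>x t\<bar> ^ 3) / 6 \<le> z T - z t" using z_lower[of t T] t by simp
  then show ?thesis using z_ge_cube[OF t] eq by (simp add: diff_divide_distrib)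
qed

text \<open>\<open>x\<close> can change its sign only where \<open>G (y)\<close> vanishes, and beyond \<open>\<tau>\<close> that happens at most at the final height.\<close>
lemma sign_constant:
  assumes G: "\<And>t. t \<in> {0..T} \<Longrightarrow> \<bar>x t\<bar> = G (y t)" and \<tau>: "0 \<le> \<tau>" "\<tau> < y T"
    and pos: "\<And>\<eta>. \<tau> < \<eta> \<Longrightarrow> \<eta> < y T \<Longrightarrow> 0 < G \<eta>"
    and zero: "\<And>\<eta>. 0 \<le> \<eta> \<Longrightarrow> \<eta> \<le> \<tau> \<Longrightarrow> G \<eta> = 0"
  shows "\<exists>\<sigma>\<in>{1, -1}. \<forall>t\<in>{0..T}. x t = \<sigma> * G (y t)"
proof -
  obtain t0 where t0: "0 \<le> t0" "t0 \<le> T" "y t0 = (\<tau> + y T) / 2"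
  proof (rule y_intermediate[of 0 T "(\<tau> + y T) / 2"])
    show "0 \<le> (0::real)" "0 \<le> T" "T \<le> T" using T_nonneg by auto
    show "y 0 \<le> (\<tau> + y T) / 2" "(\<tau> + y T) / 2 \<le> y T" using start \<tau> by auto
    fix r assume "0 \<le> r" "r \<le> T" "y r = (\<tau> + y T) / 2"
    then show thesis by (rule that)
  qed
  have "\<tau> < y t0" "y t0 < y T" unfolding t0(3) using \<tau>(2) by simp_all
  then have "0 < G (y t0)" by (rule pos)
  then have x0: "x t0 \<noteq> 0" using G[of t0] t0(1,2) by auto
  define \<sigma> where "\<sigma> = sgn (x t0)"
  have \<sigma>: "\<sigma> \<in> {1, -1}" using x0 by (auto simp: \<sigma>_def sgn_if)
  have "x t = \<sigma> * G (y t)" if t: "t \<in> {0..T}" for t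
  proof (cases "G (y t) = 0")
    case True then show ?thesis using G[OF t] by simp
  next
    case False
    have yt: "y t \<le> y T" "0 \<le> y t" using y_mono[of t T] y_mono[of 0 t] t start by auto
    have ty: "\<tau> < y t" using False zero[of "y t"] yt by force
    have nz: "x r \<noteq> 0" if r: "r \<in> {0..T}" "r \<in> closed_segment t0 t" for r
    proof -
      have yr: "min (y t0) (y t) \<le> y r" "y r \<le> max (y t0) (y t)"
        using r y_mono[of t0 r] y_mono[of r t] y_mono[of t r] y_mono[of r t0] t t0
        by (auto simp: closed_segment_eq_real_ivl min_def max_def split: if_splits)
      have "\<tau> < y r" using yr(1) ty t0(3) \<tau> by (simp add: min_def split: if_splits)
      moreover have "y r < y T \<or> y r = y t"
        using yr(2) yt t0(3) \<tau> by (auto simp: max_def split: if_splits)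
      ultimately have "0 < G (y r) \<or> G (y r) = G (y t)" using pos by auto
      then show ?thesis using G[OF r(1)] G[OF t] False by auto
    qed
    have "sgn (x t) = \<sigma>"
    proof (rule ccontr)
      assume "sgn (x t) \<noteq> \<sigma>"
      moreover have "x t \<noteq> 0" using nz[OF t] by simp
      ultimately have opp: "(x t0 < 0 \<and> 0 < x t) \<or> (0 < x t0 \<and> x t < 0)"
        using x0 by (auto simp: \<sigma>_def sgn_if split: if_splits)
      have seg: "closed_segment t0 t \<subseteq> {0..T}" using t t0 by (auto simp: closed_segment_eq_real_ivl split: if_splits)
      have "connected (x ` closed_segment t0 t)"
        by (rule connected_continuous_image[OF continuous_on_subset[OF Lip_continuous[OF lip(1)] seg] connected_segment(1)])
      moreover have "x t0 \<in> x ` closed_segment t0 t" "x t \<in> x ` closed_segment t0 t" by auto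
      ultimately have "0 \<in> x ` closed_segment t0 t"
        using opp unfolding is_interval_connected_1[symmetric] is_interval_1 by (meson less_imp_le)
      then show False using nz seg by auto
    qed
    then have "x t = \<sigma> * \<bar>x t\<bar>" by (metis mult_sgn_abs)
    then show ?thesis using G[OF t] by simp
  qed
  then show ?thesis using \<sigma> by blast
qed

lemma z_proportional:
  assumes e: "extremal c X P Tm Z" and x: "\<And>t. t \<in> {0..T} \<Longrightarrow> x t = C * X (y t)" and t: "0 \<le> t" "t \<le> T"
  shows "z t = C\<^sup>2 * Z (y t)"
proof -
  interpret extremal c X P Tm Z by fact
  have yr: "y r \<in> {0..y T}" if "r \<in> {0..t}" for r
    using y_mono[of 0 r] y_mono[of r T] that t start by auto
  have "Lip {0..t} (\<lambda>r. Z (y r))"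
    by (rule Lip_compose_C1[OF lip_sub(2)[OF order_refl t(2)] yr has_field_derivative_at_within[OF Z_deriv]])
      (auto intro!: continuous_intros continuous)
  then have L: "Lip {0..t} (\<lambda>r. z r - C\<^sup>2 * Z (y r))"
    by (intro Lip_diff Lip_mult Lip_const lip_sub order_refl t)
  have "((\<lambda>r. 0::real) has_integral ((z t - C\<^sup>2 * Z (y t)) - (z 0 - C\<^sup>2 * Z (y 0)))) {0..t}"
  proof (rule increment[OF order_refl t L])
    fix r assume r: "r \<in> {0..t} - N"
    then have r': "r \<in> {0..T} - N" using t by auto
    show "((\<lambda>r. z r - C\<^sup>2 * Z (y r)) has_real_derivative 0) (at r within {0..T})"
      by (rule DERIV_cong[OF DERIV_diff[OF deriv_z[OF r'] DERIV_cmult[OF DERIV_chain2[OF Z_deriv deriv_y[OF r']]]]])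
        (use x[of r] r' in \<open>simp add: power_mult_distrib\<close>)
  qed
  then have "(z t - C\<^sup>2 * Z (y t)) - (z 0 - C\<^sup>2 * Z (y 0)) = 0"
    using has_integral_0 has_integral_unique by blast
  then show ?thesis using start Z0 by simp
qed

lemma len_broken:
  assumes ab: "\<bar>a\<bar> \<le> 1" "\<bar>b\<bar> \<le> 1" and \<tau>: "0 \<le> \<tau>" "\<tau> \<le> y T"
    and x: "\<And>t. t \<in> {0..T} \<Longrightarrow> x t = broken_x a b \<tau> (y t)"
  shows "len = sqrt (1 - a\<^sup>2) * \<tau> + sqrt (1 - b\<^sup>2) * (y T - \<tau>)"
proof -
  obtain s where s: "0 \<le> s" "s \<le> T" "y s = \<tau>"
  proof (rule y_intermediate[of 0 T \<tau>])
    show "0 \<le> (0::real)" "0 \<le> T" "T \<le> T" using T_nonneg by auto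
    show "y 0 \<le> \<tau>" "\<tau> \<le> y T" using start \<tau> by auto
    fix r assume "0 \<le> r" "r \<le> T" "y r = \<tau>"
    then show thesis by (rule that)
  qed
  have "len = sqrt (1 - a\<^sup>2) * y s + sqrt (1 - b\<^sup>2) * (y T - y s)"
  proof (rule len_two_affine[OF s(1,2) ab, where b="a * \<tau> - b * \<tau>"])
    show "x r = a * y r" if "r \<in> {0..s}" for r
      using x[of r] y_mono[of r s] that s by (simp add: broken_x_def)
    show "x r = b * y r + (a * \<tau> - b * \<tau>)" if "r \<in> {s..T}" for r
      using x[of r] y_mono[of s r] that s by (auto simp: broken_x_def algebra_simps)
  qed
  then show ?thesis using s(3) by simp
qed

end

lemma trajectory_uminus:
  assumes "trajectory x y z u v T N"
  shows "trajectory (\<lambda>t. - x t) y z (\<lambda>t. - u t) v T N"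
    and "trajectory.len (\<lambda>t. - u t) v T = trajectory.len u v T"
proof -
  interpret trajectory x y z u v T N by fact
  have "Lip {0..T} (\<lambda>t. - x t)" using Lip_diff[OF Lip_const[of _ 0] lip(1)] by simp
  moreover have "((\<lambda>t. - x t) has_real_derivative - u t) (at t within {0..T})" if "t \<in> {0..T} - N" for t
    by (rule DERIV_minus[OF deriv_x[OF that]])
  ultimately show tr: "trajectory (\<lambda>t. - x t) y z (\<lambda>t. - u t) v T N"
    by unfold_locales (use T_nonneg negligible lip cone deriv_y deriv_z start speed_integrable in auto)
  show "trajectory.len (\<lambda>t. - u t) v T = trajectory.len u v T"
    by (simp add: trajectory.len_def[OF tr] len_def)
qed

text \<open>A curve that is a function of its own \<open>y\<close> differs from the curve parametrised by \<open>y\<close> only by the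
  change of time \<open>\<theta> \<circ> y\<close>, which may be constant on intervals where the curve rests.\<close>
lemma same_up_to_timeI:
  assumes tr: "trajectory x y z u v T N" and Y: "y T = Y"
    and \<theta>: "continuous_on {0..Y} \<theta>" "mono_on {0..Y} \<theta>" "\<theta> 0 = 0" "\<theta> Y = S"
    and eq: "\<And>t. t \<in> {0..T} \<Longrightarrow> q t = p (\<theta> (y t))"
  shows "same_up_to_time q T p S"
proof -
  interpret trajectory x y z u v T N by fact
  have yr: "y t \<in> {0..Y}" if "t \<in> {0..T}" for t
    using y_mono[of 0 t] y_mono[of t T] that start Y by auto
  have in_T: "s * T \<in> {0..T}" if "s \<in> {0..1}" for s
    using that T_nonneg mult_right_mono[of s 1 T] by auto
  have le: "s * T \<le> s' * T" if "s \<le> s'" for s s' using that T_nonneg by (rule mult_right_mono)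
  have "time_change (\<lambda>s. s * T) T"
    unfolding time_change_def using le by (auto intro!: continuous_intros mono_onI)
  moreover have "time_change (\<lambda>s. \<theta> (y (s * T))) S"
    unfolding time_change_def
  proof (intro conjI)
    have "continuous_on {0..1} (\<lambda>s. y (s * T))"
      by (rule continuous_on_compose2[OF Lip_continuous[OF lip(2)]]) (use in_T in \<open>auto intro!: continuous_intros\<close>)
    then show "continuous_on {0..1} (\<lambda>s. \<theta> (y (s * T)))"
      by (rule continuous_on_compose2[OF \<theta>(1)]) (use in_T yr in auto)
    show "mono_on {0..1} (\<lambda>s. \<theta> (y (s * T)))"
    proof (rule mono_onI)
      fix s s' :: real assume s: "s \<in> {0..1}" "s' \<in> {0..1}" "s \<le> s'"
      have "y (s * T) \<le> y (s' * T)" using in_T[OF s(1)] in_T[OF s(2)] le[OF s(3)] by (intro y_mono) auto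
      then show "\<theta> (y (s * T)) \<le> \<theta> (y (s' * T))"
        by (intro mono_onD[OF \<theta>(2)] yr in_T s)
    qed
  qed (use start \<theta>(3,4) Y in simp_all)
  ultimately show ?thesis
    unfolding same_up_to_time_def using eq in_T by (intro exI[of _ "\<lambda>s. s * T"] exI[of _ "\<lambda>s. \<theta> (y (s * T))"]) auto
qed

lemma optimal_trajI:
  assumes adm: "admissible p w S" "p 0 = q0" "p S = (x1, Y, z1)" "traj_length w S = L"
    and comp: "\<And>x y z u v T N. trajectory x y z u v T N \<Longrightarrow> x T = x1 \<Longrightarrow> y T = Y \<Longrightarrow> z T = z1 \<Longrightarrow>
      trajectory.len u v T \<le> L"
  shows "optimal_traj q0 (x1, Y, z1) p S"
  unfolding optimal_traj_def
proof (intro exI conjI allI impI)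
  fix q' u' T' assume a: "admissible q' u' T' \<and> q' 0 = q0 \<and> q' T' = (x1, Y, z1)"
  show "traj_length u' T' \<le> traj_length w S"
  proof (rule admissible_trajectory[of q' u' T'])
    fix N assume tr: "trajectory (\<lambda>t. fst (q' t)) (\<lambda>t. fst (snd (q' t))) (\<lambda>t. snd (snd (q' t))) (\<lambda>t. fst (u' t)) (\<lambda>t. snd (u' t)) T' N"
      and len: "trajectory.len (\<lambda>t. fst (u' t)) (\<lambda>t. snd (u' t)) T' = traj_length u' T'"
    show ?thesis using comp[OF tr] a len adm(4) by simp
  qed (use a in auto)
qed (use adm in auto)

lemma optimal_traj_cases:
  assumes opt: "optimal_traj q0 (x1, Y, z1) q T"
    and adm: "admissible p w S" "p 0 = q0" "p S = (x1, Y, z1)" "traj_length w S = L"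
  obtains u v N where "trajectory (\<lambda>t. fst (q t)) (\<lambda>t. fst (snd (q t))) (\<lambda>t. snd (snd (q t))) u v T N"
    and "L \<le> trajectory.len u v T" "q T = (x1, Y, z1)"
proof -
  obtain u' where u': "admissible q u' T" "q 0 = q0" "q T = (x1, Y, z1)"
    "\<And>q' u'' T'. admissible q' u'' T' \<Longrightarrow> q' 0 = q0 \<Longrightarrow> q' T' = (x1, Y, z1) \<Longrightarrow> traj_length u'' T' \<le> traj_length u' T"
    using opt unfolding optimal_traj_def by blast
  show ?thesis
  proof (rule admissible_trajectory[OF u'(1,2)])
    fix N assume tr: "trajectory (\<lambda>t. fst (q t)) (\<lambda>t. fst (snd (q t))) (\<lambda>t. snd (snd (q t))) (\<lambda>t. fst (u' t)) (\<lambda>t. snd (u' t)) T N"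
      and len: "trajectory.len (\<lambda>t. fst (u' t)) (\<lambda>t. snd (u' t)) T = traj_length u' T"
    have "L \<le> traj_length u' T" using u'(4)[OF adm(1-3)] adm(4) by simp
    then show ?thesis using that[OF tr] len u'(3) by simp
  qed
qed

text \<open>All uniqueness statements are instances of this: a length bound for competitors, and rigidity
  of the competitors that attain it, as curves over \<open>y\<close>.\<close>
lemma unique_optimalI:
  assumes adm: "admissible p w S" "p 0 = q0" "p S = (x1, Y, z1)" "traj_length w S = L"
    and \<theta>: "continuous_on {0..Y} \<theta>" "mono_on {0..Y} \<theta>" "\<theta> 0 = 0" "\<theta> Y = S"
    and comp: "\<And>x y z u v T N. trajectory x y z u v T N \<Longrightarrow> x T = x1 \<Longrightarrow> y T = Y \<Longrightarrow> z T = z1 \<Longrightarrow>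
      trajectory.len u v T \<le> L"
    and rigid: "\<And>x y z u v T N t. trajectory x y z u v T N \<Longrightarrow> x T = x1 \<Longrightarrow> y T = Y \<Longrightarrow> z T = z1 \<Longrightarrow>
      trajectory.len u v T = L \<Longrightarrow> t \<in> {0..T} \<Longrightarrow> p (\<theta> (y t)) = (x t, y t, z t)"
  shows "unique_optimal q0 (x1, Y, z1) p S"
  unfolding unique_optimal_def
proof (intro conjI allI impI)
  show "optimal_traj q0 (x1, Y, z1) p S" by (rule optimal_trajI[OF adm comp])
  fix q T assume "optimal_traj q0 (x1, Y, z1) q T"
  then show "same_up_to_time q T p S"
  proof (rule optimal_traj_cases[OF _ adm])
    fix u v N
    assume tr: "trajectory (\<lambda>t. fst (q t)) (\<lambda>t. fst (snd (q t))) (\<lambda>t. snd (snd (q t))) u v T N"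
      and len: "L \<le> trajectory.len u v T" and qT: "q T = (x1, Y, z1)"
    have e: "fst (q T) = x1" "fst (snd (q T)) = Y" "snd (snd (q T)) = z1" using qT by auto
    have "trajectory.len u v T = L" using comp[OF tr e] len by simp
    then have "q t = p (\<theta> (fst (snd (q t))))" if "t \<in> {0..T}" for t
      using rigid[OF tr e _ that] by simp
    then show ?thesis by (rule same_up_to_timeI[OF tr e(2) \<theta>])
  qed
qed

text \<open>The conditions on the sign of \<open>x\<close> keep the two curves apart, because a change of time preserves it.\<close>
lemma exactly_two_optimalI:
  assumes adm: "admissible pa wa S" "pa 0 = q0" "pa S = (x1, Y, z1)" "traj_length wa S = L"
    and adm': "admissible pb wb S" "pb 0 = q0" "pb S = (x1, Y, z1)" "traj_length wb S = L"
    and \<theta>: "continuous_on {0..Y} \<theta>" "mono_on {0..Y} \<theta>" "\<theta> 0 = 0" "\<theta> Y = S"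
    and comp: "\<And>x y z u v T N. trajectory x y z u v T N \<Longrightarrow> x T = x1 \<Longrightarrow> y T = Y \<Longrightarrow> z T = z1 \<Longrightarrow>
      trajectory.len u v T \<le> L"
    and rigid: "\<And>x y z u v T N. trajectory x y z u v T N \<Longrightarrow> x T = x1 \<Longrightarrow> y T = Y \<Longrightarrow> z T = z1 \<Longrightarrow>
      trajectory.len u v T = L \<Longrightarrow> (\<forall>t\<in>{0..T}. pa (\<theta> (y t)) = (x t, y t, z t)) \<or> (\<forall>t\<in>{0..T}. pb (\<theta> (y t)) = (x t, y t, z t))"
    and S: "0 < S" and a_pos: "\<And>s. 0 < s \<Longrightarrow> s < S \<Longrightarrow> 0 < fst (pa s)"
    and b_neg: "\<And>s. s \<in> {0..S} \<Longrightarrow> fst (pb s) \<le> 0"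
  shows "exactly_two_optimal q0 (x1, Y, z1) pa S pb S"
  unfolding exactly_two_optimal_def
proof (intro conjI allI impI notI)
  show "optimal_traj q0 (x1, Y, z1) pa S" by (rule optimal_trajI[OF adm comp])
  show "optimal_traj q0 (x1, Y, z1) pb S" by (rule optimal_trajI[OF adm' comp])
  show False if same: "same_up_to_time pa S pb S"
  proof -
    obtain \<phi> \<psi> where t: "time_change \<phi> S" "time_change \<psi> S" "\<forall>s\<in>{0..1}. pa (\<phi> s) = pb (\<psi> s)"
      using same unfolding same_up_to_time_def by blast
    have c: "continuous_on {0..1} \<phi>" "\<phi> 0 = 0" "\<phi> 1 = S" using t(1) by (auto simp: time_change_def)
    have "\<exists>s\<ge>0. s \<le> 1 \<and> \<phi> s = S / 2"
      by (rule IVT'[OF _ _ _ c(1)]) (use c S in auto)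
    then obtain s where s: "s \<in> {0..1}" "\<phi> s = S / 2" by auto
    have m: "mono_on {0..1} \<psi>" "\<psi> 0 = 0" "\<psi> 1 = S" using t(2) by (auto simp: time_change_def)
    have "\<psi> 0 \<le> \<psi> s" "\<psi> s \<le> \<psi> 1" using s(1) by (auto intro!: mono_onD[OF m(1)])
    then have "fst (pb (\<psi> s)) \<le> 0" using m by (intro b_neg) auto
    moreover have "0 < fst (pa (\<phi> s))" unfolding s(2) using a_pos[of "S / 2"] S by simp
    ultimately show False using t(3) s(1) by auto
  qed
  fix q T assume "optimal_traj q0 (x1, Y, z1) q T"
  then show "same_up_to_time q T pa S \<or> same_up_to_time q T pb S"
  proof (rule optimal_traj_cases[OF _ adm])
    fix u v N
    assume tr: "trajectory (\<lambda>t. fst (q t)) (\<lambda>t. fst (snd (q t))) (\<lambda>t. snd (snd (q t))) u v T N"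
      and len: "L \<le> trajectory.len u v T" and qT: "q T = (x1, Y, z1)"
    have e: "fst (q T) = x1" "fst (snd (q T)) = Y" "snd (snd (q T)) = z1" using qT by auto
    have "trajectory.len u v T = L" using comp[OF tr e] len by simp
    from rigid[OF tr e this] show ?thesis
    proof
      assume "\<forall>t\<in>{0..T}. pa (\<theta> (fst (snd (q t)))) = (fst (q t), fst (snd (q t)), snd (snd (q t)))"
      then have "q t = pa (\<theta> (fst (snd (q t))))" if "t \<in> {0..T}" for t using that by simp
      then have "same_up_to_time q T pa S" by (rule same_up_to_timeI[OF tr e(2) \<theta>])
      then show ?thesis ..
    next
      assume "\<forall>t\<in>{0..T}. pb (\<theta> (fst (snd (q t)))) = (fst (q t), fst (snd (q t)), snd (snd (q t)))"
      then have "q t = pb (\<theta> (fst (snd (q t))))" if "t \<in> {0..T}" for t using that by simp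
      then have "same_up_to_time q T pb S" by (rule same_up_to_timeI[OF tr e(2) \<theta>])
      then show ?thesis ..
    qed
  qed
qed

section \<open>Optimal curves to the boundary of the attainable set\<close>


lemma broken_admissible:
  assumes ab: "\<bar>a\<bar> \<le> 1" "\<bar>b\<bar> \<le> 1" and \<tau>: "0 \<le> \<tau>" "\<tau> \<le> Y"
    and p: "\<And>t. t \<in> {0..Y} \<Longrightarrow> p t = (broken_x a b \<tau> t, t, broken_z a b \<tau> t)"
  shows "\<exists>w. admissible p w Y \<and> traj_length w Y = sqrt (1 - a\<^sup>2) * \<tau> + sqrt (1 - b\<^sup>2) * (Y - \<tau>)"
proof -
  have Y: "0 \<le> Y" using \<tau> by simp
  note tr = broken_trajectory[OF ab \<tau>(1) Y]
  have m: "(\<lambda>t. if t \<le> \<tau> then a else b) \<in> borel_measurable (lebesgue_on {0..Y})"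
    "(\<lambda>t. 1 :: real) \<in> borel_measurable (lebesgue_on {0..Y})"
  proof -
    have [measurable]: "(\<lambda>t. t) \<in> borel_measurable (lebesgue_on {0..Y})"
      by (rule continuous_imp_measurable_on_sets_lebesgue) (auto intro: continuous_intros)
    show "(\<lambda>t. if t \<le> \<tau> then a else b) \<in> borel_measurable (lebesgue_on {0..Y})" by measurable
  qed simp
  have "trajectory.len (\<lambda>t. if t \<le> \<tau> then a else b) (\<lambda>t. 1) Y = sqrt (1 - a\<^sup>2) * \<tau> + sqrt (1 - b\<^sup>2) * (Y - \<tau>)"
    using trajectory.len_broken[OF tr ab \<tau>] by simp
  then show ?thesis
    using trajectory_admissible[OF tr m order_refl p] by (intro exI[of _ "\<lambda>t. (if t \<le> \<tau> then a else b, 1)"]) simp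
qed

lemma broken_0: "0 \<le> \<tau> \<Longrightarrow> (broken_x a b \<tau> 0, 0, broken_z a b \<tau> 0) = q0"
  by (simp add: broken_x_def broken_z_def q0_def)

text \<open>If every curve to the endpoint has the same \<open>x\<close> and \<open>z\<close> as functions of \<open>y\<close>, all of them have the same length,
  and optimality is automatic.\<close>
lemma broken_unique:
  assumes ab: "\<bar>a\<bar> \<le> 1" "\<bar>b\<bar> \<le> 1" and \<tau>: "0 \<le> \<tau>" "\<tau> \<le> Y"
    and p: "\<And>t. t \<in> {0..Y} \<Longrightarrow> p t = (broken_x a b \<tau> t, t, broken_z a b \<tau> t)"
    and end1: "broken_x a b \<tau> Y = x1" "broken_z a b \<tau> Y = z1"
    and rigid: "\<And>x y z u v T N t. trajectory x y z u v T N \<Longrightarrow> x T = x1 \<Longrightarrow> y T = Y \<Longrightarrow> z T = z1 \<Longrightarrow>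
      t \<in> {0..T} \<Longrightarrow> x t = broken_x a b \<tau> (y t) \<and> z t = broken_z a b \<tau> (y t)"
  shows "unique_optimal q0 (x1, Y, z1) p Y"
proof -
  have Y: "0 \<le> Y" using \<tau> by simp
  obtain w where w: "admissible p w Y" "traj_length w Y = sqrt (1 - a\<^sup>2) * \<tau> + sqrt (1 - b\<^sup>2) * (Y - \<tau>)"
    using broken_admissible[OF ab \<tau> p] by blast
  show ?thesis
  proof (rule unique_optimalI[OF w(1) _ _ w(2), where \<theta>="\<lambda>t. t"])
    show "p 0 = q0" using p[of 0] Y broken_0[OF \<tau>(1)] by simp
    show "p Y = (x1, Y, z1)" using p[of Y] Y end1 by simp
    fix x y z u v T N
    assume tr: "trajectory x y z u v T N" and e: "x T = x1" "y T = Y" "z T = z1"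
    interpret trajectory x y z u v T N by fact
    have "len = sqrt (1 - a\<^sup>2) * \<tau> + sqrt (1 - b\<^sup>2) * (y T - \<tau>)"
      by (rule len_broken[OF ab \<tau>(1)]) (use rigid[OF tr e] \<tau>(2) e(2) in auto)
    then show "len \<le> sqrt (1 - a\<^sup>2) * \<tau> + sqrt (1 - b\<^sup>2) * (Y - \<tau>)" using e(2) by simp
    fix t assume t: "t \<in> {0..T}"
    have "y t \<in> {0..Y}" using y_mono[of 0 t] y_mono[of t T] t start e(2) by auto
    then show "p (y t) = (x t, y t, z t)" using p rigid[OF tr e t] by simp
  qed (auto intro: continuous_intros mono_onI)
qed

text \<open>The extremal shape of \<open>upper_rigid\<close> with its sign; the peak lies at \<open>y = (Y + a) / 2\<close>.\<close>
lemma broken_peak: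
  assumes a: "0 \<le> a" "a \<le> Y" and \<sigma>: "\<sigma> \<in> {1, -1}" and \<eta>: "0 \<le> \<eta>" "\<eta> \<le> Y"
  shows "broken_x \<sigma> (- \<sigma>) ((Y + a) / 2) \<eta> = \<sigma> * min \<eta> (a + Y - \<eta>)"
    and "broken_z \<sigma> (- \<sigma>) ((Y + a) / 2) \<eta> = zig 0 (min \<eta> (a + Y - \<eta>)) \<eta>"
  using a \<sigma> \<eta> unfolding broken_x_def broken_z_def zig_def
  by (auto simp: min_def field_simps power2_eq_square power3_eq_cube)

lemma broken_late:
  assumes a: "0 \<le> a" "a \<le> Y" and \<sigma>: "\<sigma> \<in> {0, 1, -1}"
  shows "broken_x 0 \<sigma> (Y - a) \<eta> = \<sigma> * max 0 (\<eta> - (Y - a))"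
    and "\<sigma> \<noteq> 0 \<Longrightarrow> broken_z 0 \<sigma> (Y - a) \<eta> = (max 0 (\<eta> - (Y - a))) ^ 3 / 6"
  using a \<sigma> unfolding broken_x_def broken_z_def by (auto simp: max_def)

lemma upper_shape:
  assumes tr: "trajectory x y z u v T N" and e: "\<bar>x T\<bar> = a" "y T = Y" "z T = zig 0 a Y" and Y: "0 < Y"
  shows "\<exists>\<sigma>\<in>{1, -1}. \<forall>t\<in>{0..T}. x t = broken_x \<sigma> (- \<sigma>) ((Y + a) / 2) (y t) \<and>
     z t = broken_z \<sigma> (- \<sigma>) ((Y + a) / 2) (y t)"
proof -
  interpret trajectory x y z u v T N by fact
  have aY: "0 \<le> a" "a \<le> Y" using x_le_y[of T] T_nonneg e by auto
  have eq: "z T = zig 0 \<bar>x T\<bar> (y T)" using e by simp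
  have G: "\<bar>x t\<bar> = min (y t) (a + Y - y t)" if "t \<in> {0..T}" for t
    using upper_rigid[OF eq] that e by simp
  have "\<exists>\<sigma>\<in>{1, -1}. \<forall>t\<in>{0..T}. x t = \<sigma> * min (y t) (a + Y - y t)"
  proof (rule sign_constant[where \<tau>=0 and G="\<lambda>\<eta>. min \<eta> (a + Y - \<eta>)"])
    show "\<bar>x t\<bar> = min (y t) (a + Y - y t)" if "t \<in> {0..T}" for t by (rule G[OF that])
  qed (use Y e aY in auto)
  then obtain \<sigma> where \<sigma>: "\<sigma> \<in> {1, -1}" "\<And>t. t \<in> {0..T} \<Longrightarrow> x t = \<sigma> * min (y t) (a + Y - y t)" by blast
  have "x t = broken_x \<sigma> (- \<sigma>) ((Y + a) / 2) (y t) \<and> z t = broken_z \<sigma> (- \<sigma>) ((Y + a) / 2) (y t)"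
    if t: "t \<in> {0..T}" for t
  proof -
    have yt: "0 \<le> y t" "y t \<le> Y" using y_mono[of 0 t] y_mono[of t T] t start e(2) by auto
    show ?thesis
      using \<sigma>(2)[OF t] upper_rigid_z[OF eq, of t] G[OF t] t
      by (simp add: broken_peak[OF aY \<sigma>(1) yt])
  qed
  then show ?thesis using \<sigma>(1) by blast
qed

lemma lower_shape:
  assumes tr: "trajectory x y z u v T N" and e: "\<bar>x T\<bar> = a" "y T = Y" "z T = a ^ 3 / 6" and a: "0 < a"
  shows "\<exists>\<sigma>\<in>{1, -1}. \<forall>t\<in>{0..T}. x t = broken_x 0 \<sigma> (Y - a) (y t) \<and> z t = broken_z 0 \<sigma> (Y - a) (y t)"
proof -
  interpret trajectory x y z u v T N by fact
  have aY: "0 \<le> a" "a \<le> Y" using x_le_y[of T] T_nonneg e by auto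
  have eq: "z T = \<bar>x T\<bar> ^ 3 / 6" using e by simp
  have G: "\<bar>x t\<bar> = max 0 (y t - (Y - a))" if "t \<in> {0..T}" for t
    using lower_rigid[OF eq] that e by simp
  have "\<exists>\<sigma>\<in>{1, -1}. \<forall>t\<in>{0..T}. x t = \<sigma> * max 0 (y t - (Y - a))"
  proof (rule sign_constant[where \<tau>="Y - a" and G="\<lambda>\<eta>. max 0 (\<eta> - (Y - a))"])
    show "\<bar>x t\<bar> = max 0 (y t - (Y - a))" if "t \<in> {0..T}" for t by (rule G[OF that])
  qed (use a e aY in auto)
  then obtain \<sigma> where \<sigma>: "\<sigma> \<in> {1, -1}" "\<And>t. t \<in> {0..T} \<Longrightarrow> x t = \<sigma> * max 0 (y t - (Y - a))" by blast
  have \<sigma>': "\<sigma> \<in> {0, 1, -1}" "\<sigma> \<noteq> 0" using \<sigma>(1) by auto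
  have "x t = broken_x 0 \<sigma> (Y - a) (y t) \<and> z t = broken_z 0 \<sigma> (Y - a) (y t)" if t: "t \<in> {0..T}" for t
    using \<sigma>(2)[OF t] lower_rigid_z[OF eq, of t] G[OF t] t
    by (simp add: broken_late[OF aY \<sigma>'(1)] \<sigma>'(2))
  then show ?thesis using \<sigma>(1) by blast
qed

lemma sgn_signs: "sgn (x::real) = \<sigma> \<Longrightarrow> \<sigma> \<in> {1, -1} \<Longrightarrow> x = \<sigma> * \<bar>x\<bar> \<and> 0 < \<bar>x\<bar> \<and> \<sigma> * x = \<bar>x\<bar>"
  by (auto simp: sgn_if split: if_splits)

theorem upper_boundary_unique:
  assumes S: "(x1, y1, z1) \<in> S1 \<union> S2" and sgn: "sgn x1 = \<sigma>" and \<sigma>: "\<sigma> \<in> {1, -1}"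
  shows "unique_optimal q0 (x1, y1, z1)
     (two_arcs (X_comb \<sigma> 1) ((y1 + \<sigma> * x1) / 2) (X_comb (- \<sigma>) 1)) y1"
proof -
  define a where "a = \<bar>x1\<bar>"
  have a: "x1 = \<sigma> * a" "0 < a" "\<sigma> * x1 = a" using sgn_signs[OF sgn \<sigma>] by (auto simp: a_def)
  have Y: "0 < y1" "a \<le> y1" using S \<sigma> a by (auto simp: S1_def S2_def)
  have zig: "zig 0 a y1 = (- 3 * a ^ 3 + 3 * a ^ 2 * y1 + 3 * a * y1 ^ 2 + y1 ^ 3) / 24"
    by (simp add: zig_def field_simps power2_eq_square power3_eq_cube)
  have z1: "z1 = zig 0 a y1"
    unfolding zig using S \<sigma> a by (auto simp: S1_def S2_def)
  have \<sigma>1: "\<bar>\<sigma>\<bar> \<le> 1" "\<bar>- \<sigma>\<bar> \<le> 1" using \<sigma> by auto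
  have \<tau>: "0 \<le> (y1 + a) / 2" "(y1 + a) / 2 \<le> y1" using Y a by auto
  note pk = broken_peak[OF less_imp_le[OF a(2)] Y(2) \<sigma>]
  show ?thesis
    unfolding a(3)
  proof (rule broken_unique[OF \<sigma>1 \<tau>])
    show "two_arcs (X_comb \<sigma> 1) ((y1 + a) / 2) (X_comb (- \<sigma>) 1) t
        = (broken_x \<sigma> (- \<sigma>) ((y1 + a) / 2) t, t, broken_z \<sigma> (- \<sigma>) ((y1 + a) / 2) t)" if "t \<in> {0..y1}" for t
      by (rule two_arcs_broken) (use \<tau> that in auto)
    show "broken_x \<sigma> (- \<sigma>) ((y1 + a) / 2) y1 = x1" "broken_z \<sigma> (- \<sigma>) ((y1 + a) / 2) y1 = z1"
      using pk[of y1] Y a(1) z1 by simp_all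
    fix x y z u v T N t
    assume tr: "trajectory x y z u v T N" and e: "x T = x1" "y T = y1" "z T = z1" and t: "t \<in> {0..T}"
    interpret trajectory x y z u v T N by fact
    obtain \<sigma>' where \<sigma>': "\<sigma>' \<in> {1, -1}" "\<And>t. t \<in> {0..T} \<Longrightarrow> x t = broken_x \<sigma>' (- \<sigma>') ((y1 + a) / 2) (y t) \<and>
       z t = broken_z \<sigma>' (- \<sigma>') ((y1 + a) / 2) (y t)"
    proof -
      have "\<bar>x T\<bar> = a" "z T = zig 0 a y1" using e z1 by (simp_all add: a_def)
      from upper_shape[OF tr this(1) e(2) this(2) Y(1)] show thesis using that by blast
    qed
    have "x T = \<sigma>' * a"
      using \<sigma>'(2)[of T] T_nonneg e(2) broken_peak(1)[OF less_imp_le[OF a(2)] Y(2) \<sigma>'(1), of y1] Y by simp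
    then have "\<sigma>' = \<sigma>" using e(1) a by simp
    then show "x t = broken_x \<sigma> (- \<sigma>) ((y1 + a) / 2) (y t) \<and> z t = broken_z \<sigma> (- \<sigma>) ((y1 + a) / 2) (y t)"
      using \<sigma>'(2)[OF t] by simp
  qed
qed

lemma lower_unique:
  assumes a: "0 < a" "a \<le> Y" and \<sigma>: "\<sigma> \<in> {1, -1}"
    and p: "\<And>t. t \<in> {0..Y} \<Longrightarrow> p t = (broken_x 0 \<sigma> (Y - a) t, t, broken_z 0 \<sigma> (Y - a) t)"
  shows "unique_optimal q0 (\<sigma> * a, Y, a ^ 3 / 6) p Y"
proof (rule broken_unique[OF _ _ _ _ p])
  have \<sigma>': "\<sigma> \<in> {0, 1, -1}" "\<sigma> \<noteq> 0" using \<sigma> by auto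
  note lt = broken_late[OF less_imp_le[OF a(1)] a(2) \<sigma>'(1)]
  show "\<bar>0\<bar> \<le> (1::real)" "\<bar>\<sigma>\<bar> \<le> 1" "0 \<le> Y - a" "Y - a \<le> Y" using \<sigma> a by auto
  show "broken_x 0 \<sigma> (Y - a) Y = \<sigma> * a" "broken_z 0 \<sigma> (Y - a) Y = a ^ 3 / 6"
    using lt[of Y] \<sigma>'(2) a by simp_all
  fix x y z u v T N t
  assume tr: "trajectory x y z u v T N" and e: "x T = \<sigma> * a" "y T = Y" "z T = a ^ 3 / 6" and t: "t \<in> {0..T}"
  interpret trajectory x y z u v T N by fact
  have "\<bar>x T\<bar> = a" using e(1) \<sigma> a(1) by auto
  from lower_shape[OF tr this e(2,3) a(1)]
  obtain \<sigma>'' where \<sigma>'': "\<sigma>'' \<in> {1, -1}" "\<And>t. t \<in> {0..T} \<Longrightarrow> x t = broken_x 0 \<sigma>'' (Y - a) (y t) \<and>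
       z t = broken_z 0 \<sigma>'' (Y - a) (y t)" by blast
  have "\<sigma>'' \<in> {0, 1, -1}" using \<sigma>''(1) by auto
  then have "x T = \<sigma>'' * a"
    using \<sigma>''(2)[of T] T_nonneg e(2) broken_late(1)[OF less_imp_le[OF a(1)] a(2), of \<sigma>'' Y] a by simp
  then have "\<sigma>'' = \<sigma>" using e(1) a by simp
  then show "x t = broken_x 0 \<sigma> (Y - a) (y t) \<and> z t = broken_z 0 \<sigma> (Y - a) (y t)"
    using \<sigma>''(2)[OF t] by simp
qed

theorem lower_boundary_unique:
  assumes S: "(x1, y1, z1) \<in> S3 \<union> S4" and sgn: "sgn x1 = \<sigma>" and \<sigma>: "\<sigma> \<in> {1, -1}"
  shows "unique_optimal q0 (x1, y1, z1) (two_arcs X2 (y1 - \<sigma> * x1) (X_comb \<sigma> 1)) y1"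
proof -
  define a where "a = \<bar>x1\<bar>"
  have a: "x1 = \<sigma> * a" "0 < a" "\<sigma> * x1 = a" using sgn_signs[OF sgn \<sigma>] by (auto simp: a_def)
  have Y: "a \<le> y1" and z1: "z1 = a ^ 3 / 6"
    using S \<sigma> a by (auto simp: S3_def S4_def)
  show ?thesis
    unfolding a(3) unfolding a(1) z1 X2_eq
    by (rule lower_unique[OF a(2) Y \<sigma>], rule two_arcs_broken) (use Y in auto)
qed

theorem straight_unique:
  assumes sgn: "sgn x1 = \<sigma>" and \<sigma>: "\<sigma> \<in> {1, -1}" and y1: "y1 = \<sigma> * x1" and z1: "z1 = y1 ^ 3 / 6"
  shows "unique_optimal q0 (x1, y1, z1) (\<lambda>t. flow (X_comb \<sigma> 1) t q0) y1"
proof -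
  define a where "a = \<bar>x1\<bar>"
  have a: "x1 = \<sigma> * a" "0 < a" "y1 = a" using sgn_signs[OF sgn \<sigma>] y1 by (auto simp: a_def)
  show ?thesis
    unfolding z1 a(3) unfolding a(1)
  proof (rule lower_unique[OF a(2) order_refl \<sigma>])
    fix t assume "t \<in> {0..a}"
    then show "flow (X_comb \<sigma> 1) t q0 = (broken_x 0 \<sigma> (a - a) t, t, broken_z 0 \<sigma> (a - a) t)"
      by (auto simp: flow_X_comb_q0 broken_x_def broken_z_def)
  qed
qed

theorem vertical_unique:
  assumes Y: "0 < Y"
  shows "unique_optimal q0 (0, Y, 0) (\<lambda>t. flow X2 t q0) Y"
proof (rule broken_unique[of 0 0 Y])
  fix x y z u v T N t
  assume tr: "trajectory x y z u v T N" and e: "x T = 0" "y T = Y" "z T = 0" and t: "t \<in> {0..T}"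
  interpret trajectory x y z u v T N by fact
  have eq: "z T = \<bar>x T\<bar> ^ 3 / 6" using e by simp
  have "y t \<le> Y" using y_mono[of t T] t e(2) by auto
  then have "x t = 0" using lower_rigid[OF eq, of t] t e by simp
  then show "x t = broken_x 0 0 Y (y t) \<and> z t = broken_z 0 0 Y (y t)"
    using lower_rigid_z[OF eq, of t] t by (simp add: broken_x_def broken_z_def)
qed (use Y in \<open>auto simp: X2_eq flow_X_comb_q0 broken_x_def broken_z_def\<close>)

theorem peak_two:
  assumes z: "z1 = y1 ^ 3 / 24" "0 < z1"
  shows "exactly_two_optimal q0 (0, y1, z1)
     (two_arcs (X_comb 1 1) (y1 / 2) (X_comb (- 1) 1)) y1
     (two_arcs (X_comb (- 1) 1) (y1 / 2) (X_comb 1 1)) y1"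
proof -
  have "0 < y1 ^ 3" using z by linarith
  then have Y: "0 < y1" by (simp add: zero_less_power_eq)
  have z1: "z1 = zig 0 0 y1" using z by (simp add: zig_def power3_eq_cube)
  have pk: "broken_x \<sigma> (- \<sigma>) (y1 / 2) \<eta> = \<sigma> * min \<eta> (y1 - \<eta>)"
    "broken_z \<sigma> (- \<sigma>) (y1 / 2) \<eta> = zig 0 (min \<eta> (y1 - \<eta>)) \<eta>"
    if "\<sigma> \<in> {1, -1}" "0 \<le> \<eta>" "\<eta> \<le> y1" for \<sigma> \<eta>
    using broken_peak[of 0 y1 \<sigma> \<eta>] that Y by simp_all
  have arcs: "two_arcs (X_comb \<sigma> 1) (y1 / 2) (X_comb (- \<sigma>) 1) t
      = (broken_x \<sigma> (- \<sigma>) (y1 / 2) t, t, broken_z \<sigma> (- \<sigma>) (y1 / 2) t)" if "0 \<le> t" for \<sigma> t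
    by (rule two_arcs_broken) (use Y that in auto)
  have adm: "\<exists>w. admissible (two_arcs (X_comb \<sigma> 1) (y1 / 2) (X_comb (- \<sigma>) 1)) w y1 \<and> traj_length w y1 = 0"
    if \<sigma>: "\<sigma> \<in> {1, -1}" for \<sigma>
  proof -
    have \<sigma>1: "\<bar>\<sigma>\<bar> \<le> 1" "\<bar>- \<sigma>\<bar> \<le> 1" "\<sigma>\<^sup>2 = 1" using \<sigma> by auto
    have "0 \<le> y1 / 2" "y1 / 2 \<le> y1" using Y by simp_all
    from broken_admissible[OF \<sigma>1(1,2) this, of "two_arcs (X_comb \<sigma> 1) (y1 / 2) (X_comb (- \<sigma>) 1)", OF arcs]
    show ?thesis by (simp add: \<sigma>1(3))
  qed
  have ends: "two_arcs (X_comb \<sigma> 1) (y1 / 2) (X_comb (- \<sigma>) 1) 0 = q0"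
    "two_arcs (X_comb \<sigma> 1) (y1 / 2) (X_comb (- \<sigma>) 1) y1 = (0, y1, z1)" if \<sigma>: "\<sigma> \<in> {1, -1}" for \<sigma>
    using arcs[of 0 \<sigma>] arcs[of y1 \<sigma>] broken_0[of "y1 / 2" \<sigma> "- \<sigma>"] pk[OF \<sigma>, of y1] Y z1 by simp_all
  have shape: "\<exists>\<sigma>\<in>{1, -1}. \<forall>t\<in>{0..T}. x t = broken_x \<sigma> (- \<sigma>) (y1 / 2) (y t) \<and> z t = broken_z \<sigma> (- \<sigma>) (y1 / 2) (y t)"
    if tr: "trajectory x y z u v T N" and e: "x T = 0" "y T = y1" "z T = z1" for x y z u v T N
    using upper_shape[OF tr _ e(2) _ Y, of 0] e z1 by simp
  have s1: "(1::real) \<in> {1, -1}" "(- 1::real) \<in> {1, -1}" by auto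
  obtain w1 where w1: "admissible (two_arcs (X_comb 1 1) (y1 / 2) (X_comb (- 1) 1)) w1 y1" "traj_length w1 y1 = 0"
    using adm[OF s1(1)] by blast
  obtain w2 where w2: "admissible (two_arcs (X_comb (- 1) 1) (y1 / 2) (X_comb 1 1)) w2 y1" "traj_length w2 y1 = 0"
    using adm[OF s1(2)] by auto
  note en = ends[OF s1(1)] ends[OF s1(2), simplified]
  show ?thesis
  proof (rule exactly_two_optimalI[OF w1(1) en(1,2) w1(2) w2(1) en(3,4) w2(2), where \<theta>="\<lambda>t. t"])
    fix x y z u v T N
    assume tr: "trajectory x y z u v T N" and e: "x T = 0" "y T = y1" "z T = z1"
    interpret trajectory x y z u v T N by fact
    obtain \<sigma> where \<sigma>: "\<sigma> \<in> {1, -1}" "\<And>t. t \<in> {0..T} \<Longrightarrow> x t = broken_x \<sigma> (- \<sigma>) (y1 / 2) (y t) \<and> z t = broken_z \<sigma> (- \<sigma>) (y1 / 2) (y t)"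
      using shape[OF tr e] by blast
    have "len = sqrt (1 - \<sigma>\<^sup>2) * (y1 / 2) + sqrt (1 - (- \<sigma>)\<^sup>2) * (y T - y1 / 2)"
      by (rule len_broken) (use \<sigma> Y e in auto)
    moreover have "\<sigma>\<^sup>2 = 1" using \<sigma>(1) by auto
    ultimately show "len \<le> 0" by simp
    have y0: "0 \<le> y t" if "t \<in> {0..T}" for t using y_mono[of 0 t] that start by auto
    show "(\<forall>t\<in>{0..T}. two_arcs (X_comb 1 1) (y1 / 2) (X_comb (- 1) 1) (y t) = (x t, y t, z t)) \<or>
      (\<forall>t\<in>{0..T}. two_arcs (X_comb (- 1) 1) (y1 / 2) (X_comb 1 1) (y t) = (x t, y t, z t))"
    proof -
      have "two_arcs (X_comb \<sigma> 1) (y1 / 2) (X_comb (- \<sigma>) 1) (y t) = (x t, y t, z t)" if "t \<in> {0..T}" for t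
        using arcs[OF y0[OF that], of \<sigma>] \<sigma>(2)[OF that] by simp
      then show ?thesis using \<sigma>(1) by (elim insertE) simp_all
    qed
  next
    show "0 < y1" by (rule Y)
    show "0 < fst (two_arcs (X_comb 1 1) (y1 / 2) (X_comb (- 1) 1) s)" if "0 < s" "s < y1" for s
      using arcs[of s 1] pk(1)[OF s1(1), of s] that by simp
    show "fst (two_arcs (X_comb (- 1) 1) (y1 / 2) (X_comb 1 1) s) \<le> 0" if "s \<in> {0..y1}" for s
      using arcs[of s "- 1"] pk(1)[OF s1(2), of s] that by simp
  qed (auto intro: continuous_intros mono_onI)
qed

section \<open>Optimal curves to interior points\<close>

lemma attainable_bounds:
  assumes "(x1, y1, z1) \<in> attainable q0"
  shows "\<bar>x1\<bar> \<le> y1" "\<bar>x1\<bar> ^ 3 / 6 \<le> z1" "z1 \<le> zig 0 \<bar>x1\<bar> y1"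
proof -
  obtain q w T where q: "admissible q w T" "q 0 = q0" "q T = (x1, y1, z1)"
    using assms by (auto simp: attainable_def)
  have "\<bar>x1\<bar> \<le> y1 \<and> \<bar>x1\<bar> ^ 3 / 6 \<le> z1 \<and> z1 \<le> zig 0 \<bar>x1\<bar> y1"
  proof (rule admissible_trajectory[OF q(1,2)])
    fix N assume tr: "trajectory (\<lambda>t. fst (q t)) (\<lambda>t. fst (snd (q t))) (\<lambda>t. snd (snd (q t))) (\<lambda>t. fst (w t)) (\<lambda>t. snd (w t)) T N"
    note T = trajectory.T_nonneg[OF tr]
    show ?thesis
      using trajectory.x_le_y[OF tr T order_refl] trajectory.z_ge_cube[OF tr T order_refl]
        trajectory.z_le_zig[OF tr T order_refl] q(3) by simp
  qed
  then show "\<bar>x1\<bar> \<le> y1" "\<bar>x1\<bar> ^ 3 / 6 \<le> z1" "z1 \<le> zig 0 \<bar>x1\<bar> y1" by auto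
qed

text \<open>The bounds become strict in the interior of the attainable set, since moving \<open>y\<close> or \<open>z\<close> slightly would
  violate them.\<close>
lemma interior_attainable_bounds:
  assumes "(x1, y1, z1) \<in> interior (attainable q0)"
  shows "\<bar>x1\<bar> < y1" "\<bar>x1\<bar> ^ 3 / 6 < z1" "z1 < zig 0 \<bar>x1\<bar> y1"
proof -
  obtain e where e: "0 < e" "ball (x1, y1, z1) e \<subseteq> attainable q0"
    using assms by (auto simp: mem_interior)
  have "(x1, y1 - e / 2, z1) \<in> attainable q0" "(x1, y1, z1 - e / 2) \<in> attainable q0" "(x1, y1, z1 + e / 2) \<in> attainable q0"
    using e(1) by (auto intro!: subsetD[OF e(2)] simp: dist_Pair_Pair dist_real_def)
  from attainable_bounds(1)[OF this(1)] attainable_bounds(2)[OF this(2)] attainable_bounds(3)[OF this(3)]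
  show "\<bar>x1\<bar> < y1" "\<bar>x1\<bar> ^ 3 / 6 < z1" "z1 < zig 0 \<bar>x1\<bar> y1" using e(1) by auto
qed

lemma family_ex: "0 < Y \<Longrightarrow> \<exists>X P Tm Z. extremal_family X P Tm Z Y"
proof -
  assume Y: "0 < Y"
  define E where "E = (\<lambda>c p (X, P, Tm, Z). extremal c X P Tm Z \<and> P 0 = p)"
  define q where "q = (\<lambda>c p. SOME r. E c p r)"
  have q: "E c p (q c p)" if p: "0 \<le> p" for c p
  proof -
    obtain X P Tm Z where "extremal c X P Tm Z" "P 0 = p" using extremal_ex[OF p] by blast
    then have "E c p (X, P, Tm, Z)" by (simp add: E_def)
    then show ?thesis unfolding q_def by (rule someI)
  qed
  define X P Tm Z where "X = (\<lambda>c p. fst (q c p))" and "P = (\<lambda>c p. fst (snd (q c p)))"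
    and "Tm = (\<lambda>c p. fst (snd (snd (q c p))))" and "Z = (\<lambda>c p. snd (snd (snd (q c p))))"
  have h: "extremal c (X c p) (P c p) (Tm c p) (Z c p) \<and> P c p 0 = p" if "0 \<le> p" for c p
    using q[OF that, of c] unfolding E_def X_def P_def Tm_def Z_def by (simp only: case_prod_unfold)
  have "extremal_family X P Tm Z Y"
    by (rule extremal_family.intro) (use h Y in blast)+
  then show ?thesis by blast
qed

text \<open>A positive extremal, possibly with \<open>X Y = 0\<close> at the end. The points of \<open>N_plus\<close>, \<open>N_minus\<close> and \<open>N_zero\<close>
  correspond to these up to the sign of \<open>x\<close>.\<close>
definition reaches :: "real \<Rightarrow> (real \<Rightarrow> real) \<Rightarrow> (real \<Rightarrow> real) \<Rightarrow> (real \<Rightarrow> real) \<Rightarrow> (real \<Rightarrow> real) \<Rightarrow> real \<Rightarrow> bool" where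
  "reaches c X P Tm Z Y \<longleftrightarrow> extremal c X P Tm Z \<and> 0 < P 0 \<and> 0 < Y \<and> (\<forall>\<eta>. 0 < \<eta> \<and> \<eta> < Y \<longrightarrow> 0 < X \<eta>)"

lemma reaches_positive:
  assumes "0 < \<xi>" "\<xi> < Y" "\<xi> ^ 3 / 6 < \<zeta>" "\<zeta> < zig 0 \<xi> Y"
  shows "\<exists>c X P Tm Z. reaches c X P Tm Z Y \<and> X Y = \<xi> \<and> Z Y = \<zeta>"
proof -
  have Y: "0 < Y" using assms by simp
  obtain X P Tm Z where "extremal_family X P Tm Z Y" using family_ex[OF Y] by blast
  then interpret extremal_family X P Tm Z Y .
  obtain c p where h: "hits c p \<xi>" "Z c p Y = \<zeta>" using hits_all_positive[OF assms] by blast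
  then have "reaches c (X c p) (P c p) (Tm c p) (Z c p) Y \<and> X c p Y = \<xi> \<and> Z c p Y = \<zeta>"
    using ext[of p c] init[of p c] Y by (auto simp: reaches_def hits_def)
  then show ?thesis by blast
qed

lemma reaches_zero:
  assumes "0 < Y" "0 < \<zeta>" "\<zeta> < zig 0 0 Y"
  shows "\<exists>c X P Tm Z. 0 < c \<and> reaches c X P Tm Z Y \<and> X Y = 0 \<and> Z Y = \<zeta>"
proof -
  obtain X P Tm Z where "extremal_family X P Tm Z Y" using family_ex[OF assms(1)] by blast
  then interpret extremal_family X P Tm Z Y .
  have "\<zeta> < Y ^ 3 / 24" using assms(3) by (simp add: zig_def power_divide)
  then obtain c p where h: "0 < c" "hits c p 0" "Z c p Y = \<zeta>" using hits_all_zero assms(2) by blast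
  then have "reaches c (X c p) (P c p) (Tm c p) (Z c p) Y \<and> X c p Y = 0 \<and> Z c p Y = \<zeta>"
    using ext[of p c] init[of p c] assms(1) by (auto simp: reaches_def hits_def)
  then show ?thesis using h(1) by blast
qed

text \<open>The reflection \<open>x \<mapsto> - x\<close> reduces the exponential mapping to nonnegative initial \<open>\<psi>\<close>.\<close>
lemma Exp_signed:
  assumes e: "extremal c X P Tm Z" and \<sigma>: "\<sigma> \<in> {1, -1}" and \<eta>: "0 \<le> \<eta>"
  shows "Exp (\<sigma> * arsinh (P 0), c) (Tm \<eta>) = (\<sigma> * X \<eta>, \<eta>, Z \<eta>)"
    and "\<exists>w. admissible (Exp (\<sigma> * arsinh (P 0), c)) w (Tm \<eta>) \<and> traj_length w (Tm \<eta>) = Tm \<eta>"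
proof -
  have "Exp (\<sigma> * arsinh (P 0), c) (Tm \<eta>) = (\<sigma> * X \<eta>, \<eta>, Z \<eta>) \<and>
    (\<exists>w. admissible (Exp (\<sigma> * arsinh (P 0), c)) w (Tm \<eta>) \<and> traj_length w (Tm \<eta>) = Tm \<eta>)"
  proof (cases "\<sigma> = 1")
    case True
    have p: "P 0 = sinh (arsinh (P 0))" by simp
    show ?thesis using Exp_extremal[OF e p \<eta>] Exp_admissible[OF e p \<eta>] True by simp
  next
    case False
    then have \<sigma>': "\<sigma> = - 1" using \<sigma> by simp
    have p: "- P 0 = sinh (- arsinh (P 0))" by simp
    show ?thesis using Exp_extremal[OF extremal_uminus[OF e] p \<eta>] Exp_admissible[OF extremal_uminus[OF e] p \<eta>] \<sigma>' by simp
  qed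
  then show "Exp (\<sigma> * arsinh (P 0), c) (Tm \<eta>) = (\<sigma> * X \<eta>, \<eta>, Z \<eta>)"
    "\<exists>w. admissible (Exp (\<sigma> * arsinh (P 0), c)) w (Tm \<eta>) \<and> traj_length w (Tm \<eta>) = Tm \<eta>" by auto
qed

text \<open>A competitor of maximal length is \<open>x = C X(y)\<close> by calibration; its final \<open>z\<close> is \<open>C\<^sup>2 Z Y = Z Y\<close>, so
  \<open>C = \<plusminus>1\<close>.\<close>
lemma reaches_optimal:
  assumes r: "reaches c X P Tm Z Y" and \<sigma>: "\<sigma> \<in> {1, -1}"
    and tr: "trajectory x y z u v T N" and e: "x T = \<sigma> * X Y" "y T = Y" "z T = Z Y"
  shows "trajectory.len u v T \<le> Tm Y"
    and "trajectory.len u v T = Tm Y \<Longrightarrow> \<exists>C\<in>{1, -1}. (X Y \<noteq> 0 \<longrightarrow> C = \<sigma>) \<and> (\<forall>t\<in>{0..T}. x t = C * X (y t) \<and> z t = Z (y t))"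
proof -
  have ext: "extremal c X P Tm Z" and P0: "0 < P 0" and Y: "0 < Y"
    and pos: "\<And>\<eta>. 0 < \<eta> \<Longrightarrow> \<eta> < Y \<Longrightarrow> 0 < X \<eta>" using r by (auto simp: reaches_def)
  interpret extremal c X P Tm Z by fact
  interpret trajectory x y z u v T N by fact
  obtain u' where tr': "trajectory (\<lambda>t. \<sigma> * x t) y z u' v T N" and len': "trajectory.len u' v T = len"
  proof (cases "\<sigma> = 1")
    case True
    show thesis by (rule that[of u]) (use tr True in simp_all)
  next
    case False
    then have "\<sigma> = - 1" using \<sigma> by simp
    then show thesis using that[of "\<lambda>t. - u t"] trajectory_uminus[OF tr] by simp
  qed
  have \<sigma>2: "\<sigma> * (\<sigma> * b) = b" for b using \<sigma> by auto
  have e': "\<sigma> * x T = X Y" by (simp add: e(1) \<sigma>2)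
  note cal = calibration[OF tr' ext e(2) Y P0 pos e', unfolded len' e(3)]
  show "len \<le> Tm Y" using cal(1) by simp
  assume "len = Tm Y"
  then have "\<exists>C. \<forall>t\<in>{0..T}. \<sigma> * x t = C * X (y t)" using cal(2) by simp
  then obtain C where C: "\<And>t. t \<in> {0..T} \<Longrightarrow> \<sigma> * x t = C * X (y t)" by blast
  have x: "x t = (\<sigma> * C) * X (y t)" if "t \<in> {0..T}" for t
    using C[OF that] \<sigma>2[of "x t"] by (simp add: mult.assoc)
  have zz: "z t = (\<sigma> * C)\<^sup>2 * Z (y t)" if "t \<in> {0..T}" for t
    by (rule z_proportional[OF ext x]) (use that in auto)
  have "Z 0 < Z Y"
  proof (rule DERIV_pos_imp_increasing_open[OF Y])
    show "\<exists>d. (Z has_real_derivative d) (at \<eta>) \<and> 0 < d" if "0 < \<eta>" "\<eta> < Y" for \<eta>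
      using Z_deriv[of \<eta>] pos[OF that] by (intro exI[of _ "(X \<eta>)\<^sup>2 / 2"]) auto
    show "continuous_on {0..Y} Z" by (rule continuous)
  qed
  then have "(\<sigma> * C)\<^sup>2 = 1" using zz[of T] T_nonneg e Z0 by simp
  then have "\<sigma> * C \<in> {1, -1}" by (simp add: power2_eq_1_iff)
  moreover have "X Y \<noteq> 0 \<longrightarrow> \<sigma> * C = \<sigma>"
  proof -
    have "x T = (\<sigma> * C) * X (y T)" by (rule x) (use T_nonneg in simp)
    then have "(\<sigma> * C) * X Y = \<sigma> * X Y" using e(1,2) by (simp only:)
    then show ?thesis by (metis mult_right_cancel)
  qed
  moreover have "x t = (\<sigma> * C) * X (y t) \<and> z t = Z (y t)" if "t \<in> {0..T}" for t
    using x[OF that] zz[OF that] \<open>(\<sigma> * C)\<^sup>2 = 1\<close> by simp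
  ultimately show "\<exists>C\<in>{1, -1}. (X Y \<noteq> 0 \<longrightarrow> C = \<sigma>) \<and> (\<forall>t\<in>{0..T}. x t = C * X (y t) \<and> z t = Z (y t))" by blast
qed

lemma clock_mono:
  assumes "extremal c X P Tm Z"
  shows "continuous_on {0..Y} Tm" "mono_on {0..Y} Tm" "Tm 0 = 0"
proof -
  interpret extremal c X P Tm Z by fact
  show "continuous_on {0..Y} Tm" by (rule continuous)
  show "mono_on {0..Y} Tm" using Tm_strict_mono by (intro mono_onI) (metis less_imp_le order_le_less)
  show "Tm 0 = 0" by (rule Tm0)
qed

lemma Exp_start:
  assumes "extremal c X P Tm Z" "\<sigma> \<in> {1, -1}"
  shows "Exp (\<sigma> * arsinh (P 0), c) 0 = q0"
  using Exp_signed(1)[OF assms, of 0] extremal.Tm0[OF assms(1)] extremal.X0[OF assms(1)] extremal.Z0[OF assms(1)]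
  by (simp add: q0_def)

theorem reaches_unique:
  assumes r: "reaches c X P Tm Z Y" and \<sigma>: "\<sigma> \<in> {1, -1}" and nz: "X Y \<noteq> 0"
  shows "unique_optimal q0 (\<sigma> * X Y, Y, Z Y) (Exp (\<sigma> * arsinh (P 0), c)) (Tm Y)"
proof -
  have ext: "extremal c X P Tm Z" and Y: "0 < Y" using r by (auto simp: reaches_def)
  obtain w where w: "admissible (Exp (\<sigma> * arsinh (P 0), c)) w (Tm Y)" "traj_length w (Tm Y) = Tm Y"
    using Exp_signed(2)[OF ext \<sigma>] Y by (meson less_imp_le)
  show ?thesis
  proof (rule unique_optimalI[OF w(1) Exp_start[OF ext \<sigma>] _ w(2) clock_mono[OF ext] refl])
    show "Exp (\<sigma> * arsinh (P 0), c) (Tm Y) = (\<sigma> * X Y, Y, Z Y)" using Exp_signed(1)[OF ext \<sigma>] Y by simp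
    fix x y z u v T N
    assume tr: "trajectory x y z u v T N" and e: "x T = \<sigma> * X Y" "y T = Y" "z T = Z Y"
    show "trajectory.len u v T \<le> Tm Y" by (rule reaches_optimal(1)[OF r \<sigma> tr e])
    fix t assume len: "trajectory.len u v T = Tm Y" and t: "t \<in> {0..T}"
    have "x t = \<sigma> * X (y t) \<and> z t = Z (y t)" using reaches_optimal(2)[OF r \<sigma> tr e len] nz t by auto
    moreover have "0 \<le> y t" using trajectory.x_le_y[OF tr, of t] t by auto
    ultimately show "Exp (\<sigma> * arsinh (P 0), c) (Tm (y t)) = (x t, y t, z t)"
      using Exp_signed(1)[OF ext \<sigma>] by simp
  qed
qed

theorem reaches_two:
  assumes r: "reaches c X P Tm Z Y" and z: "X Y = 0"
  shows "exactly_two_optimal q0 (0, Y, Z Y) (Exp (arsinh (P 0), c)) (Tm Y) (Exp (- arsinh (P 0), c)) (Tm Y)"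
proof -
  have ext: "extremal c X P Tm Z" and Y: "0 < Y" and pos: "\<And>\<eta>. 0 < \<eta> \<Longrightarrow> \<eta> < Y \<Longrightarrow> 0 < X \<eta>"
    using r by (auto simp: reaches_def)
  interpret extremal c X P Tm Z by fact
  have s: "(1::real) \<in> {1, -1}" "(- 1::real) \<in> {1, -1}" by auto
  obtain w where w: "admissible (Exp (arsinh (P 0), c)) w (Tm Y)" "traj_length w (Tm Y) = Tm Y"
    using Exp_signed(2)[OF ext s(1), of Y] Y by auto
  obtain w' where w': "admissible (Exp (- arsinh (P 0), c)) w' (Tm Y)" "traj_length w' (Tm Y) = Tm Y"
    using Exp_signed(2)[OF ext s(2), of Y] Y by auto
  have E: "Exp (arsinh (P 0), c) (Tm \<eta>) = (X \<eta>, \<eta>, Z \<eta>)" "Exp (- arsinh (P 0), c) (Tm \<eta>) = (- X \<eta>, \<eta>, Z \<eta>)"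
    if "0 \<le> \<eta>" for \<eta>
    using Exp_signed(1)[OF ext s(1) that] Exp_signed(1)[OF ext s(2) that] by simp_all
  have TY: "0 < Tm Y" using Tm_strict_mono[OF Y] Tm0 by simp
  have inv: "\<exists>\<eta>\<in>{0..Y}. Tm \<eta> = s" if "s \<in> {0..Tm Y}" for s
    using IVT'[of Tm 0 s Y] that Tm0 Y continuous(3) by auto
  show ?thesis
  proof (rule exactly_two_optimalI[OF w(1) _ _ w(2) w'(1) _ _ w'(2) clock_mono[OF ext] refl])
    show "Exp (arsinh (P 0), c) 0 = q0" "Exp (- arsinh (P 0), c) 0 = q0"
      using Exp_start[OF ext s(1)] Exp_start[OF ext s(2)] by simp_all
    show "Exp (arsinh (P 0), c) (Tm Y) = (0, Y, Z Y)" "Exp (- arsinh (P 0), c) (Tm Y) = (0, Y, Z Y)"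
      using E[of Y] Y z by simp_all
    fix x y z' u v T N
    assume tr: "trajectory x y z' u v T N" and e: "x T = 0" "y T = Y" "z' T = Z Y"
    have e': "x T = 1 * X Y" using e(1) z by simp
    show "trajectory.len u v T \<le> Tm Y" by (rule reaches_optimal(1)[OF r s(1) tr e' e(2,3)])
    assume "trajectory.len u v T = Tm Y"
    from reaches_optimal(2)[OF r s(1) tr e' e(2,3) this]
    obtain C where C: "C \<in> {1, -1}" "\<And>t. t \<in> {0..T} \<Longrightarrow> x t = C * X (y t) \<and> z' t = Z (y t)" by blast
    have y0: "0 \<le> y t" if "t \<in> {0..T}" for t using trajectory.x_le_y[OF tr, of t] that by auto
    show "(\<forall>t\<in>{0..T}. Exp (arsinh (P 0), c) (Tm (y t)) = (x t, y t, z' t)) \<or>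
       (\<forall>t\<in>{0..T}. Exp (- arsinh (P 0), c) (Tm (y t)) = (x t, y t, z' t))"
    proof (cases "C = 1")
      case True
      then have "\<forall>t\<in>{0..T}. Exp (arsinh (P 0), c) (Tm (y t)) = (x t, y t, z' t)"
        using E(1)[OF y0] C(2) by simp
      then show ?thesis ..
    next
      case False
      then have "C = - 1" using C(1) by simp
      then have "\<forall>t\<in>{0..T}. Exp (- arsinh (P 0), c) (Tm (y t)) = (x t, y t, z' t)"
        using E(2)[OF y0] C(2) by simp
      then show ?thesis ..
    qed
  next
    show "0 < Tm Y" by (rule TY)
    show "0 < fst (Exp (arsinh (P 0), c) s)" if s: "0 < s" "s < Tm Y" for s
    proof -
      have "s \<in> {0..Tm Y}" using s by simp
      then obtain \<eta> where \<eta>: "\<eta> \<in> {0..Y}" "Tm \<eta> = s" using inv by blast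
      then have "\<eta> \<noteq> 0" "\<eta> \<noteq> Y" using s Tm0 by auto
      then show ?thesis using E(1)[of \<eta>] pos[of \<eta>] \<eta> by auto
    qed
    show "fst (Exp (- arsinh (P 0), c) s) \<le> 0" if s: "s \<in> {0..Tm Y}" for s
    proof -
      obtain \<eta> where \<eta>: "\<eta> \<in> {0..Y}" "Tm \<eta> = s" using inv[OF s] by blast
      have "0 \<le> X \<eta>" using pos[of \<eta>] \<eta>(1) X0 z by (cases "\<eta> = 0"; cases "\<eta> = Y") auto
      then show ?thesis using E(2)[of \<eta>] \<eta> by auto
    qed
  qed
qed

lemma t_bound_uminus: "t_bound (- \<psi>) c = t_bound \<psi> c"
  by (simp add: t_bound_def)

lemma signed_bound: "\<sigma> \<in> {1, -1} \<Longrightarrow> t_bound (\<sigma> * \<psi>) c = t_bound \<psi> c"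
  using t_bound_uminus by auto

lemma N_reaches:
  assumes "((\<psi>, c), t) \<in> N_plus \<union> N_minus"
  obtains \<sigma> X P Tm Z Y where "\<sigma> \<in> {1, -1}" "reaches c X P Tm Z Y" "\<psi> = \<sigma> * arsinh (P 0)" "Tm Y = t" "0 < X Y"
proof -
  define \<sigma> where "\<sigma> = sgn \<psi>"
  have \<psi>: "\<psi> \<noteq> 0" "0 < t" "ereal t < t_bound \<psi> c" using assms by (auto simp: N_plus_def N_minus_def)
  have \<sigma>: "\<sigma> \<in> {1, -1}" using \<psi>(1) by (auto simp: \<sigma>_def sgn_if)
  have ab: "0 < \<bar>\<psi>\<bar>" "\<psi> = \<sigma> * \<bar>\<psi>\<bar>" using \<psi>(1) by (auto simp: \<sigma>_def mult_sgn_abs)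
  have tb: "ereal t < t_bound \<bar>\<psi>\<bar> c" using \<psi>(3) t_bound_uminus[of "\<bar>\<psi>\<bar>" c] by (cases "0 < \<psi>") auto
  obtain X P Tm Z where e: "extremal c X P Tm Z" "P 0 = sinh \<bar>\<psi>\<bar>" using extremal_ex_pos[of "sinh \<bar>\<psi>\<bar>" c] ab by auto
  obtain Y where Y: "0 < Y" "Tm Y = t" "\<forall>\<eta>\<in>{0<..Y}. 0 < X \<eta>"
    using t_bound_positivity(1)[OF e ab(1) \<psi>(2) tb] by blast
  have "0 < P 0" using e(2) ab by simp
  then have r: "reaches c X P Tm Z Y" using e(1) Y(1,3) by (simp add: reaches_def)
  have \<psi>_eq: "\<psi> = \<sigma> * arsinh (P 0)" unfolding e(2) arsinh_sinh_real by (rule ab(2))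
  have XY: "0 < X Y" using bspec[OF Y(3), of Y] Y(1) by simp
  show ?thesis by (rule that[OF \<sigma> r \<psi>_eq Y(2) XY])
qed

lemma N_zero_reaches:
  assumes "((\<psi>, c), t) \<in> N_zero"
  obtains \<sigma> X P Tm Z Y where "\<sigma> \<in> {1, -1}" "reaches c X P Tm Z Y" "\<psi> = \<sigma> * arsinh (P 0)" "Tm Y = t" "X Y = 0"
proof -
  define \<sigma> where "\<sigma> = sgn \<psi>"
  have \<psi>: "\<psi> \<noteq> 0" "0 < c" "ereal t = t_bound \<psi> c" using assms by (auto simp: N_zero_def)
  have \<sigma>: "\<sigma> \<in> {1, -1}" using \<psi>(1) by (auto simp: \<sigma>_def sgn_if)
  have ab: "0 < \<bar>\<psi>\<bar>" "\<psi> = \<sigma> * \<bar>\<psi>\<bar>" using \<psi>(1) by (auto simp: \<sigma>_def mult_sgn_abs)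
  have tb: "ereal t = t_bound \<bar>\<psi>\<bar> c" using \<psi>(3) t_bound_uminus[of "\<bar>\<psi>\<bar>" c] by (cases "0 < \<psi>") auto
  obtain X P Tm Z where e: "extremal c X P Tm Z" "P 0 = sinh \<bar>\<psi>\<bar>" using extremal_ex_pos[of "sinh \<bar>\<psi>\<bar>" c] ab by auto
  obtain Y where Y: "0 < Y" "ereal (Tm Y) = t_bound \<bar>\<psi>\<bar> c" "X Y = 0" "\<forall>\<eta>\<in>{0<..<Y}. 0 < X \<eta>"
    using t_bound_positivity(3)[OF e ab(1) \<psi>(2)] by blast
  have "0 < P 0" using e(2) ab by simp
  then have "reaches c X P Tm Z Y" using e(1) Y by (auto simp: reaches_def)
  moreover have "\<psi> = \<sigma> * arsinh (P 0)" unfolding e(2) arsinh_sinh_real by (rule ab(2))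
  moreover have "Tm Y = t" using Y(2) tb by (metis ereal.inject)
  ultimately show ?thesis using that \<sigma> Y(3) by blast
qed

lemma reaches_in_N:
  assumes r: "reaches c X P Tm Z Y" and \<sigma>: "\<sigma> \<in> {1, -1}" and X: "0 < X Y"
  shows "((\<sigma> * arsinh (P 0), c), Tm Y) \<in> N_plus \<union> N_minus"
proof -
  have e: "extremal c X P Tm Z" and P0: "0 < P 0" and Y: "0 < Y" and pos: "\<forall>\<eta>. 0 < \<eta> \<and> \<eta> < Y \<longrightarrow> 0 < X \<eta>"
    using r by (auto simp: reaches_def)
  have "0 < X \<eta>" if "\<eta> \<in> {0<..Y}" for \<eta> using pos X that by (cases "\<eta> = Y") auto
  then have "ereal (Tm Y) < t_bound (arsinh (P 0)) c"
    using t_bound_positivity(2)[OF e _ _ Y, of "arsinh (P 0)"] P0 by simp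
  moreover have "0 < Tm Y" using extremal.Tm_strict_mono[OF e Y] extremal.Tm0[OF e] by simp
  ultimately show ?thesis
    using \<sigma> P0 signed_bound[OF \<sigma>, of "arsinh (P 0)" c] by (auto simp: N_plus_def N_minus_def)
qed

lemma reaches_in_N_zero:
  assumes r: "reaches c X P Tm Z Y" and \<sigma>: "\<sigma> \<in> {1, -1}" and X: "X Y = 0" and c: "0 < c"
  shows "((\<sigma> * arsinh (P 0), c), Tm Y) \<in> N_zero"
proof -
  have e: "extremal c X P Tm Z" and P0: "0 < P 0" and Y: "0 < Y" and pos: "\<And>\<eta>. 0 < \<eta> \<Longrightarrow> \<eta> < Y \<Longrightarrow> 0 < X \<eta>"
    using r by (auto simp: reaches_def)
  have p: "P 0 = sinh (arsinh (P 0))" "0 < arsinh (P 0)" using P0 by simp_all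
  obtain Y' where Y': "0 < Y'" "ereal (Tm Y') = t_bound (arsinh (P 0)) c" "X Y' = 0" "\<forall>\<eta>\<in>{0<..<Y'}. 0 < X \<eta>"
    using t_bound_positivity(3)[OF e p c] by blast
  have "\<not> Y < Y'" using bspec[OF Y'(4), of Y] X Y by auto
  moreover have "\<not> Y' < Y" using pos[of Y'] Y'(1,3) by auto
  ultimately have "Y' = Y" by simp
  then show ?thesis using Y'(2) signed_bound[OF \<sigma>, of "arsinh (P 0)" c] \<sigma> P0 c by (auto simp: N_zero_def)
qed

lemma reaches_injective:
  assumes r: "reaches c X P Tm Z Y" and r': "reaches c' X' P' Tm' Z' Y" and eq: "X' Y = X Y" "Z' Y = Z Y"
  shows "c' = c" "P' 0 = P 0" "Tm' Y = Tm Y"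
proof -
  have e: "extremal c X P Tm Z" "extremal c' X' P' Tm' Z'" and P0: "0 < P 0" "0 < P' 0" and Y: "0 < Y"
    and pos: "\<And>\<eta>. 0 < \<eta> \<Longrightarrow> \<eta> < Y \<Longrightarrow> 0 < X \<eta>" "\<And>\<eta>. 0 < \<eta> \<Longrightarrow> \<eta> < Y \<Longrightarrow> 0 < X' \<eta>"
    using r r' by (auto simp: reaches_def)
  show c: "c' = c" and P: "P' 0 = P 0" by (rule extremal_pair_unique[OF e P0 Y pos eq], assumption+)+
  show "Tm' Y = Tm Y" using extremal_agree(3)[OF e(1) e(2)[unfolded c] P] Y by simp
qed

text \<open>Surjectivity supplies a preimage, \<open>reaches_injective\<close> shows that it is the only one (the sign of \<open>x\<^sub>1\<close>
  fixes the sign of \<open>\<psi>\<^sub>0\<close>), and \<open>reaches_unique\<close> gives optimality.\<close>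
theorem interior_off_plane:
  assumes q1: "q1 \<in> interior (attainable q0) - plane_x0"
  shows "\<exists>lam t1. Exp_preimages (N_plus \<union> N_minus) q1 = {(lam, t1)} \<and> unique_optimal q0 q1 (Exp lam) t1"
proof -
  obtain x1 Y z1 where q1_eq: "q1 = (x1, Y, z1)" by (cases q1)
  have x1: "x1 \<noteq> 0" using q1 by (auto simp: q1_eq plane_x0_def)
  define \<sigma> where "\<sigma> = sgn x1"
  have \<sigma>: "\<sigma> \<in> {1, -1}" using x1 by (auto simp: \<sigma>_def sgn_if)
  have sx: "x1 = \<sigma> * \<bar>x1\<bar>" "0 < \<bar>x1\<bar>" using sgn_signs[of x1 \<sigma>] \<sigma> by (auto simp: \<sigma>_def)
  note b = interior_attainable_bounds[of x1 Y z1]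
  obtain c X P Tm Z where r: "reaches c X P Tm Z Y" and XY: "X Y = \<bar>x1\<bar>" and ZY: "Z Y = z1"
    using reaches_positive[OF sx(2), of Y z1] b q1 q1_eq by auto
  have e: "extremal c X P Tm Z" and Y: "0 < Y" using r by (auto simp: reaches_def)
  define lam where "lam = (\<sigma> * arsinh (P 0), c)"
  have q1': "q1 = (\<sigma> * X Y, Y, Z Y)" using q1_eq XY ZY sx(1) by simp
  have "unique_optimal q0 q1 (Exp lam) (Tm Y)"
    unfolding q1' lam_def by (rule reaches_unique[OF r \<sigma>]) (use XY x1 in simp)
  moreover have "Exp_preimages (N_plus \<union> N_minus) q1 = {(lam, Tm Y)}"
  proof (intro equalityI subsetI)
    fix p assume p: "p \<in> Exp_preimages (N_plus \<union> N_minus) q1"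
    obtain \<psi> c' t where p_eq: "p = ((\<psi>, c'), t)" by (metis prod.exhaust)
    have pN: "((\<psi>, c'), t) \<in> N_plus \<union> N_minus" "Exp (\<psi>, c') t = q1" using p by (auto simp: p_eq Exp_preimages_def)
    show "p \<in> {(lam, Tm Y)}"
    proof (rule N_reaches[OF pN(1)])
      fix \<sigma>' X' P' Tm' Z' Y'
      assume s': "\<sigma>' \<in> {1, -1::real}" and r': "reaches c' X' P' Tm' Z' Y'" and \<psi>: "\<psi> = \<sigma>' * arsinh (P' 0)"
        and t: "Tm' Y' = t" and X': "0 < X' Y'"
      have e': "extremal c' X' P' Tm' Z'" and Y': "0 \<le> Y'" using r' by (auto simp: reaches_def)
      have "Exp (\<psi>, c') t = (\<sigma>' * X' Y', Y', Z' Y')"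
        using Exp_signed(1)[OF e' s' Y'] unfolding \<psi>[symmetric] t .
      then have "(\<sigma>' * X' Y', Y', Z' Y') = (\<sigma> * X Y, Y, Z Y)" by (rule trans[OF sym trans[OF pN(2) q1']])
      then have eq: "\<sigma>' * X' Y' = \<sigma> * X Y" "Y' = Y" "Z' Y' = Z Y" by auto
      have XYp: "0 < X Y" using XY sx(2) by simp
      have ss: "\<sigma>' = \<sigma>" using eq(1) s' \<sigma> X' XYp by auto
      have "\<sigma> \<noteq> 0" using \<sigma> by auto
      then have "X' Y = X Y" using eq ss by simp
      from reaches_injective[OF r r'[unfolded eq(2)] this] eq(2,3)
      show ?thesis using t \<psi> by (simp add: p_eq lam_def ss)
    qed
  next
    fix p assume "p \<in> {(lam, Tm Y)}"
    then have p: "p = ((\<sigma> * arsinh (P 0), c), Tm Y)" by (simp add: lam_def)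
    have "0 < X Y" using XY sx(2) by simp
    then show "p \<in> Exp_preimages (N_plus \<union> N_minus) q1"
      using reaches_in_N[OF r \<sigma>] Exp_signed(1)[OF e \<sigma>, of Y] Y unfolding p q1' Exp_preimages_def by simp
  qed
  ultimately show ?thesis by blast
qed

text \<open>On the plane both signs of \<open>\<psi>\<^sub>0\<close> lead to the same point, so preimages and optimal curves come in
  mirror pairs.\<close>
theorem interior_on_plane:
  assumes q1: "q1 \<in> interior (attainable q0) \<inter> plane_x0"
  shows "\<exists>lam1 lam2 t1. lam1 \<noteq> lam2 \<and> Exp_preimages N_zero q1 = {(lam1, t1), (lam2, t1)} \<and>
     exactly_two_optimal q0 q1 (Exp lam1) t1 (Exp lam2) t1"
proof -
  obtain Y z1 where q1_eq: "q1 = (0, Y, z1)" using q1 by (auto simp: plane_x0_def)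
  note b = interior_attainable_bounds[of 0 Y z1]
  obtain c X P Tm Z where c: "0 < c" and r: "reaches c X P Tm Z Y" and XY: "X Y = 0" and ZY: "Z Y = z1"
    using reaches_zero[of Y z1] b q1 q1_eq by auto
  have e: "extremal c X P Tm Z" and Y: "0 < Y" and P0: "0 < P 0" using r by (auto simp: reaches_def)
  define lam where "lam = (\<lambda>\<sigma>::real. (\<sigma> * arsinh (P 0), c))"
  have q1': "q1 = (0, Y, Z Y)" using q1_eq ZY by simp
  have "exactly_two_optimal q0 q1 (Exp (lam 1)) (Tm Y) (Exp (lam (- 1))) (Tm Y)"
    using reaches_two[OF r XY] by (simp add: lam_def q1')
  moreover have "lam 1 \<noteq> lam (- 1)"
  proof -
    have "0 < arsinh (P 0)" using P0 by simp
    then show ?thesis by (auto simp: lam_def)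
  qed
  moreover have "Exp_preimages N_zero q1 = {(lam 1, Tm Y), (lam (- 1), Tm Y)}"
  proof (intro equalityI subsetI)
    fix p assume p: "p \<in> Exp_preimages N_zero q1"
    obtain \<psi> c' t where p_eq: "p = ((\<psi>, c'), t)" by (metis prod.exhaust)
    have pN: "((\<psi>, c'), t) \<in> N_zero" "Exp (\<psi>, c') t = q1" using p by (auto simp: p_eq Exp_preimages_def)
    show "p \<in> {(lam 1, Tm Y), (lam (- 1), Tm Y)}"
    proof (rule N_zero_reaches[OF pN(1)])
      fix \<sigma>' X' P' Tm' Z' Y'
      assume s': "\<sigma>' \<in> {1, -1::real}" and r': "reaches c' X' P' Tm' Z' Y'" and \<psi>: "\<psi> = \<sigma>' * arsinh (P' 0)"
        and t: "Tm' Y' = t" and X': "X' Y' = 0"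
      have e': "extremal c' X' P' Tm' Z'" and Y': "0 \<le> Y'" using r' by (auto simp: reaches_def)
      have "Exp (\<psi>, c') t = (\<sigma>' * X' Y', Y', Z' Y')"
        using Exp_signed(1)[OF e' s' Y'] unfolding \<psi>[symmetric] t .
      then have "(\<sigma>' * X' Y', Y', Z' Y') = (0, Y, Z Y)" by (rule trans[OF sym trans[OF pN(2) q1']])
      then have eq: "Y' = Y" "Z' Y' = Z Y" by auto
      have "X' Y = X Y" "Z' Y = Z Y" using X' XY eq by simp_all
      from reaches_injective[OF r r'[unfolded eq(1)] this]
      have "p = (lam \<sigma>', Tm Y)" using t \<psi> eq(1) by (simp add: p_eq lam_def)
      then show ?thesis using s' by auto
    qed
  next
    fix p assume "p \<in> {(lam 1, Tm Y), (lam (- 1), Tm Y)}"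
    then have "\<exists>\<sigma>\<in>{1, -1}. p = (lam \<sigma>, Tm Y)" by auto
    then obtain \<sigma> where \<sigma>: "\<sigma> \<in> {1, -1}" and p: "p = ((\<sigma> * arsinh (P 0), c), Tm Y)"
      unfolding lam_def by blast
    show "p \<in> Exp_preimages N_zero q1"
      using reaches_in_N_zero[OF r \<sigma> XY c] Exp_signed(1)[OF e \<sigma>, of Y] Y XY unfolding p q1' Exp_preimages_def by simp
  qed
  ultimately show ?thesis by blast
qed

theorem theorem7:
  shows
    "(\<forall>q1 \<in> interior (attainable q0) - plane_x0.
        \<exists>lam t1. Exp_preimages (N_plus \<union> N_minus) q1 = {(lam, t1)} \<and>
               unique_optimal q0 q1 (Exp lam) t1)
   \<and> (\<forall>q1 \<in> interior (attainable q0) \<inter> plane_x0.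
        \<exists>lam1 lam2 t1. lam1 \<noteq> lam2 \<and>
               Exp_preimages N_zero q1 = {(lam1, t1), (lam2, t1)} \<and>
               exactly_two_optimal q0 q1 (Exp lam1) t1 (Exp lam2) t1)
   \<and> (\<forall>x1 y1 z1. \<forall>\<sigma> \<in> {1, -1}. (x1, y1, z1) \<in> S1 \<union> S2 \<and> sgn x1 = \<sigma> \<longrightarrow>
        unique_optimal q0 (x1, y1, z1)
          (two_arcs (X_comb \<sigma> 1) ((y1 + \<sigma> * x1) / 2) (X_comb (- \<sigma>) 1)) y1)
   \<and> (\<forall>x1 y1 z1. \<forall>\<sigma> \<in> {1, -1}. (x1, y1, z1) \<in> S3 \<union> S4 \<and> sgn x1 = \<sigma> \<longrightarrow>
        unique_optimal q0 (x1, y1, z1)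
          (two_arcs X2 (y1 - \<sigma> * x1) (X_comb \<sigma> 1)) y1)
   \<and> (\<forall>y1 > 0. unique_optimal q0 (0, y1, 0) (\<lambda>t. flow X2 t q0) y1)
   \<and> (\<forall>y1 z1. z1 = y1^3 / 24 \<and> z1 > 0 \<longrightarrow>
        exactly_two_optimal q0 (0, y1, z1)
          (two_arcs (X_comb 1 1) (y1 / 2) (X_comb (- 1) 1)) y1
          (two_arcs (X_comb (- 1) 1) (y1 / 2) (X_comb 1 1)) y1)
   \<and> (\<forall>x1 y1 z1. \<forall>\<sigma> \<in> {1, -1}. sgn x1 = \<sigma> \<and> y1 = \<sigma> * x1 \<and> z1 = y1^3 / 6 \<longrightarrow>
        unique_optimal q0 (x1, y1, z1) (\<lambda>t. flow (X_comb \<sigma> 1) t q0) y1)"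
proof (intro conjI ballI allI impI; (elim conjE)?)
  show "\<exists>lam t1. Exp_preimages (N_plus \<union> N_minus) q1 = {(lam, t1)} \<and> unique_optimal q0 q1 (Exp lam) t1"
    if "q1 \<in> interior (attainable q0) - plane_x0" for q1
    by (rule interior_off_plane[OF that])
  show "\<exists>lam1 lam2 t1. lam1 \<noteq> lam2 \<and> Exp_preimages N_zero q1 = {(lam1, t1), (lam2, t1)} \<and>
      exactly_two_optimal q0 q1 (Exp lam1) t1 (Exp lam2) t1"
    if "q1 \<in> interior (attainable q0) \<inter> plane_x0" for q1
    by (rule interior_on_plane[OF that])
  show "unique_optimal q0 (x1, y1, z1) (two_arcs (X_comb \<sigma> 1) ((y1 + \<sigma> * x1) / 2) (X_comb (- \<sigma>) 1)) y1"
    if "\<sigma> \<in> {1, -1}" "(x1, y1, z1) \<in> S1 \<union> S2" "sgn x1 = \<sigma>" for x1 y1 z1 \<sigma>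
    by (rule upper_boundary_unique[OF that(2,3,1)])
  show "unique_optimal q0 (x1, y1, z1) (two_arcs X2 (y1 - \<sigma> * x1) (X_comb \<sigma> 1)) y1"
    if "\<sigma> \<in> {1, -1}" "(x1, y1, z1) \<in> S3 \<union> S4" "sgn x1 = \<sigma>" for x1 y1 z1 \<sigma>
    by (rule lower_boundary_unique[OF that(2,3,1)])
  show "unique_optimal q0 (0, y1, 0) (\<lambda>t. flow X2 t q0) y1" if "0 < y1" for y1
    by (rule vertical_unique[OF that])
  show "exactly_two_optimal q0 (0, y1, z1) (two_arcs (X_comb 1 1) (y1 / 2) (X_comb (- 1) 1)) y1
      (two_arcs (X_comb (- 1) 1) (y1 / 2) (X_comb 1 1)) y1" if "z1 = y1^3 / 24" "z1 > 0" for y1 z1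
    by (rule peak_two[OF that])
  show "unique_optimal q0 (x1, y1, z1) (\<lambda>t. flow (X_comb \<sigma> 1) t q0) y1"
    if "\<sigma> \<in> {1, -1}" "sgn x1 = \<sigma>" "y1 = \<sigma> * x1" "z1 = y1^3 / 6" for x1 y1 z1 \<sigma>
    by (rule straight_unique[OF that(2,1,3,4)])
qed

end
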